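(* Let $\Gamma$ be a CGV typing environment, $\phi\in\{\mathsf{main},\lozenge\}$ a thread marker, $C,D$ CGV configurations and $T$ a CGV type. If $\Gamma\vdash_{\mathtt C}^{\phi} C:T$ and either $C\equiv_{\mathtt C} D$ or $C\longrightarrow_{\mathtt C} D$, then $\Gamma\vdash_{\mathtt C}^{\phi} D:T$.
   Context: **CGV (runtime) terms.** $x,y,\ldots$ are variables; $\ell,i,j$ labels; $I$ a set of labels. $L,M,N ::= x \mid () \mid \lambda x.M \mid M\,N \mid (M,N) \mid \mathsf{let}\,(x,y)=M\,\mathsf{in}\,N \mid \mathsf{new} \mid \mathsf{spawn}\,M \mid \mathsf{send}\,M \mid \mathsf{recv}\,M \mid \mathsf{select}\,\ell\,M \mid \mathsf{case}\,M\,\mathsf{of}\,\{i:M_i\}_{i\in I} \mid M\{\!\{N/x\}\!\} \mid \mathsf{send}'(M,N)$. $\lambda x.M$ binds $x$ in $M$; $\mathsf{let}\,(x,y)=M\,\mathsf{in}\,N$ binds $x,y$ in $N$; the explicit substitution $M\{\!\{N/x\}\!\}$ binds $x$ in $M$. $\mathrm{fn}$ denotes free variables; $M\{y/x\}$ is ordinary substitution of $y$ for $x$. Conventions: in $(\lambda x.M)\,N$, $x\notin\mathrm{fn}(N)$; in $\mathsf{let}\,(x,y)=M\,\mathsf{in}\,N$, $x\neq y$ and $x,y\notin\mathrm{fn}(M)$. Reduction contexts: $\mathcal R ::= [] \mid \mathcal R\,M \mid \mathsf{spawn}\,\mathcal R \mid \mathsf{send}\,\mathcal R \mid \mathsf{recv}\,\mathcal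 R \mid \mathsf{let}\,(x,y)=\mathcal R\,\mathsf{in}\,M \mid \mathsf{select}\,\ell\,\mathcal R \mid \mathsf{case}\,\mathcal R\,\mathsf{of}\,\{i:M_i\}_{i\in I} \mid \mathcal R\{\!\{M/x\}\!\} \mid M\{\!\{\mathcal R/x\}\!\} \mid \mathsf{send}'(M,\mathcal R)$. $\mathcal R[M]$ replaces the hole by $M$; $\mathrm{fn}(\mathcal R)=\mathrm{fn}(\mathcal R[()])$ (similarly for other contexts). Structural congruence $\equiv_{\mathtt M}$ on terms is the congruence generated by: $(\mathcal R[M])\{\!\{N/x\}\!\}\equiv_{\mathtt M}\mathcal R[M\{\!\{N/x\}\!\}]$ if $x\notin\mathrm{fn}(\mathcal R)$. Term reduction $\longrightarrow_{\mathtt M}$ is generated by: $(\lambda x.M)\,N\longrightarrow_{\mathtt M} M\{\!\{N/x\}\!\}$; $\mathsf{let}\,(x,y)=(M_1,M_2)\,\mathsf{in}\,N\longrightarrow_{\mathtt M} N\{\!\{M_1/x\}\!\}\{\!\{M_2/y\}\!\}$; $M\{\!\{y/x\}\!\}\longrightarrow_{\mathtt M} M\{y/x\}$; $x\{\!\{M/x\}\!\}\longrightarrow_{\mathtt M} M$; $\mathsf{send}\,(M,N)\longrightarrow_{\mathtt M}\mathsf{send}'(M,N)$; closure under reduction contexts ($M\longrightarrow_{\mathtt M}N$ implies $\mathcal R[M]\longrightarrow_{\mathtt M}\mathcal R[N]$) and under $\equiv_{\mathtt M}$ on both sides. **Configurations.** Markers $\phi ::= \mathsf{main}\mid\lozenge$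 (main / child). Messages $m,n ::= M\mid\ell$; $\vec m$ is a finite sequence of messages, $\epsilon$ the empty one. $C,D,E ::= \phi\,M \mid C\parallel D \mid (\nu x[\vec m\rangle y)C \mid C\{\!\{M/x\}\!\}$. $(\nu x[\vec m\rangle y)C$ (buffered restriction) binds $x,y$; $C\{\!\{M/x\}\!\}$ binds $x$ in $C$. Thread contexts $\mathcal F ::= \phi\,\mathcal R\mid C\{\!\{\mathcal R/x\}\!\}$; $\hat{\mathcal F}$ denotes a thread context whose hole does not occur under an explicit substitution, i.e. it is not built using the clause $\mathcal R\{\!\{M/x\}\!\}$. Configuration contexts $\mathcal G ::= []\mid\mathcal G\parallel C\mid(\nu x[\vec m\rangle y)\mathcal G\mid\mathcal G\{\!\{M/x\}\!\}$. Structural congruence $\equiv_{\mathtt C}$ is the congruence generated by: $\phi\,M\equiv_{\mathtt C}\phi\,M'$ if $M\equiv_{\mathtt M}M'$; $(\nu x[\epsilon\rangle y)C\equiv_{\mathtt C}(\nu y[\epsilon\rangle x)C$; $(\nu x[\vec m\rangle y)(\nu z[\vec n\rangle w)C\equiv_{\mathtt C}(\nu z[\vec n\rangle w)(\nu x[\vec m\rangle y)C$; $(\nu x[\vec m\rangle y)(C\parallel D)\equiv_{\mathtt C}C\parallel(\nu x[\vec m\rangle y)D$ if $x,y\notin\mathrm{fn}(C)$; $(\nu x[\epsilon\rangle y)C\equiv_{\mathtt C}C$ if $x,y\notin\mathrm{fn}(C)$; $(\nu x[\vec m\rangle y)(\hat{\mathcal F}[\mathsf{send}'(M,x)]\parallel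 C)\equiv_{\mathtt C}(\nu x[M,\vec m\rangle y)(\hat{\mathcal F}[x]\parallel C)$; $(\nu x[\vec m\rangle y)(\mathcal F[\mathsf{select}\,\ell\,x]\parallel C)\equiv_{\mathtt C}(\nu x[\ell,\vec m\rangle y)(\mathcal F[x]\parallel C)$; $C\parallel\lozenge\,()\equiv_{\mathtt C}C$; commutativity and associativity of $\parallel$; $\phi\,(M\{\!\{N/x\}\!\})\equiv_{\mathtt C}(\phi\,M)\{\!\{N/x\}\!\}$; $(\mathcal G[C])\{\!\{M/x\}\!\}\equiv_{\mathtt C}\mathcal G[C\{\!\{M/x\}\!\}]$ if $x\notin\mathrm{fn}(\mathcal G)$. Configuration reduction $\longrightarrow_{\mathtt C}$ is generated by: $\mathcal F[\mathsf{new}]\longrightarrow_{\mathtt C}(\nu x[\epsilon\rangle y)(\mathcal F[(x,y)])$ ($x,y$ fresh); $\hat{\mathcal F}[\mathsf{spawn}\,(M,N)]\longrightarrow_{\mathtt C}\hat{\mathcal F}[N]\parallel\lozenge\,M$; $(\nu x[\vec m,M\rangle y)(\hat{\mathcal F}[\mathsf{recv}\,y]\parallel C)\longrightarrow_{\mathtt C}(\nu x[\vec m\rangle y)(\hat{\mathcal F}[(M,y)]\parallel C)$; $(\nu x[\vec m,j\rangle y)(\mathcal F[\mathsf{case}\,y\,\mathsf{of}\,\{i:M_i\}_{i\in I}]\parallel C)\longrightarrow_{\mathtt C}(\nu x[\vec m\rangle y)(\mathcal F[M_j\,y]\parallel C)$ if $j\in I$; $C\longrightarrow_{\mathtt C}C'$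 implies $\mathcal G[C]\longrightarrow_{\mathtt C}\mathcal G[C']$; $M\longrightarrow_{\mathtt M}M'$ implies $\mathcal F[M]\longrightarrow_{\mathtt C}\mathcal F[M']$; closure under $\equiv_{\mathtt C}$ on both sides. **Types.** $T,U ::= T\times U\mid T\multimap U\mid\mathbf 1\mid S$ and session types $S ::= {!}T.S\mid{?}T.S\mid\oplus\{i:S_i\}_{i\in I}\mid\&\{i:S_i\}_{i\in I}\mid\mathsf{end}$. Duality: $\overline{!T.S}={?}T.\overline S$, $\overline{?T.S}={!}T.\overline S$, $\overline{\oplus\{i:S_i\}}=\&\{i:\overline{S_i}\}$, $\overline{\&\{i:S_i\}}=\oplus\{i:\overline{S_i}\}$, $\overline{\mathsf{end}}=\mathsf{end}$. Typing environments $\Gamma,\Delta,\Lambda$ are finite assignments $x:T$ to distinct variables; writing $\Gamma,\Delta$ presupposes disjoint domains. **Term typing** $\Gamma\vdash_{\mathtt M}M:T$ (premises $\Rightarrow$ conclusion): T-Var: $x:T\vdash_{\mathtt M}x:T$. T-Abs: $\Gamma,x:T\vdash_{\mathtt M}M:U\Rightarrow\Gamma\vdash_{\mathtt M}\lambda x.M:T\multimap U$. T-App: $\Gamma\vdash_{\mathtt M}M:T\multimap U$, $\Delta\vdash_{\mathtt M}N:T\Rightarrow\Gamma,\Delta\vdash_{\mathtt M}M\,N:U$. T-Unit: $\emptyset\vdash_{\mathtt M}():\mathbf 1$. T-Pair: $\Gamma\vdash_{\mathtt M}M:T$, $\Delta\vdash_{\mathtt M}N:U\Rightarrow\Gamma,\Delta\vdash_{\mathtt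 M}(M,N):T\times U$. T-Split: $\Gamma\vdash_{\mathtt M}M:T\times T'$, $\Delta,x:T,y:T'\vdash_{\mathtt M}N:U\Rightarrow\Gamma,\Delta\vdash_{\mathtt M}\mathsf{let}\,(x,y)=M\,\mathsf{in}\,N:U$. T-New: $\emptyset\vdash_{\mathtt M}\mathsf{new}:S\times\overline S$. T-Spawn: $\Gamma\vdash_{\mathtt M}M:\mathbf 1\times T\Rightarrow\Gamma\vdash_{\mathtt M}\mathsf{spawn}\,M:T$. T-EndL: $\Gamma\vdash_{\mathtt M}M:T\Rightarrow\Gamma,x:\mathsf{end}\vdash_{\mathtt M}M:T$. T-EndR: $\emptyset\vdash_{\mathtt M}x:\mathsf{end}$. T-Send: $\Gamma\vdash_{\mathtt M}M:T\times{!}T.S\Rightarrow\Gamma\vdash_{\mathtt M}\mathsf{send}\,M:S$. T-Recv: $\Gamma\vdash_{\mathtt M}M:{?}T.S\Rightarrow\Gamma\vdash_{\mathtt M}\mathsf{recv}\,M:T\times S$. T-Select: $\Gamma\vdash_{\mathtt M}M:\oplus\{i:T_i\}_{i\in I}$, $j\in I\Rightarrow\Gamma\vdash_{\mathtt M}\mathsf{select}\,j\,M:T_j$. T-Case: $\Gamma\vdash_{\mathtt M}M:\&\{i:T_i\}_{i\in I}$, $\forall i\in I.\ \Delta\vdash_{\mathtt M}N_i:T_i\multimap U\Rightarrow\Gamma,\Delta\vdash_{\mathtt M}\mathsf{case}\,M\,\mathsf{of}\,\{i:N_i\}_{i\in I}:U$. T-Sub: $\Gamma,x:T\vdash_{\mathtt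 M}M:U$, $\Delta\vdash_{\mathtt M}N:T\Rightarrow\Gamma,\Delta\vdash_{\mathtt M}M\{\!\{N/x\}\!\}:U$. T-Send': $\Gamma\vdash_{\mathtt M}M:T$, $\Delta\vdash_{\mathtt M}N:{!}T.S\Rightarrow\Gamma,\Delta\vdash_{\mathtt M}\mathsf{send}'(M,N):S$. **Buffer typing** $\Gamma\vdash_{\mathtt B}[\vec m\rangle:S'>S$: T-Buf: $\emptyset\vdash_{\mathtt B}[\epsilon\rangle:S'>S'$. T-BufSend: $\Gamma\vdash_{\mathtt M}M:T$, $\Delta\vdash_{\mathtt B}[\vec m\rangle:S'>S\Rightarrow\Gamma,\Delta\vdash_{\mathtt B}[\vec m,M\rangle:S'>{!}T.S$. T-BufSelect: $\Gamma\vdash_{\mathtt B}[\vec m\rangle:S'>S_j$, $j\in I\Rightarrow\Gamma\vdash_{\mathtt B}[\vec m,j\rangle:S'>\oplus\{i:S_i\}_{i\in I}$. **Configuration typing** $\Gamma\vdash^\phi_{\mathtt C}C:T$, with $\mathsf{main}+\lozenge=\lozenge+\mathsf{main}=\mathsf{main}$, $\lozenge+\lozenge=\lozenge$, $\mathsf{main}+\mathsf{main}$ undefined: T-Main: $\Gamma\vdash_{\mathtt M}M:T\Rightarrow\Gamma\vdash^{\mathsf{main}}_{\mathtt C}\mathsf{main}\,M:T$. T-Child: $\Gamma\vdash_{\mathtt M}M:\mathbf 1\Rightarrow\Gamma\vdash^{\lozenge}_{\mathtt C}\lozenge\,M:\mathbf 1$. T-ParL: $\Gamma\vdash^{\lozenge}_{\mathtt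 C}C:\mathbf 1$, $\Delta\vdash^\phi_{\mathtt C}D:T\Rightarrow\Gamma,\Delta\vdash^{\lozenge+\phi}_{\mathtt C}C\parallel D:T$. T-ParR: $\Gamma\vdash^\phi_{\mathtt C}C:T$, $\Delta\vdash^{\lozenge}_{\mathtt C}D:\mathbf 1\Rightarrow\Gamma,\Delta\vdash^{\phi+\lozenge}_{\mathtt C}C\parallel D:T$. T-Res: $\Gamma\vdash_{\mathtt B}[\vec m\rangle:S'>S$, $\Delta,x:S',y:\overline S\vdash^\phi_{\mathtt C}C:T\Rightarrow\Gamma,\Delta\vdash^\phi_{\mathtt C}(\nu x[\vec m\rangle y)C:T$. T-ResBuf: $\Gamma,y:\overline S\vdash_{\mathtt B}[\vec m\rangle:S'>S$, $\Delta,x:S'\vdash^\phi_{\mathtt C}C:T\Rightarrow\Gamma,\Delta\vdash^\phi_{\mathtt C}(\nu x[\vec m\rangle y)C:T$. T-ConfSub: $\Gamma,x:T\vdash^\phi_{\mathtt C}C:U$, $\Delta\vdash_{\mathtt M}M:T\Rightarrow\Gamma,\Delta\vdash^\phi_{\mathtt C}C\{\!\{M/x\}\!\}:U$.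
   Formalization: The ≡ rules moving send'(M,x) and select ℓ x into the buffer are restricted to x not free in the thread context or in C, and T-Case requires I nonempty; without these, dummy uses of x via T-EndR or an empty case break preservation. *)

theory Defs
  imports "HOL-Library.Finite_Map"
begin

section \<open>Terms\<close>

text \<open>
  Terms are identified up to renaming of bound variables.  The datatype below is the usual
  canonical representation of these classes: free variables are the natural numbers (used as
  names), and the constructors \<open>dbAbs\<close>, \<open>dbSplit\<close>, \<open>dbESub\<close> are nameless binders.
  Nothing after the named binders \<open>Lam\<close>, \<open>LetP\<close>, \<open>ESub\<close> (and \<open>Res\<close>, \<open>CSub\<close> for
  configurations) have been introduced refers to the nameless ones.  Labels are the elements of
  an arbitrary type \<open>'l\<close>, and a family indexed by a finite set of labels is a finite map.
\<close>

type_synonym var = nat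

datatype 'l tm =
    Var var
  | Triv
  | dbAbs "'l tm"
  | App "'l tm" "'l tm"
  | Tup "'l tm" "'l tm"
  | dbSplit "'l tm" "'l tm"
  | New
  | Spawn "'l tm"
  | Send "'l tm"
  | Recv "'l tm"
  | Select 'l "'l tm"
  | Case "'l tm" "('l, 'l tm) fmap"
  | dbESub "'l tm" "'l tm"
  | SendP "'l tm" "'l tm"

text \<open>Indices \<open>0\<close> (and \<open>1\<close>) are bound in the body of a nameless binder;
  \<open>lift\<close> moves a renaming under one bound index.\<close>

definition lift :: "(nat \<Rightarrow> nat) \<Rightarrow> nat \<Rightarrow> nat" where
  "lift f n = (case n of 0 \<Rightarrow> 0 | Suc k \<Rightarrow> Suc (f k))"

primrec rename :: "(var \<Rightarrow> var) \<Rightarrow> 'l tm \<Rightarrow> 'l tm" where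
  "rename f (Var x) = Var (f x)"
| "rename f Triv = Triv"
| "rename f (dbAbs M) = dbAbs (rename (lift f) M)"
| "rename f (App M N) = App (rename f M) (rename f N)"
| "rename f (Tup M N) = Tup (rename f M) (rename f N)"
| "rename f (dbSplit M N) = dbSplit (rename f M) (rename (lift (lift f)) N)"
| "rename f New = New"
| "rename f (Spawn M) = Spawn (rename f M)"
| "rename f (Send M) = Send (rename f M)"
| "rename f (Recv M) = Recv (rename f M)"
| "rename f (Select l M) = Select l (rename f M)"
| "rename f (Case M B) = Case (rename f M) (fmmap (rename f) B)"
| "rename f (dbESub M N) = dbESub (rename (lift f) M) (rename f N)"
| "rename f (SendP M N) = SendP (rename f M) (rename f N)"

primrec fn :: "'l tm \<Rightarrow> var set" where
  "fn (Var x) = {x}"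
| "fn Triv = {}"
| "fn (dbAbs M) = {n. Suc n \<in> fn M}"
| "fn (App M N) = fn M \<union> fn N"
| "fn (Tup M N) = fn M \<union> fn N"
| "fn (dbSplit M N) = fn M \<union> {n. Suc (Suc n) \<in> fn N}"
| "fn New = {}"
| "fn (Spawn M) = fn M"
| "fn (Send M) = fn M"
| "fn (Recv M) = fn M"
| "fn (Select l M) = fn M"
| "fn (Case M B) = fn M \<union> \<Union> (fmran' (fmmap fn B))"
| "fn (dbESub M N) = {n. Suc n \<in> fn M} \<union> fn N"
| "fn (SendP M N) = fn M \<union> fn N"

definition bind1 :: "var \<Rightarrow> var \<Rightarrow> nat" where
  "bind1 x n = (if n = x then 0 else Suc n)"

definition bind2 :: "var \<Rightarrow> var \<Rightarrow> var \<Rightarrow> nat" where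
  "bind2 x y n = (if n = x then 0 else if n = y then 1 else Suc (Suc n))"

text \<open>\<open>LetP x y M N\<close> is \<open>let (x,y) = M in N\<close>, and \<open>ESub M N x\<close> is the explicit
  substitution \<open>M{{N/x}}\<close>.\<close>

definition Lam :: "var \<Rightarrow> 'l tm \<Rightarrow> 'l tm" where
  "Lam x M = dbAbs (rename (bind1 x) M)"

definition LetP :: "var \<Rightarrow> var \<Rightarrow> 'l tm \<Rightarrow> 'l tm \<Rightarrow> 'l tm" where
  "LetP x y M N = dbSplit M (rename (bind2 x y) N)"

definition ESub :: "'l tm \<Rightarrow> 'l tm \<Rightarrow> var \<Rightarrow> 'l tm" where
  "ESub M N x = dbESub (rename (bind1 x) M) N"

text \<open>The ordinary substitution \<open>M{y/x}\<close> of a variable for a variable; it avoids capture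
  because \<open>rename\<close> lifts the renaming under binders.\<close>

definition subst_var :: "'l tm \<Rightarrow> var \<Rightarrow> var \<Rightarrow> 'l tm" where
  "subst_var M y x = rename (id(x := y)) M"

subsection \<open>The named binders behave as binders\<close>

lemma lift_simps [simp]: "lift f 0 = 0" "lift f (Suc n) = Suc (f n)"
  by (simp_all add: lift_def)

lemma lift_comp: "lift f \<circ> lift g = lift (f \<circ> g)"
  by (rule ext) (simp add: lift_def split: nat.split)

lemma rename_rename: "rename f (rename g M) = rename (f \<circ> g) M"
proof (induction M arbitrary: f g)
  case (Case M B)
  have "fmmap (rename f \<circ> rename g) B = fmmap (rename (f \<circ> g)) B"
    by (rule fmap.map_cong0) (subst comp_apply, rule Case.IH(2))
  then show ?case by (simp add: Case.IH(1) fmap.map_comp del: o_apply)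
qed (simp_all add: lift_comp)

lemma rename_cong: "(\<And>n. n \<in> fn M \<Longrightarrow> f n = g n) \<Longrightarrow> rename f M = rename g M"
proof (induction M arbitrary: f g)
  case (dbAbs M)
  have "rename (lift f) M = rename (lift g) M"
    using dbAbs.prems by (intro dbAbs.IH) (auto simp: lift_def split: nat.split)
  then show ?case by simp
next
  case (dbSplit M N)
  have "rename (lift (lift f)) N = rename (lift (lift g)) N"
    using dbSplit.prems by (intro dbSplit.IH) (auto simp: lift_def split: nat.split)
  moreover have "rename f M = rename g M"
    using dbSplit.prems by (intro dbSplit.IH) auto
  ultimately show ?case by simp
next
  case (dbESub M N)
  have "rename (lift f) M = rename (lift g) M"
    using dbESub.prems by (intro dbESub.IH) (auto simp: lift_def split: nat.split)
  moreover have "rename f N = rename g N"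
    using dbESub.prems by (intro dbESub.IH) auto
  ultimately show ?case by simp
next
  case (Case M B)
  have "rename f M = rename g M"
    using Case.prems by (intro Case.IH) auto
  moreover have "fmmap (rename f) B = fmmap (rename g) B"
  proof (rule fmap.map_cong0)
    fix N assume N: "N \<in> fmran' B"
    show "rename f N = rename g N"
      using N Case.prems by (intro Case.IH(2)[OF N]) (auto simp: fmap.set_map)
  qed
  ultimately show ?case by simp
next
  case (App M N)
  show ?case using App.prems by (auto intro!: App.IH)
next
  case (Tup M N)
  show ?case using Tup.prems by (auto intro!: Tup.IH)
next
  case (SendP M N)
  show ?case using SendP.prems by (auto intro!: SendP.IH)
next
  case (Spawn M)
  show ?case using Spawn.prems by (auto intro!: Spawn.IH)
next
  case (Send M)
  show ?case using Send.prems by (auto intro!: Send.IH)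
next
  case (Recv M)
  show ?case using Recv.prems by (auto intro!: Recv.IH)
next
  case (Select l M)
  show ?case using Select.prems by (auto intro!: Select.IH)
qed simp_all

lemma lift_vimage: "{n. Suc n \<in> lift f ` A} = f ` {n. Suc n \<in> A}"
proof (intro set_eqI iffI)
  fix n assume "n \<in> {n. Suc n \<in> lift f ` A}"
  then obtain k where "k \<in> A" "Suc n = lift f k" by auto
  then show "n \<in> f ` {n. Suc n \<in> A}" by (cases k) auto
next
  fix n assume "n \<in> f ` {n. Suc n \<in> A}"
  then obtain k where "Suc k \<in> A" "n = f k" by auto
  then have "Suc n = lift f (Suc k)" by simp
  with \<open>Suc k \<in> A\<close> show "n \<in> {n. Suc n \<in> lift f ` A}" by blast
qed

lemma lift_vimage2: "{n. Suc (Suc n) \<in> lift (lift f) ` A} = f ` {n. Suc (Suc n) \<in> A}"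
proof -
  have "{n. Suc n \<in> {k. Suc k \<in> lift (lift f) ` A}} = f ` {n. Suc n \<in> {k. Suc k \<in> A}}"
    by (simp only: lift_vimage)
  then show ?thesis by simp
qed

lemma fn_rename: "fn (rename f M) = f ` fn M"
proof (induction M arbitrary: f)
  case (Case M B)
  then show ?case by (simp add: fmap.set_map image_Un image_UN)
qed (simp_all add: image_Un lift_vimage lift_vimage2)

lemma finite_fn: "finite (fn M)"
proof (induction M)
  case (Case M B)
  then show ?case by (auto simp: fmap.set_map fmran'_alt_def)
next
  case (dbAbs M)
  then show ?case using finite_vimageI[of "fn M" Suc] by (simp add: vimage_def)
next
  case (dbSplit M N)
  then show ?case using finite_vimageI[of "fn N" "Suc \<circ> Suc"]
    by (simp add: vimage_def inj_def)
next
  case (dbESub M N)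
  then show ?case using finite_vimageI[of "fn M" Suc] by (simp add: vimage_def)
qed simp_all

lemma bind_vimage:
  "{n. Suc n \<in> bind1 x ` A} = A - {x}" "{n. Suc (Suc n) \<in> bind2 x y ` A} = A - {x, y}"
  by (auto simp: bind1_def bind2_def split: if_splits)

lemma fn_Lam: "fn (Lam x M) = fn M - {x}"
  by (simp add: Lam_def fn_rename bind_vimage)

lemma fn_LetP: "fn (LetP x y M N) = fn M \<union> (fn N - {x, y})"
  by (simp add: LetP_def fn_rename bind_vimage)

lemma fn_ESub: "fn (ESub M N x) = (fn M - {x}) \<union> fn N"
  by (simp add: ESub_def fn_rename bind_vimage)

lemma Lam_alpha: "z \<notin> fn M \<Longrightarrow> Lam z (subst_var M z x) = Lam x M"
  by (auto simp: Lam_def subst_var_def rename_rename bind1_def intro!: rename_cong)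

lemma ESub_alpha: "z \<notin> fn M \<Longrightarrow> ESub (subst_var M z x) N z = ESub M N x"
  by (auto simp: ESub_def subst_var_def rename_rename bind1_def intro!: rename_cong)

lemma LetP_alpha:
  assumes "x \<noteq> y" "z \<noteq> w" "z \<notin> fn N" "w \<notin> fn N"
  shows "LetP z w M (rename (id(x := z, y := w)) N) = LetP x y M N"
  using assms by (auto simp: LetP_def rename_rename bind2_def intro!: rename_cong)

lemma rename_id: "rename id M = M"
proof -
  have lift_id: "lift (\<lambda>n. n) = (\<lambda>n. n)"
    by (rule ext) (simp add: lift_def split: nat.split)
  have "rename (\<lambda>n. n) M = M"
  proof (induction M)
    case (Case M B)
    have "fmmap (rename (\<lambda>n. n)) B = fmmap id B"
      by (rule fmap.map_cong0) (simp add: Case.IH(2))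
    then show ?case by (simp only: rename.simps Case.IH(1) fmap.map_id)
  qed (simp_all add: lift_id)
  then show ?thesis by (simp add: id_def)
qed

text \<open>Every nameless binder is a named one, for all sufficiently fresh names.\<close>

lemma dbAbs_eq_Lam:
  assumes "x \<notin> fn (dbAbs M)"
  shows "dbAbs M = Lam x (rename (case_nat x id) M)"
proof -
  have "rename (bind1 x \<circ> case_nat x id) M = rename id M"
    using assms by (intro rename_cong) (auto simp: bind1_def split: nat.splits)
  then show ?thesis by (simp only: Lam_def rename_rename rename_id)
qed

lemma dbESub_eq_ESub:
  assumes "x \<notin> fn (dbAbs M)"
  shows "dbESub M N = ESub (rename (case_nat x id) M) N x"
  using dbAbs_eq_Lam[OF assms] by (simp add: Lam_def ESub_def)

lemma dbSplit_eq_LetP: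
  assumes "x \<noteq> y" "x \<notin> fn (dbSplit M N)" "y \<notin> fn (dbSplit M N)"
  shows "dbSplit M N = LetP x y M (rename (case_nat x (case_nat y id)) N)"
proof -
  have "rename (bind2 x y \<circ> case_nat x (case_nat y id)) N = rename id N"
    using assms by (intro rename_cong) (auto simp: bind2_def split: nat.splits)
  then show ?thesis by (simp only: LetP_def rename_rename rename_id)
qed

section \<open>Reduction contexts, structural congruence and reduction of terms\<close>

text \<open>Contexts are not identified up to renaming: filling the hole may capture, and \<open>binders\<close>
  collects the names that scope over the hole.\<close>

datatype 'l rctx =
    RHole
  | RApp "'l rctx" "'l tm"
  | RSpawn "'l rctx"
  | RSend "'l rctx"
  | RRecv "'l rctx"
  | RLetP var var "'l rctx" "'l tm"
  | RSelect 'l "'l rctx"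
  | RCase "'l rctx" "('l, 'l tm) fmap"
  | RESubL "'l rctx" "'l tm" var
  | RESubR "'l tm" "'l rctx" var
  | RSendP "'l tm" "'l rctx"

primrec rplug :: "'l rctx \<Rightarrow> 'l tm \<Rightarrow> 'l tm" where
  "rplug RHole L = L"
| "rplug (RApp R M) L = App (rplug R L) M"
| "rplug (RSpawn R) L = Spawn (rplug R L)"
| "rplug (RSend R) L = Send (rplug R L)"
| "rplug (RRecv R) L = Recv (rplug R L)"
| "rplug (RLetP x y R M) L = LetP x y (rplug R L) M"
| "rplug (RSelect l R) L = Select l (rplug R L)"
| "rplug (RCase R B) L = Case (rplug R L) B"
| "rplug (RESubL R M x) L = ESub (rplug R L) M x"
| "rplug (RESubR M R x) L = ESub M (rplug R L) x"
| "rplug (RSendP M R) L = SendP M (rplug R L)"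

primrec rbinders :: "'l rctx \<Rightarrow> var set" where
  "rbinders RHole = {}"
| "rbinders (RApp R M) = rbinders R"
| "rbinders (RSpawn R) = rbinders R"
| "rbinders (RSend R) = rbinders R"
| "rbinders (RRecv R) = rbinders R"
| "rbinders (RLetP x y R M) = rbinders R"
| "rbinders (RSelect l R) = rbinders R"
| "rbinders (RCase R B) = rbinders R"
| "rbinders (RESubL R M x) = insert x (rbinders R)"
| "rbinders (RESubR M R x) = rbinders R"
| "rbinders (RSendP M R) = rbinders R"

text \<open>The hole does not occur under an explicit substitution, i.e. \<open>RESubL\<close> is not used.\<close>

primrec rhat :: "'l rctx \<Rightarrow> bool" where
  "rhat RHole \<longleftrightarrow> True"
| "rhat (RApp R M) \<longleftrightarrow> rhat R"
| "rhat (RSpawn R) \<longleftrightarrow> rhat R"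
| "rhat (RSend R) \<longleftrightarrow> rhat R"
| "rhat (RRecv R) \<longleftrightarrow> rhat R"
| "rhat (RLetP x y R M) \<longleftrightarrow> rhat R"
| "rhat (RSelect l R) \<longleftrightarrow> rhat R"
| "rhat (RCase R B) \<longleftrightarrow> rhat R"
| "rhat (RESubL R M x) \<longleftrightarrow> False"
| "rhat (RESubR M R x) \<longleftrightarrow> rhat R"
| "rhat (RSendP M R) \<longleftrightarrow> rhat R"

definition rfn :: "'l rctx \<Rightarrow> var set" where
  "rfn R = fn (rplug R Triv)"

text \<open>
  As usual for calculi with binders, an equation or reduction that moves a subterm \<open>N\<close> or an
  occurrence of a name across a binder presupposes that nothing is captured and nothing escapes
  its scope.  Since contexts carry concrete names, this is expressed by side conditions
  on \<open>rbinders\<close> (below also \<open>fbinders\<close> and \<open>gbinders\<close>) and by distinctness of bound names.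
\<close>

inductive scongM :: "'l tm \<Rightarrow> 'l tm \<Rightarrow> bool" (infix "\<equiv>\<^sub>M" 50) where
  SCM_Sub: "x \<notin> rfn R \<Longrightarrow> x \<notin> rbinders R \<Longrightarrow> rbinders R \<inter> fn N = {} \<Longrightarrow>
    ESub (rplug R M) N x \<equiv>\<^sub>M rplug R (ESub M N x)"
| SCM_refl: "M \<equiv>\<^sub>M M"
| SCM_sym: "M \<equiv>\<^sub>M N \<Longrightarrow> N \<equiv>\<^sub>M M"
| SCM_trans: "L \<equiv>\<^sub>M M \<Longrightarrow> M \<equiv>\<^sub>M N \<Longrightarrow> L \<equiv>\<^sub>M N"
| SCM_Lam: "M \<equiv>\<^sub>M M' \<Longrightarrow> Lam x M \<equiv>\<^sub>M Lam x M'"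
| SCM_App: "M \<equiv>\<^sub>M M' \<Longrightarrow> N \<equiv>\<^sub>M N' \<Longrightarrow> App M N \<equiv>\<^sub>M App M' N'"
| SCM_Tup: "M \<equiv>\<^sub>M M' \<Longrightarrow> N \<equiv>\<^sub>M N' \<Longrightarrow> Tup M N \<equiv>\<^sub>M Tup M' N'"
| SCM_LetP: "M \<equiv>\<^sub>M M' \<Longrightarrow> N \<equiv>\<^sub>M N' \<Longrightarrow> LetP x y M N \<equiv>\<^sub>M LetP x y M' N'"
| SCM_Spawn: "M \<equiv>\<^sub>M M' \<Longrightarrow> Spawn M \<equiv>\<^sub>M Spawn M'"
| SCM_Send: "M \<equiv>\<^sub>M M' \<Longrightarrow> Send M \<equiv>\<^sub>M Send M'"
| SCM_Recv: "M \<equiv>\<^sub>M M' \<Longrightarrow> Recv M \<equiv>\<^sub>M Recv M'"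
| SCM_Select: "M \<equiv>\<^sub>M M' \<Longrightarrow> Select l M \<equiv>\<^sub>M Select l M'"
| SCM_Case: "M \<equiv>\<^sub>M M' \<Longrightarrow> fmrel scongM B B' \<Longrightarrow> Case M B \<equiv>\<^sub>M Case M' B'"
| SCM_ESub: "M \<equiv>\<^sub>M M' \<Longrightarrow> N \<equiv>\<^sub>M N' \<Longrightarrow> ESub M N x \<equiv>\<^sub>M ESub M' N' x"
| SCM_SendP: "M \<equiv>\<^sub>M M' \<Longrightarrow> N \<equiv>\<^sub>M N' \<Longrightarrow> SendP M N \<equiv>\<^sub>M SendP M' N'"
monos fmap.rel_mono

inductive redM :: "'l tm \<Rightarrow> 'l tm \<Rightarrow> bool" (infix "\<longrightarrow>\<^sub>M" 50) where
  RM_Lam: "x \<notin> fn N \<Longrightarrow> App (Lam x M) N \<longrightarrow>\<^sub>M ESub M N x"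
| RM_Pair: "x \<noteq> y \<Longrightarrow> {x, y} \<inter> fn (Tup M1 M2) = {} \<Longrightarrow>
    LetP x y (Tup M1 M2) N \<longrightarrow>\<^sub>M ESub (ESub N M1 x) M2 y"
| RM_SubName: "ESub M (Var y) x \<longrightarrow>\<^sub>M subst_var M y x"
| RM_NameSub: "ESub (Var x) M x \<longrightarrow>\<^sub>M M"
| RM_Send: "Send (Tup M N) \<longrightarrow>\<^sub>M SendP M N"
| RM_Lift: "M \<longrightarrow>\<^sub>M N \<Longrightarrow> rplug R M \<longrightarrow>\<^sub>M rplug R N"
| RM_SC: "M \<equiv>\<^sub>M M' \<Longrightarrow> M' \<longrightarrow>\<^sub>M N' \<Longrightarrow> N' \<equiv>\<^sub>M N \<Longrightarrow> M \<longrightarrow>\<^sub>M N"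

section \<open>Configurations\<close>

datatype marker = Main | Child

datatype 'l msg = Val "'l tm" | Lbl 'l

datatype 'l conf =
    Thread marker "'l tm"
  | Par "'l conf" "'l conf" (infixr "\<parallel>" 60)
  | dbRes "'l msg list" "'l conf"
  | dbCSub "'l conf" "'l tm"

primrec rename_msg :: "(var \<Rightarrow> var) \<Rightarrow> 'l msg \<Rightarrow> 'l msg" where
  "rename_msg f (Val M) = Val (rename f M)"
| "rename_msg f (Lbl l) = Lbl l"

text \<open>In \<open>dbRes ms C\<close> the indices \<open>0\<close> and \<open>1\<close> are bound in the messages \<open>ms\<close> as well as in
  \<open>C\<close>; binding in the messages is what \<open>T_ResBuf\<close> requires.\<close>

primrec rename_conf :: "(var \<Rightarrow> var) \<Rightarrow> 'l conf \<Rightarrow> 'l conf" where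
  "rename_conf f (Thread \<phi> M) = Thread \<phi> (rename f M)"
| "rename_conf f (C \<parallel> D) = rename_conf f C \<parallel> rename_conf f D"
| "rename_conf f (dbRes ms C) =
    dbRes (map (rename_msg (lift (lift f))) ms) (rename_conf (lift (lift f)) C)"
| "rename_conf f (dbCSub C M) = dbCSub (rename_conf (lift f) C) (rename f M)"

primrec fn_msg :: "'l msg \<Rightarrow> var set" where
  "fn_msg (Val M) = fn M"
| "fn_msg (Lbl l) = {}"

definition fn_msgs :: "'l msg list \<Rightarrow> var set" where
  "fn_msgs ms = (\<Union>m \<in> set ms. fn_msg m)"

primrec fn_conf :: "'l conf \<Rightarrow> var set" where
  "fn_conf (Thread \<phi> M) = fn M"
| "fn_conf (C \<parallel> D) = fn_conf C \<union> fn_conf D"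
| "fn_conf (dbRes ms C) = {n. Suc (Suc n) \<in> fn_msgs ms \<union> fn_conf C}"
| "fn_conf (dbCSub C M) = {n. Suc n \<in> fn_conf C} \<union> fn M"

text \<open>\<open>Res x ms y C\<close> is the buffered restriction \<open>(\<nu>x[ms\<rangle>y)C\<close>, and \<open>CSub C M x\<close> is
  \<open>C{{M/x}}\<close>.\<close>

definition Res :: "var \<Rightarrow> 'l msg list \<Rightarrow> var \<Rightarrow> 'l conf \<Rightarrow> 'l conf" where
  "Res x ms y C = dbRes (map (rename_msg (bind2 x y)) ms) (rename_conf (bind2 x y) C)"

definition CSub :: "'l conf \<Rightarrow> 'l tm \<Rightarrow> var \<Rightarrow> 'l conf" where
  "CSub C M x = dbCSub (rename_conf (bind1 x) C) M"

lemma fn_msgs_rename: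
  fixes ms :: "'l msg list"
  shows "fn_msgs (map (rename_msg f) ms) = f ` fn_msgs ms"
proof -
  have "fn_msg (rename_msg f m) = f ` fn_msg m" for m :: "'l msg"
    by (cases m) (simp_all add: fn_rename)
  then show ?thesis by (simp add: fn_msgs_def image_UN)
qed

lemma fn_rename_conf: "fn_conf (rename_conf f C) = f ` fn_conf C"
proof (induction C arbitrary: f)
  case (dbRes ms C)
  have "{n. Suc (Suc n) \<in> lift (lift f) ` (fn_msgs ms \<union> fn_conf C)}
      = f ` {n. Suc (Suc n) \<in> fn_msgs ms \<union> fn_conf C}"
    by (rule lift_vimage2)
  then show ?case by (simp only: rename_conf.simps fn_conf.simps dbRes.IH fn_msgs_rename image_Un)
qed (simp_all add: fn_rename image_Un lift_vimage)

lemma fn_Res: "fn_conf (Res x ms y C) = (fn_msgs ms \<union> fn_conf C) - {x, y}"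
proof -
  have "{n. Suc (Suc n) \<in> bind2 x y ` (fn_msgs ms \<union> fn_conf C)} = fn_msgs ms \<union> fn_conf C - {x, y}"
    by (rule bind_vimage)
  then show ?thesis
    by (simp only: Res_def fn_conf.simps fn_msgs_rename fn_rename_conf image_Un)
qed

lemma fn_CSub: "fn_conf (CSub C M x) = (fn_conf C - {x}) \<union> fn M"
  by (simp add: CSub_def fn_rename_conf bind_vimage)

text \<open>Thread contexts; \<open>FCSub C R x\<close> is \<open>C{{R/x}}\<close>.\<close>

datatype 'l fctx = FThread marker "'l rctx" | FCSub "'l conf" "'l rctx" var

primrec fplug :: "'l fctx \<Rightarrow> 'l tm \<Rightarrow> 'l conf" where
  "fplug (FThread \<phi> R) M = Thread \<phi> (rplug R M)"
| "fplug (FCSub C R x) M = CSub C (rplug R M) x"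

primrec fbinders :: "'l fctx \<Rightarrow> var set" where
  "fbinders (FThread \<phi> R) = rbinders R"
| "fbinders (FCSub C R x) = rbinders R"

primrec fhat :: "'l fctx \<Rightarrow> bool" where
  "fhat (FThread \<phi> R) \<longleftrightarrow> rhat R"
| "fhat (FCSub C R x) \<longleftrightarrow> rhat R"

definition ffn :: "'l fctx \<Rightarrow> var set" where
  "ffn F = fn_conf (fplug F Triv)"

datatype 'l gctx =
    GHole
  | GPar "'l gctx" "'l conf"
  | GRes var "'l msg list" var "'l gctx"
  | GCSub "'l gctx" "'l tm" var

primrec gplug :: "'l gctx \<Rightarrow> 'l conf \<Rightarrow> 'l conf" where
  "gplug GHole C = C"
| "gplug (GPar G D) C = gplug G C \<parallel> D"
| "gplug (GRes x ms y G) C = Res x ms y (gplug G C)"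
| "gplug (GCSub G M x) C = CSub (gplug G C) M x"

primrec gbinders :: "'l gctx \<Rightarrow> var set" where
  "gbinders GHole = {}"
| "gbinders (GPar G D) = gbinders G"
| "gbinders (GRes x ms y G) = {x, y} \<union> gbinders G"
| "gbinders (GCSub G M x) = insert x (gbinders G)"

definition gfn :: "'l gctx \<Rightarrow> var set" where
  "gfn G = fn_conf (gplug G (Thread Child Triv))"

section \<open>Structural congruence and reduction of configurations\<close>

text \<open>
  The left end of a buffer is where the endpoint \<open>x\<close> writes, and the right end is where \<open>y\<close> reads.

  In \<open>SCC_Send\<close> and \<open>SCC_Select\<close> the displayed occurrence of the endpoint \<open>x\<close> is its only
  occurrence in the body of the restriction (outside a transmitted value).
  Rule \<open>T_EndR\<close> below types any variable with \<open>end\<close> without consuming an assumption.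
  Hence, read from right to left without this condition, the rules would also
  apply when the displayed \<open>x\<close> is such a dummy use of type \<open>end\<close> while the endpoint proper, at some
  other session type, is used elsewhere in \<open>F\<close> or \<open>C\<close>; the resulting configuration uses
  the endpoint twice and is not typable.
\<close>

inductive scongC :: "'l conf \<Rightarrow> 'l conf \<Rightarrow> bool" (infix "\<equiv>\<^sub>C" 50) where
  SCC_Term: "M \<equiv>\<^sub>M M' \<Longrightarrow> Thread \<phi> M \<equiv>\<^sub>C Thread \<phi> M'"
| SCC_ResSwap: "x \<noteq> y \<Longrightarrow> Res x [] y C \<equiv>\<^sub>C Res y [] x C"
| SCC_ResComm: "distinct [x, y, z, w] \<Longrightarrow> {x, y} \<inter> fn_msgs ns = {} \<Longrightarrow> {z, w} \<inter> fn_msgs ms = {} \<Longrightarrow>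
    Res x ms y (Res z ns w C) \<equiv>\<^sub>C Res z ns w (Res x ms y C)"
| SCC_ResExt: "x \<noteq> y \<Longrightarrow> x \<notin> fn_conf C \<Longrightarrow> y \<notin> fn_conf C \<Longrightarrow>
    Res x ms y (C \<parallel> D) \<equiv>\<^sub>C C \<parallel> Res x ms y D"
| SCC_ResNil: "x \<noteq> y \<Longrightarrow> x \<notin> fn_conf C \<Longrightarrow> y \<notin> fn_conf C \<Longrightarrow> Res x [] y C \<equiv>\<^sub>C C"
| SCC_Send: "x \<noteq> y \<Longrightarrow> fhat F \<Longrightarrow> x \<notin> ffn F \<Longrightarrow> x \<notin> fn_conf C \<Longrightarrow>
    Res x ms y (fplug F (SendP M (Var x)) \<parallel> C) \<equiv>\<^sub>C Res x (Val M # ms) y (fplug F (Var x) \<parallel> C)"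
| SCC_Select: "x \<noteq> y \<Longrightarrow> x \<notin> fbinders F \<Longrightarrow> x \<notin> ffn F \<Longrightarrow> x \<notin> fn_conf C \<Longrightarrow>
    Res x ms y (fplug F (Select l (Var x)) \<parallel> C) \<equiv>\<^sub>C Res x (Lbl l # ms) y (fplug F (Var x) \<parallel> C)"
| SCC_ParNil: "C \<parallel> Thread Child Triv \<equiv>\<^sub>C C"
| SCC_ParComm: "C \<parallel> D \<equiv>\<^sub>C D \<parallel> C"
| SCC_ParAssoc: "C \<parallel> (D \<parallel> E) \<equiv>\<^sub>C (C \<parallel> D) \<parallel> E"
| SCC_ConfSub: "Thread \<phi> (ESub M N x) \<equiv>\<^sub>C CSub (Thread \<phi> M) N x"
| SCC_ConfSubExt: "x \<notin> gfn G \<Longrightarrow> x \<notin> gbinders G \<Longrightarrow> gbinders G \<inter> fn M = {} \<Longrightarrow>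
    CSub (gplug G C) M x \<equiv>\<^sub>C gplug G (CSub C M x)"
| SCC_refl: "C \<equiv>\<^sub>C C"
| SCC_sym: "C \<equiv>\<^sub>C D \<Longrightarrow> D \<equiv>\<^sub>C C"
| SCC_trans: "C \<equiv>\<^sub>C D \<Longrightarrow> D \<equiv>\<^sub>C E \<Longrightarrow> C \<equiv>\<^sub>C E"
| SCC_Par: "C \<equiv>\<^sub>C C' \<Longrightarrow> D \<equiv>\<^sub>C D' \<Longrightarrow> C \<parallel> D \<equiv>\<^sub>C C' \<parallel> D'"
| SCC_Res: "C \<equiv>\<^sub>C C' \<Longrightarrow> Res x ms y C \<equiv>\<^sub>C Res x ms y C'"
| SCC_CSub: "C \<equiv>\<^sub>C C' \<Longrightarrow> CSub C M x \<equiv>\<^sub>C CSub C' M x"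

inductive redC :: "'l conf \<Rightarrow> 'l conf \<Rightarrow> bool" (infix "\<longrightarrow>\<^sub>C" 50) where
  RC_New: "x \<noteq> y \<Longrightarrow> {x, y} \<inter> (ffn F \<union> fbinders F) = {} \<Longrightarrow>
    fplug F New \<longrightarrow>\<^sub>C Res x [] y (fplug F (Tup (Var x) (Var y)))"
| RC_Spawn: "fhat F \<Longrightarrow> fplug F (Spawn (Tup M N)) \<longrightarrow>\<^sub>C fplug F N \<parallel> Thread Child M"
| RC_Recv: "x \<noteq> y \<Longrightarrow> fhat F \<Longrightarrow>
    Res x (ms @ [Val M]) y (fplug F (Recv (Var y)) \<parallel> C) \<longrightarrow>\<^sub>C Res x ms y (fplug F (Tup M (Var y)) \<parallel> C)"
| RC_Case: "x \<noteq> y \<Longrightarrow> y \<notin> fbinders F \<Longrightarrow> fmlookup B j = Some N \<Longrightarrow>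
    Res x (ms @ [Lbl j]) y (fplug F (Case (Var y) B) \<parallel> C) \<longrightarrow>\<^sub>C Res x ms y (fplug F (App N (Var y)) \<parallel> C)"
| RC_LiftC: "C \<longrightarrow>\<^sub>C C' \<Longrightarrow> gplug G C \<longrightarrow>\<^sub>C gplug G C'"
| RC_LiftM: "M \<longrightarrow>\<^sub>M M' \<Longrightarrow> fplug F M \<longrightarrow>\<^sub>C fplug F M'"
| RC_SC: "C \<equiv>\<^sub>C C' \<Longrightarrow> C' \<longrightarrow>\<^sub>C D' \<Longrightarrow> D' \<equiv>\<^sub>C D \<Longrightarrow> C \<longrightarrow>\<^sub>C D"

section \<open>Types\<close>

datatype 'l ty =
    Prod "'l ty" "'l ty"
  | Lolli "'l ty" "'l ty"
  | One
  | Sess "'l sty"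
and 'l sty =
    Out "'l ty" "'l sty"
  | In "'l ty" "'l sty"
  | IChoice "('l, 'l sty) fmap"
  | EChoice "('l, 'l sty) fmap"
  | End

primrec dual :: "'l sty \<Rightarrow> 'l sty" where
  "dual (Out T S) = In T (dual S)"
| "dual (In T S) = Out T (dual S)"
| "dual (IChoice Ss) = EChoice (fmmap dual Ss)"
| "dual (EChoice Ss) = IChoice (fmmap dual Ss)"
| "dual End = End"

type_synonym 'l env = "(var, 'l ty) fmap"

text \<open>The environment \<open>\<Gamma>, \<Delta>\<close> is \<open>\<Gamma> ++\<^sub>f \<Delta>\<close>, with disjointness as a premise, and
  \<open>\<Gamma>, x : T\<close> is \<open>fmupd x T \<Gamma>\<close>, with \<open>x\<close> outside the domain as a premise.\<close>

definition disj :: "'l env \<Rightarrow> 'l env \<Rightarrow> bool" (infix "\<diamondop>" 50) where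
  "\<Gamma> \<diamondop> \<Delta> \<longleftrightarrow> fmdom' \<Gamma> \<inter> fmdom' \<Delta> = {}"

section \<open>Typing\<close>

text \<open>In \<open>T_Case\<close> the index set is nonempty, as usual for labelled choices; otherwise the
  rule would leave the environment of the branches unconstrained.\<close>

inductive typM :: "'l env \<Rightarrow> 'l tm \<Rightarrow> 'l ty \<Rightarrow> bool" ("_ \<turnstile>\<^sub>M _ \<^bold>: _" [50, 50, 50] 50) where
  T_Var: "fmupd x T fmempty \<turnstile>\<^sub>M Var x \<^bold>: T"
| T_Abs: "x \<notin> fmdom' \<Gamma> \<Longrightarrow> fmupd x T \<Gamma> \<turnstile>\<^sub>M M \<^bold>: U \<Longrightarrow> \<Gamma> \<turnstile>\<^sub>M Lam x M \<^bold>: Lolli T U"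
| T_App: "\<Gamma> \<diamondop> \<Delta> \<Longrightarrow> \<Gamma> \<turnstile>\<^sub>M M \<^bold>: Lolli T U \<Longrightarrow> \<Delta> \<turnstile>\<^sub>M N \<^bold>: T \<Longrightarrow> \<Gamma> ++\<^sub>f \<Delta> \<turnstile>\<^sub>M App M N \<^bold>: U"
| T_Unit: "fmempty \<turnstile>\<^sub>M Triv \<^bold>: One"
| T_Pair: "\<Gamma> \<diamondop> \<Delta> \<Longrightarrow> \<Gamma> \<turnstile>\<^sub>M M \<^bold>: T \<Longrightarrow> \<Delta> \<turnstile>\<^sub>M N \<^bold>: U \<Longrightarrow> \<Gamma> ++\<^sub>f \<Delta> \<turnstile>\<^sub>M Tup M N \<^bold>: Prod T U"
| T_Split: "\<Gamma> \<diamondop> \<Delta> \<Longrightarrow> x \<noteq> y \<Longrightarrow> x \<notin> fmdom' \<Delta> \<Longrightarrow> y \<notin> fmdom' \<Delta> \<Longrightarrow>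
    \<Gamma> \<turnstile>\<^sub>M M \<^bold>: Prod T T' \<Longrightarrow> fmupd y T' (fmupd x T \<Delta>) \<turnstile>\<^sub>M N \<^bold>: U \<Longrightarrow> \<Gamma> ++\<^sub>f \<Delta> \<turnstile>\<^sub>M LetP x y M N \<^bold>: U"
| T_New: "fmempty \<turnstile>\<^sub>M New \<^bold>: Prod (Sess S) (Sess (dual S))"
| T_Spawn: "\<Gamma> \<turnstile>\<^sub>M M \<^bold>: Prod One T \<Longrightarrow> \<Gamma> \<turnstile>\<^sub>M Spawn M \<^bold>: T"
| T_EndL: "x \<notin> fmdom' \<Gamma> \<Longrightarrow> \<Gamma> \<turnstile>\<^sub>M M \<^bold>: T \<Longrightarrow> fmupd x (Sess End) \<Gamma> \<turnstile>\<^sub>M M \<^bold>: T"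
| T_EndR: "fmempty \<turnstile>\<^sub>M Var x \<^bold>: Sess End"
| T_Send: "\<Gamma> \<turnstile>\<^sub>M M \<^bold>: Prod T (Sess (Out T S)) \<Longrightarrow> \<Gamma> \<turnstile>\<^sub>M Send M \<^bold>: Sess S"
| T_Recv: "\<Gamma> \<turnstile>\<^sub>M M \<^bold>: Sess (In T S) \<Longrightarrow> \<Gamma> \<turnstile>\<^sub>M Recv M \<^bold>: Prod T (Sess S)"
| T_Select: "\<Gamma> \<turnstile>\<^sub>M M \<^bold>: Sess (IChoice Ss) \<Longrightarrow> fmlookup Ss j = Some S \<Longrightarrow> \<Gamma> \<turnstile>\<^sub>M Select j M \<^bold>: Sess S"
| T_Case: "\<Gamma> \<diamondop> \<Delta> \<Longrightarrow> \<Gamma> \<turnstile>\<^sub>M M \<^bold>: Sess (EChoice Ss) \<Longrightarrow> fmdom' Ss \<noteq> {} \<Longrightarrow> fmdom' B = fmdom' Ss \<Longrightarrow>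
    (\<And>i S N. fmlookup Ss i = Some S \<Longrightarrow> fmlookup B i = Some N \<Longrightarrow> \<Delta> \<turnstile>\<^sub>M N \<^bold>: Lolli (Sess S) U) \<Longrightarrow>
    \<Gamma> ++\<^sub>f \<Delta> \<turnstile>\<^sub>M Case M B \<^bold>: U"
| T_Sub: "\<Gamma> \<diamondop> \<Delta> \<Longrightarrow> x \<notin> fmdom' \<Gamma> \<Longrightarrow> fmupd x T \<Gamma> \<turnstile>\<^sub>M M \<^bold>: U \<Longrightarrow> \<Delta> \<turnstile>\<^sub>M N \<^bold>: T \<Longrightarrow>
    \<Gamma> ++\<^sub>f \<Delta> \<turnstile>\<^sub>M ESub M N x \<^bold>: U"
| T_SendP: "\<Gamma> \<diamondop> \<Delta> \<Longrightarrow> \<Gamma> \<turnstile>\<^sub>M M \<^bold>: T \<Longrightarrow> \<Delta> \<turnstile>\<^sub>M N \<^bold>: Sess (Out T S) \<Longrightarrow> \<Gamma> ++\<^sub>f \<Delta> \<turnstile>\<^sub>M SendP M N \<^bold>: Sess S"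

inductive typB :: "'l env \<Rightarrow> 'l msg list \<Rightarrow> 'l sty \<Rightarrow> 'l sty \<Rightarrow> bool"
    ("_ \<turnstile>\<^sub>B _ \<^bold>: _ \<rhd> _" [50, 50, 50, 50] 50) where
  T_Buf: "fmempty \<turnstile>\<^sub>B [] \<^bold>: S' \<rhd> S'"
| T_BufSend: "\<Gamma> \<diamondop> \<Delta> \<Longrightarrow> \<Gamma> \<turnstile>\<^sub>M M \<^bold>: T \<Longrightarrow> \<Delta> \<turnstile>\<^sub>B ms \<^bold>: S' \<rhd> S \<Longrightarrow>
    \<Gamma> ++\<^sub>f \<Delta> \<turnstile>\<^sub>B ms @ [Val M] \<^bold>: S' \<rhd> Out T S"
| T_BufSelect: "\<Gamma> \<turnstile>\<^sub>B ms \<^bold>: S' \<rhd> S \<Longrightarrow> fmlookup Ss j = Some S \<Longrightarrow>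
    \<Gamma> \<turnstile>\<^sub>B ms @ [Lbl j] \<^bold>: S' \<rhd> IChoice Ss"

text \<open>Partial addition of markers.\<close>

fun madd :: "marker \<Rightarrow> marker \<Rightarrow> marker option" where
  "madd Main Child = Some Main"
| "madd Child Main = Some Main"
| "madd Child Child = Some Child"
| "madd Main Main = None"

text \<open>In \<open>T_Res\<close> and \<open>T_ResBuf\<close> the bound names \<open>x\<close>, \<open>y\<close> do not occur in the environment of the
  conclusion.\<close>

inductive typC :: "'l env \<Rightarrow> marker \<Rightarrow> 'l conf \<Rightarrow> 'l ty \<Rightarrow> bool"
    ("_ \<turnstile>\<^sub>C[_] _ \<^bold>: _" [50, 0, 50, 50] 50) where
  T_Main: "\<Gamma> \<turnstile>\<^sub>M M \<^bold>: T \<Longrightarrow> \<Gamma> \<turnstile>\<^sub>C[Main] Thread Main M \<^bold>: T"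
| T_Child: "\<Gamma> \<turnstile>\<^sub>M M \<^bold>: One \<Longrightarrow> \<Gamma> \<turnstile>\<^sub>C[Child] Thread Child M \<^bold>: One"
| T_ParL: "\<Gamma> \<diamondop> \<Delta> \<Longrightarrow> \<Gamma> \<turnstile>\<^sub>C[Child] C \<^bold>: One \<Longrightarrow> \<Delta> \<turnstile>\<^sub>C[\<phi>] D \<^bold>: T \<Longrightarrow> madd Child \<phi> = Some \<psi> \<Longrightarrow>
    \<Gamma> ++\<^sub>f \<Delta> \<turnstile>\<^sub>C[\<psi>] C \<parallel> D \<^bold>: T"
| T_ParR: "\<Gamma> \<diamondop> \<Delta> \<Longrightarrow> \<Gamma> \<turnstile>\<^sub>C[\<phi>] C \<^bold>: T \<Longrightarrow> \<Delta> \<turnstile>\<^sub>C[Child] D \<^bold>: One \<Longrightarrow> madd \<phi> Child = Some \<psi> \<Longrightarrow>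
    \<Gamma> ++\<^sub>f \<Delta> \<turnstile>\<^sub>C[\<psi>] C \<parallel> D \<^bold>: T"
| T_Res: "\<Gamma> \<diamondop> \<Delta> \<Longrightarrow> x \<noteq> y \<Longrightarrow> {x, y} \<inter> fmdom' (\<Gamma> ++\<^sub>f \<Delta>) = {} \<Longrightarrow> \<Gamma> \<turnstile>\<^sub>B ms \<^bold>: S' \<rhd> S \<Longrightarrow>
    fmupd y (Sess (dual S)) (fmupd x (Sess S') \<Delta>) \<turnstile>\<^sub>C[\<phi>] C \<^bold>: T \<Longrightarrow>
    \<Gamma> ++\<^sub>f \<Delta> \<turnstile>\<^sub>C[\<phi>] Res x ms y C \<^bold>: T"
| T_ResBuf: "\<Gamma> \<diamondop> \<Delta> \<Longrightarrow> x \<noteq> y \<Longrightarrow> {x, y} \<inter> fmdom' (\<Gamma> ++\<^sub>f \<Delta>) = {} \<Longrightarrow>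
    fmupd y (Sess (dual S)) \<Gamma> \<turnstile>\<^sub>B ms \<^bold>: S' \<rhd> S \<Longrightarrow> fmupd x (Sess S') \<Delta> \<turnstile>\<^sub>C[\<phi>] C \<^bold>: T \<Longrightarrow>
    \<Gamma> ++\<^sub>f \<Delta> \<turnstile>\<^sub>C[\<phi>] Res x ms y C \<^bold>: T"
| T_ConfSub: "\<Gamma> \<diamondop> \<Delta> \<Longrightarrow> x \<notin> fmdom' \<Gamma> \<Longrightarrow> fmupd x T \<Gamma> \<turnstile>\<^sub>C[\<phi>] C \<^bold>: U \<Longrightarrow> \<Delta> \<turnstile>\<^sub>M M \<^bold>: T \<Longrightarrow>
    \<Gamma> ++\<^sub>f \<Delta> \<turnstile>\<^sub>C[\<phi>] CSub C M x \<^bold>: U"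

end

theory Submission
  imports Defs
begin

text \<open>Assumptions of type \<open>end\<close> may be dropped (\<open>T_EndL\<close>) and conjured up (\<open>T_EndR\<close>) at will, so a
  judgement depends only on the part of its environment that is not of type \<open>end\<close>, its core.  On
  cores the typing rules become strictly linear and syntax directed, and inversion is immediate.  With the nameless representation of terms, typability is then
  defined by recursion on the syntax (\<open>wtM\<close>, \<open>wtB\<close>, \<open>wtC\<close>) and agrees with the given rules.  In this
  system the environment of a term plugged into a context splits into the part used by the context
  and the part used in the hole, so that structural congruence preserves typability in both
  directions by reshuffling disjoint environments, and reduction preserves it in one.\<close>

section \<open>Linear typing without the end type\<close>

text \<open>The obstacle is \<open>T_EndR\<close>: a variable of type \<open>end\<close> may occur
  any number of times with no assumption behind it. The domain of an environment is therefore only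
  included in the free names, a substitution of \<open>y\<close> for \<open>x\<close> may merge two
  names, and occurrences alone do not tell where an endpoint is used. Lookup in the core does tell,
  and merging is harmless as long as the renaming is injective on the core. Inversion of the
  declared rules at a named binder would return some other name and body for the same term.
  Recursion over nameless terms gives one equation per constructor, and the named form of each
  equation is derived once. As these equations determine \<open>wtM M\<close> as a predicate on
  environments and types, structural congruence becomes equality of predicates. A restriction has
  two declared rules, depending on whether the reading endpoint sits in the body or has itself been
  sent into the buffer. A send can lead from one to the other, so \<open>wtC\<close> has a single
  clause in which the splitting decides.\<close>

type_synonym 'l lenv = "var \<rightharpoonup> 'l ty"

text \<open>With values in \<open>option\<close>, binding a name of type \<open>end\<close> and
  leaving it unbound are the same map update \<open>\<Gamma>(x := live T)\<close>, which spares
  every binder a case distinction.\<close>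

definition live :: "'l ty \<Rightarrow> 'l ty option" where
  "live T = (if T = Sess End then None else Some T)"

definition sing :: "var \<Rightarrow> 'l ty \<Rightarrow> 'l lenv" where
  "sing x T = Map.empty(x := live T)"

definition push :: "'l ty \<Rightarrow> 'l lenv \<Rightarrow> 'l lenv" where
  "push T \<Gamma> = case_nat (live T) \<Gamma>"

text \<open>The disjoint union of separation logic as a relation. Being pointwise, it lets each
  variable be treated on its own, and union and disjointness travel together.\<close>

definition splits :: "'l lenv \<Rightarrow> 'l lenv \<Rightarrow> 'l lenv \<Rightarrow> bool" where
  "splits \<Gamma> \<Gamma>1 \<Gamma>2 \<longleftrightarrow> (\<forall>n. \<Gamma>1 n = None \<and> \<Gamma> n = \<Gamma>2 n \<or> \<Gamma>2 n = None \<and> \<Gamma> n = \<Gamma>1 n)"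

text \<open>Index 0 is the innermost bound variable, so in \<open>dbSplit\<close> the first
  component is pushed last. The recursion reaches the branches of \<open>Case\<close> only through
  \<open>fmmap\<close>, which turns them into predicates; \<open>wtM_Case\<close> undoes
  this.\<close>

primrec wtM :: "'l tm \<Rightarrow> 'l lenv \<Rightarrow> 'l ty \<Rightarrow> bool" where
  "wtM (Var x) \<Gamma> T \<longleftrightarrow> \<Gamma> = sing x T"
| "wtM Triv \<Gamma> T \<longleftrightarrow> \<Gamma> = Map.empty \<and> T = One"
| "wtM (dbAbs M) \<Gamma> T \<longleftrightarrow> (\<exists>T1 U. T = Lolli T1 U \<and> wtM M (push T1 \<Gamma>) U)"
| "wtM (App M N) \<Gamma> U \<longleftrightarrow> (\<exists>\<Gamma>1 \<Gamma>2 T. splits \<Gamma> \<Gamma>1 \<Gamma>2 \<and> wtM M \<Gamma>1 (Lolli T U) \<and> wtM N \<Gamma>2 T)"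
| "wtM (Tup M N) \<Gamma> V \<longleftrightarrow>
    (\<exists>\<Gamma>1 \<Gamma>2 T U. V = Prod T U \<and> splits \<Gamma> \<Gamma>1 \<Gamma>2 \<and> wtM M \<Gamma>1 T \<and> wtM N \<Gamma>2 U)"
| "wtM (dbSplit M N) \<Gamma> U \<longleftrightarrow>
    (\<exists>\<Gamma>1 \<Gamma>2 T T'. splits \<Gamma> \<Gamma>1 \<Gamma>2 \<and> wtM M \<Gamma>1 (Prod T T') \<and> wtM N (push T (push T' \<Gamma>2)) U)"
| "wtM New \<Gamma> T \<longleftrightarrow> \<Gamma> = Map.empty \<and> (\<exists>S. T = Prod (Sess S) (Sess (dual S)))"
| "wtM (Spawn M) \<Gamma> T \<longleftrightarrow> wtM M \<Gamma> (Prod One T)"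
| "wtM (Send M) \<Gamma> U \<longleftrightarrow> (\<exists>T S. U = Sess S \<and> wtM M \<Gamma> (Prod T (Sess (Out T S))))"
| "wtM (Recv M) \<Gamma> U \<longleftrightarrow> (\<exists>T S. U = Prod T (Sess S) \<and> wtM M \<Gamma> (Sess (In T S)))"
| "wtM (Select l M) \<Gamma> U \<longleftrightarrow>
    (\<exists>Ss S. U = Sess S \<and> fmlookup Ss l = Some S \<and> wtM M \<Gamma> (Sess (IChoice Ss)))"
| "wtM (Case M B) \<Gamma> U \<longleftrightarrow>
    (\<exists>\<Gamma>1 \<Gamma>2 Ss. splits \<Gamma> \<Gamma>1 \<Gamma>2 \<and> wtM M \<Gamma>1 (Sess (EChoice Ss)) \<and>
      fmdom' Ss \<noteq> {} \<and> fmdom' B = fmdom' Ss \<and>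
      (\<forall>i S P. fmlookup Ss i = Some S \<longrightarrow> fmlookup (fmmap wtM B) i = Some P \<longrightarrow>
        P \<Gamma>2 (Lolli (Sess S) U)))"
| "wtM (dbESub M N) \<Gamma> U \<longleftrightarrow>
    (\<exists>\<Gamma>1 \<Gamma>2 T. splits \<Gamma> \<Gamma>1 \<Gamma>2 \<and> wtM M (push T \<Gamma>1) U \<and> wtM N \<Gamma>2 T)"
| "wtM (SendP M N) \<Gamma> U \<longleftrightarrow>
    (\<exists>\<Gamma>1 \<Gamma>2 T S. U = Sess S \<and> splits \<Gamma> \<Gamma>1 \<Gamma>2 \<and> wtM M \<Gamma>1 T \<and> wtM N \<Gamma>2 (Sess (Out T S)))"

text \<open>The declared rules grow a buffer at the reading end, but the endpoint \<open>x\<close>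
  writes at the other. Recursion from the left keeps \<open>S\<close> fixed and undoes the pending
  messages on the type \<open>S'\<close> of the writer, the most recently sent one first;
  \<open>wtB_snoc\<close> gives the view from the right.\<close>

fun wtB :: "'l msg list \<Rightarrow> 'l lenv \<Rightarrow> 'l sty \<Rightarrow> 'l sty \<Rightarrow> bool" where
  "wtB [] \<Gamma> S' S \<longleftrightarrow> \<Gamma> = Map.empty \<and> S = S'"
| "wtB (Val M # ms) \<Gamma> S' S \<longleftrightarrow>
    (\<exists>\<Gamma>1 \<Gamma>2 T. splits \<Gamma> \<Gamma>1 \<Gamma>2 \<and> wtM M \<Gamma>1 T \<and> wtB ms \<Gamma>2 (Out T S') S)"
| "wtB (Lbl l # ms) \<Gamma> S' S \<longleftrightarrow> (\<exists>Ss. fmlookup Ss l = Some S' \<and> wtB ms \<Gamma> (IChoice Ss) S)"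

text \<open>In \<open>dbRes\<close> index 0 is the writing endpoint, never held by the buffer; index
  1, the reading one, goes to the buffer or to the body as \<open>splits\<close> chooses.
  \<open>madd\<close> disappears because one side of a parallel composition is always a
  child.\<close>

primrec wtC :: "'l conf \<Rightarrow> 'l lenv \<Rightarrow> marker \<Rightarrow> 'l ty \<Rightarrow> bool" where
  "wtC (Thread \<psi> M) \<Gamma> \<phi> T \<longleftrightarrow> \<psi> = \<phi> \<and> (\<phi> = Child \<longrightarrow> T = One) \<and> wtM M \<Gamma> T"
| "wtC (C \<parallel> D) \<Gamma> \<phi> T \<longleftrightarrow> (\<exists>\<Gamma>1 \<Gamma>2. splits \<Gamma> \<Gamma>1 \<Gamma>2 \<and>
    (wtC C \<Gamma>1 Child One \<and> wtC D \<Gamma>2 \<phi> T \<or> wtC C \<Gamma>1 \<phi> T \<and> wtC D \<Gamma>2 Child One))"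
| "wtC (dbRes ms C) \<Gamma> \<phi> T \<longleftrightarrow> (\<exists>\<Gamma>1 \<Gamma>2 S S'.
    splits (push (Sess S') (push (Sess (dual S)) \<Gamma>)) \<Gamma>1 \<Gamma>2 \<and> \<Gamma>1 0 = None \<and>
    wtB ms \<Gamma>1 S' S \<and> wtC C \<Gamma>2 \<phi> T)"
| "wtC (dbCSub C M) \<Gamma> \<phi> U \<longleftrightarrow>
    (\<exists>\<Gamma>1 \<Gamma>2 T. splits \<Gamma> \<Gamma>1 \<Gamma>2 \<and> wtC C (push T \<Gamma>1) \<phi> U \<and> wtM M \<Gamma>2 T)"

section \<open>Environments\<close>

lemma live_eq [simp]: "live T = None \<longleftrightarrow> T = Sess End" "live T = Some U \<longleftrightarrow> T = U \<and> T \<noteq> Sess End"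
  by (auto simp: live_def)

lemma push_simps [simp]: "push T \<Gamma> 0 = live T" "push T \<Gamma> (Suc n) = \<Gamma> n"
  by (simp_all add: push_def)

lemma sing_apply [simp]: "sing x T n = (if n = x then live T else None)"
  by (simp add: sing_def)

lemma dual_dual [simp]: "dual (dual (S :: 'a sty)) = S"
\<comment> \<open>Duality does not enter payload types, so the mutual induction proves nothing about
  them.\<close>
proof (induction S rule: sty.induct[where ?P1.0 = "\<lambda>_. True"])
  case (IChoice Ss)
  then have "fmmap (dual \<circ> dual) Ss = fmmap id Ss"
    by (intro fmap.map_cong0) simp
  then show ?case by (simp add: fmap.map_comp fmap.map_id)
next
  case (EChoice Ss)
  then have "fmmap (dual \<circ> dual) Ss = fmmap id Ss"
    by (intro fmap.map_cong0) simp
  then show ?case by (simp add: fmap.map_comp fmap.map_id)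
qed simp_all

lemma dual_eq_End [simp]: "dual S = End \<longleftrightarrow> S = End"
  by (cases S) auto

lemma splits_sym: "splits \<Gamma> \<Gamma>1 \<Gamma>2 \<Longrightarrow> splits \<Gamma> \<Gamma>2 \<Gamma>1"
  unfolding splits_def by metis

lemma splits_empty [simp]:
  "splits \<Gamma> Map.empty \<Delta> \<longleftrightarrow> \<Delta> = \<Gamma>" "splits \<Gamma> \<Delta> Map.empty \<longleftrightarrow> \<Delta> = \<Gamma>"
  by (auto simp: splits_def fun_eq_iff; metis)+

lemma splits_dom: "splits \<Gamma> \<Gamma>1 \<Gamma>2 \<Longrightarrow> dom \<Gamma> = dom \<Gamma>1 \<union> dom \<Gamma>2"
  unfolding splits_def by (intro set_eqI) (metis Un_iff domIff)

lemma splits_disjoint: "splits \<Gamma> \<Gamma>1 \<Gamma>2 \<Longrightarrow> dom \<Gamma>1 \<inter> dom \<Gamma>2 = {}"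
  unfolding splits_def by (metis disjoint_iff domIff)

lemma splitsI: "dom \<Gamma>1 \<inter> dom \<Gamma>2 = {} \<Longrightarrow> \<Gamma> = \<Gamma>1 ++ \<Gamma>2 \<Longrightarrow> splits \<Gamma> \<Gamma>1 \<Gamma>2"
  by (auto simp: splits_def map_add_def split: option.split)

lemma splits_add: "splits \<Gamma> \<Gamma>1 \<Gamma>2 \<Longrightarrow> \<Gamma> = \<Gamma>1 ++ \<Gamma>2"
  by (rule ext) (auto simp: splits_def map_add_def split: option.split dest!: spec)

lemma splits_assoc:
  assumes "splits \<Gamma> \<Gamma>1 \<Gamma>2" "splits \<Gamma>2 \<Gamma>3 \<Gamma>4"
  obtains \<Delta> where "splits \<Gamma> \<Delta> \<Gamma>4" "splits \<Delta> \<Gamma>1 \<Gamma>3"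
proof
  show "splits \<Gamma> (\<Gamma>1 ++ \<Gamma>3) \<Gamma>4" "splits (\<Gamma>1 ++ \<Gamma>3) \<Gamma>1 \<Gamma>3"
    using assms[THEN splits_disjoint] assms[THEN splits_dom] assms[THEN splits_add]
    by (auto intro!: splitsI)
qed

lemma dom_push: "n \<in> dom (push T \<Gamma>) \<longleftrightarrow> n = 0 \<and> live T \<noteq> None \<or> (\<exists>k \<in> dom \<Gamma>. n = Suc k)"
  by (cases n) auto

lemma wtM_Case: "wtM (Case M B) \<Gamma> U \<longleftrightarrow>
    (\<exists>\<Gamma>1 \<Gamma>2 Ss. splits \<Gamma> \<Gamma>1 \<Gamma>2 \<and> wtM M \<Gamma>1 (Sess (EChoice Ss)) \<and>
      fmdom' Ss \<noteq> {} \<and> fmdom' B = fmdom' Ss \<and>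
      (\<forall>i S N. fmlookup Ss i = Some S \<longrightarrow> fmlookup B i = Some N \<longrightarrow> wtM N \<Gamma>2 (Lolli (Sess S) U)))"
  by (simp add: ex_simps[symmetric] del: ex_simps) metis

declare wtM.simps(12) [simp del]

text \<open>Only an inclusion, since an occurrence of type \<open>end\<close> has no entry. It turns
  freshness side conditions into absent entries.\<close>

lemma wtM_dom: "wtM M \<Gamma> T \<Longrightarrow> dom \<Gamma> \<subseteq> fn M"
proof (induction M arbitrary: \<Gamma> T)
  case (Var x)
  then show ?case by (auto split: if_splits)
next
  case (dbAbs M)
  then obtain T1 U where "dom (push T1 \<Gamma>) \<subseteq> fn M" by auto metis
  then show ?case by (auto simp: dom_push)
next
  case (App M N)
  then show ?case using splits_dom by (fastforce)
next
  case (Tup M N)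
  then show ?case using splits_dom by (fastforce)
next
  case (SendP M N)
  then show ?case using splits_dom by (fastforce)
next
  case (dbSplit M N)
  then obtain \<Gamma>1 \<Gamma>2 T T' where "splits \<Gamma> \<Gamma>1 \<Gamma>2" "dom \<Gamma>1 \<subseteq> fn M" "dom (push T (push T' \<Gamma>2)) \<subseteq> fn N"
    by simp metis
  then show ?case by (auto simp: dom_push splits_dom)
next
  case (dbESub M N)
  then obtain \<Gamma>1 \<Gamma>2 T where "splits \<Gamma> \<Gamma>1 \<Gamma>2" "dom \<Gamma>2 \<subseteq> fn N" "dom (push T \<Gamma>1) \<subseteq> fn M"
    by simp metis
  then show ?case by (auto simp: dom_push splits_dom)
next
  case (Case M B)
  then obtain \<Gamma>1 \<Gamma>2 Ss where *: "splits \<Gamma> \<Gamma>1 \<Gamma>2" "wtM M \<Gamma>1 (Sess (EChoice Ss))"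
    "fmdom' Ss \<noteq> {}" "fmdom' B = fmdom' Ss"
    "\<And>i S N. fmlookup Ss i = Some S \<Longrightarrow> fmlookup B i = Some N \<Longrightarrow> wtM N \<Gamma>2 (Lolli (Sess S) T)"
    unfolding wtM_Case by blast
  \<comment> \<open>The index set is nonempty, so some branch bounds the environment that all
    branches share.\<close>
  then obtain i where i: "i \<in> fmdom' Ss" "i \<in> fmdom' B" by auto
  then obtain S N where "fmlookup Ss i = Some S" and N: "fmlookup B i = Some N"
    by (auto simp: fmlookup_dom'_iff)
  then have "wtM N \<Gamma>2 (Lolli (Sess S) T)" using *(5) by blast
  moreover have "N \<in> fmran' B" using N by (rule fmran'I)
  ultimately have "dom \<Gamma>2 \<subseteq> \<Union> (fn ` fmran' B)" using Case.IH(2) by blast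
  then show ?case using Case.IH(1)[OF *(2)] splits_dom[OF *(1)] by (auto simp: fmap.set_map)
qed auto

section \<open>Renaming\<close>

text \<open>A renaming need only be injective on the variables in the environment: all other
  occurrences have type \<open>end\<close> and may be identified at will.\<close>

definition moves :: "(var \<Rightarrow> var) \<Rightarrow> 'l lenv \<Rightarrow> 'l lenv \<Rightarrow> bool" where
  "moves f \<Gamma> \<Gamma>' \<longleftrightarrow> inj_on f (dom \<Gamma>) \<and> (\<forall>n \<in> dom \<Gamma>. \<Gamma>' (f n) = \<Gamma> n) \<and> dom \<Gamma>' = f ` dom \<Gamma>"

lemma moves_empty [simp]: "moves f Map.empty \<Gamma>' \<longleftrightarrow> \<Gamma>' = Map.empty"
  by (auto simp: moves_def)

lemma moves_sing: "moves f (sing x T) \<Gamma>' \<Longrightarrow> \<Gamma>' = sing (f x) T"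
proof (cases "T = Sess End")
  case True
  then have "sing x T = Map.empty" "sing (f x) T = Map.empty" by (auto simp: sing_def live_def)
  then show "moves f (sing x T) \<Gamma>' \<Longrightarrow> \<Gamma>' = sing (f x) T" by simp
next
  case False
  then have "sing x T = [x \<mapsto> T]" "sing (f x) T = [f x \<mapsto> T]" by (auto simp: sing_def live_def)
  then show "moves f (sing x T) \<Gamma>' \<Longrightarrow> \<Gamma>' = sing (f x) T"
    by (auto simp: moves_def dom_eq_singleton_conv)
qed

lemma moves_push:
  assumes "moves f \<Gamma> \<Gamma>'"
  shows "moves (lift f) (push T \<Gamma>) (push T \<Gamma>')"
proof -
  have "inj_on (lift f) (dom (push T \<Gamma>))"
  proof (rule inj_onI)
    fix m n assume "m \<in> dom (push T \<Gamma>)" "n \<in> dom (push T \<Gamma>)" "lift f m = lift f n"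
    then show "m = n"
      using assms by (cases m; cases n) (auto simp: moves_def dest: inj_onD)
  qed
  moreover have "dom (push T \<Gamma>') = lift f ` dom (push T \<Gamma>)"
  proof (intro set_eqI iffI)
    fix n assume "n \<in> dom (push T \<Gamma>')"
    then have "n = 0 \<and> live T \<noteq> None \<or> (\<exists>k \<in> f ` dom \<Gamma>. n = Suc k)"
      using assms by (simp add: dom_push moves_def)
    then show "n \<in> lift f ` dom (push T \<Gamma>)"
    proof
      assume "n = 0 \<and> live T \<noteq> None"
      then show ?thesis by (intro image_eqI[of _ _ 0]) (auto simp: dom_push)
    next
      assume "\<exists>k \<in> f ` dom \<Gamma>. n = Suc k"
      then obtain k where "k \<in> dom \<Gamma>" "n = lift f (Suc k)" by auto
      then show ?thesis by (intro image_eqI[of _ _ "Suc k"]) (auto simp: dom_push)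
    qed
  next
    fix n assume "n \<in> lift f ` dom (push T \<Gamma>)"
    then obtain k where "n = lift f k" "k \<in> dom (push T \<Gamma>)" by blast
    moreover have "dom \<Gamma>' = f ` dom \<Gamma>" using assms by (simp add: moves_def)
    ultimately show "n \<in> dom (push T \<Gamma>')"
      by (cases k) (auto simp: dom_push simp del: domIff)
  qed
  moreover have "push T \<Gamma>' (lift f n) = push T \<Gamma> n" if "n \<in> dom (push T \<Gamma>)" for n
    using that assms by (cases n) (auto simp: moves_def)
  ultimately show ?thesis by (auto simp: moves_def)
qed

text \<open>Injectivity on the whole domain keeps the images of the two parts disjoint; each new
  part is the restriction of \<open>\<Gamma>'\<close> to such an image.\<close>

lemma moves_splits:
  assumes "moves f \<Gamma> \<Gamma>'" "splits \<Gamma> \<Gamma>1 \<Gamma>2"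
  obtains \<Gamma>1' \<Gamma>2' where "moves f \<Gamma>1 \<Gamma>1'" "moves f \<Gamma>2 \<Gamma>2'" "splits \<Gamma>' \<Gamma>1' \<Gamma>2'"
proof
  note d = splits_dom[OF assms(2)]
  have s: "\<Gamma> n = \<Gamma>1 n" if "n \<in> dom \<Gamma>1" for n
    using that assms(2) unfolding splits_def by (metis domIff)
  have s': "\<Gamma> n = \<Gamma>2 n" if "n \<in> dom \<Gamma>2" for n
    using that assms(2) unfolding splits_def by (metis domIff)
  have dj: "dom \<Gamma>1 \<inter> dom \<Gamma>2 = {}"
    using assms(2) unfolding splits_def by (metis disjoint_iff domIff)
  have i: "inj_on f (dom \<Gamma>)" and e: "\<And>n. n \<in> dom \<Gamma> \<Longrightarrow> \<Gamma>' (f n) = \<Gamma> n" and r: "dom \<Gamma>' = f ` dom \<Gamma>"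
    using assms(1) by (auto simp: moves_def)
  show "moves f \<Gamma>1 (\<Gamma>' |` (f ` dom \<Gamma>1))"
    unfolding moves_def using i e s d r by (auto simp: inj_on_def)
  show "moves f \<Gamma>2 (\<Gamma>' |` (f ` dom \<Gamma>2))"
    unfolding moves_def using i e s' d r by (auto simp: inj_on_def)
  have "f ` dom \<Gamma>1 \<inter> f ` dom \<Gamma>2 = {}"
    using i d dj by (auto simp: inj_on_def) (metis UnCI disjoint_iff domIff option.distinct(1))
  moreover have "f ` dom \<Gamma>1 \<union> f ` dom \<Gamma>2 = dom \<Gamma>'" using r d by auto
  ultimately show "splits \<Gamma>' (\<Gamma>' |` (f ` dom \<Gamma>1)) (\<Gamma>' |` (f ` dom \<Gamma>2))"
    unfolding splits_def restrict_map_def by (metis IntI UnE domIff emptyE)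
qed

text \<open>Injectivity is asked only on entries, so this also covers the merging renaming
  \<open>id(x := y)\<close> behind \<open>RM_SubName\<close>.\<close>

lemma wtM_rename: "wtM M \<Gamma> T \<Longrightarrow> moves f \<Gamma> \<Gamma>' \<Longrightarrow> wtM (rename f M) \<Gamma>' T"
proof (induction M arbitrary: \<Gamma> \<Gamma>' T f)
  case (Var x)
  then have "moves f (sing x T) \<Gamma>'" by (simp only: wtM.simps)
  from moves_sing[OF this] show ?case by (simp only: rename.simps wtM.simps)
next
  case (dbAbs M)
  then show ?case using moves_push by (simp only: wtM.simps rename.simps) blast
next
  case (App M N)
  from App.prems(1) obtain \<Gamma>1 \<Gamma>2 T1 where
    *: "splits \<Gamma> \<Gamma>1 \<Gamma>2"  "wtM M \<Gamma>1 (Lolli T1 T)" "wtM N \<Gamma>2 T1"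
    by (simp only: wtM.simps) blast
  obtain \<Gamma>1' \<Gamma>2' where m: "moves f \<Gamma>1 \<Gamma>1'" "moves f \<Gamma>2 \<Gamma>2'" "splits \<Gamma>' \<Gamma>1' \<Gamma>2'"
    using moves_splits[OF App.prems(2) *(1)] .
  show ?case
    using m(3) App.IH(1)[OF *(2) m(1)] App.IH(2)[OF *(3) m(2)]
    by (simp only: wtM.simps rename.simps) blast
next
  case (Tup M N)
  from Tup.prems(1) obtain \<Gamma>1 \<Gamma>2 T1 T2 where
    *: "splits \<Gamma> \<Gamma>1 \<Gamma>2" "wtM M \<Gamma>1 T1" "wtM N \<Gamma>2 T2"
    and T: "T = Prod T1 T2"
    by (simp only: wtM.simps) blast
  obtain \<Gamma>1' \<Gamma>2' where m: "moves f \<Gamma>1 \<Gamma>1'" "moves f \<Gamma>2 \<Gamma>2'" "splits \<Gamma>' \<Gamma>1' \<Gamma>2'"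
    using moves_splits[OF Tup.prems(2) *(1)] .
  show ?case
    using T m(3) Tup.IH(1)[OF *(2) m(1)] Tup.IH(2)[OF *(3) m(2)]
    by (simp only: wtM.simps rename.simps) blast
next
  case (SendP M N)
  from SendP.prems(1) obtain \<Gamma>1 \<Gamma>2 T1 T2 where
    *: "splits \<Gamma> \<Gamma>1 \<Gamma>2" "wtM M \<Gamma>1 T1" "wtM N \<Gamma>2 T2"
    and T: "\<exists>S. T = Sess S \<and> T2 = Sess (Out T1 S)"
    by (simp only: wtM.simps) blast
  obtain \<Gamma>1' \<Gamma>2' where m: "moves f \<Gamma>1 \<Gamma>1'" "moves f \<Gamma>2 \<Gamma>2'" "splits \<Gamma>' \<Gamma>1' \<Gamma>2'"
    using moves_splits[OF SendP.prems(2) *(1)] .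
  show ?case
    using T m(3) SendP.IH(1)[OF *(2) m(1)] SendP.IH(2)[OF *(3) m(2)]
    by (simp only: wtM.simps rename.simps) blast
next
  case (dbSplit M N)
  from dbSplit.prems(1) obtain \<Gamma>1 \<Gamma>2 T1 T2 where
    *: "splits \<Gamma> \<Gamma>1 \<Gamma>2"  "wtM M \<Gamma>1 (Prod T1 T2)" "wtM N (push T1 (push T2 \<Gamma>2)) T"
    by (simp only: wtM.simps) blast
  obtain \<Gamma>1' \<Gamma>2' where m: "moves f \<Gamma>1 \<Gamma>1'" "moves f \<Gamma>2 \<Gamma>2'" "splits \<Gamma>' \<Gamma>1' \<Gamma>2'"
    using moves_splits[OF dbSplit.prems(2) *(1)] .
  show ?case
    using m(3) dbSplit.IH(1)[OF *(2) m(1)] dbSplit.IH(2)[OF *(3) moves_push[OF moves_push[OF m(2)]]]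
    by (simp only: wtM.simps rename.simps) blast
next
  case (dbESub M N)
  from dbESub.prems(1) obtain \<Gamma>1 \<Gamma>2 T1 where
    *: "splits \<Gamma> \<Gamma>1 \<Gamma>2"  "wtM M (push T1 \<Gamma>1) T" "wtM N \<Gamma>2 T1"
    by (simp only: wtM.simps) blast
  obtain \<Gamma>1' \<Gamma>2' where m: "moves f \<Gamma>1 \<Gamma>1'" "moves f \<Gamma>2 \<Gamma>2'" "splits \<Gamma>' \<Gamma>1' \<Gamma>2'"
    using moves_splits[OF dbESub.prems(2) *(1)] .
  show ?case
    using m(3) dbESub.IH(1)[OF *(2) moves_push[OF m(1)]] dbESub.IH(2)[OF *(3) m(2)]
    by (simp only: wtM.simps rename.simps) blast
next
  case (Case M B)
  then obtain \<Gamma>1 \<Gamma>2 Ss where *: "splits \<Gamma> \<Gamma>1 \<Gamma>2" "wtM M \<Gamma>1 (Sess (EChoice Ss))"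
    "fmdom' Ss \<noteq> {}" "fmdom' B = fmdom' Ss"
    "\<And>i S N. fmlookup Ss i = Some S \<Longrightarrow> fmlookup B i = Some N \<Longrightarrow> wtM N \<Gamma>2 (Lolli (Sess S) T)"
    unfolding wtM_Case by blast
  obtain \<Gamma>1' \<Gamma>2' where m: "moves f \<Gamma>1 \<Gamma>1'" "moves f \<Gamma>2 \<Gamma>2'" "splits \<Gamma>' \<Gamma>1' \<Gamma>2'"
    using moves_splits[OF Case.prems(2) *(1)] .
  have "wtM (rename f N) \<Gamma>2' (Lolli (Sess S) T)"
    if "fmlookup Ss i = Some S" "fmlookup B i = Some N" for i S N
    using Case.IH(2)[OF fmran'I[OF that(2)] *(5)[OF that] m(2)] .
  then have "\<forall>i S N. fmlookup Ss i = Some S \<longrightarrow> fmlookup (fmmap (rename f) B) i = Some N \<longrightarrow>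
      wtM N \<Gamma>2' (Lolli (Sess S) T)"
    by auto
  moreover have "fmdom' (fmmap (rename f) B) = fmdom' Ss" using *(4) by simp
  ultimately show ?case
    using m(3) *(3) Case.IH(1)[OF *(2) m(1)] unfolding rename.simps wtM_Case by blast
next
  case (Spawn M)
  then show ?case by (simp only: wtM.simps rename.simps)
next
  case (Send M)
  then show ?case by (simp only: wtM.simps rename.simps) blast
next
  case (Recv M)
  then show ?case by (simp only: wtM.simps rename.simps) blast
next
  case (Select l M)
  then show ?case by (simp only: wtM.simps rename.simps) blast
qed simp_all

lemma moves_inv:
  assumes "inj f" "dom \<Gamma> \<subseteq> range f"
  shows "moves (inv f) \<Gamma> (\<Gamma> \<circ> f)"
  unfolding moves_def
proof (intro conjI ballI)
  show "inj_on (inv f) (dom \<Gamma>)" using assms(2) by (rule inj_on_inv_into)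
  show "(\<Gamma> \<circ> f) (inv f n) = \<Gamma> n" if "n \<in> dom \<Gamma>" for n
    using assms(2) that by (auto simp: f_inv_into_f)
  show "dom (\<Gamma> \<circ> f) = inv f ` dom \<Gamma>"
  proof (intro set_eqI iffI)
    fix n assume "n \<in> dom (\<Gamma> \<circ> f)"
    then show "n \<in> inv f ` dom \<Gamma>"
      using assms(1) by (intro image_eqI[of _ _ "f n"]) auto
  next
    fix n assume "n \<in> inv f ` dom \<Gamma>"
    then show "n \<in> dom (\<Gamma> \<circ> f)"
      using assms(2) by (auto simp: f_inv_into_f domI subset_iff)
  qed
qed

lemma moves_comp:
  assumes "inj f" "dom \<Gamma> \<subseteq> range f"
  shows "moves f (\<Gamma> \<circ> f) \<Gamma>"
  unfolding moves_def
proof (intro conjI ballI)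
  show "inj_on f (dom (\<Gamma> \<circ> f))" using assms(1) by (rule inj_on_subset) simp
  show "dom \<Gamma> = f ` dom (\<Gamma> \<circ> f)" using assms(2) by (fastforce simp: dom_def image_iff)
qed simp

text \<open>From left to right the term is renamed back along \<open>inv f\<close>;
  \<open>wtM_dom\<close> puts all entries into the range of \<open>f\<close>, where this inverse is
  faithful.\<close>

lemma wtM_rename_inj:
  assumes "inj f"
  shows "wtM (rename f M) \<Gamma> T \<longleftrightarrow> dom \<Gamma> \<subseteq> range f \<and> wtM M (\<Gamma> \<circ> f) T"
proof
  assume w: "wtM (rename f M) \<Gamma> T"
  then have r: "dom \<Gamma> \<subseteq> range f" using wtM_dom fn_rename by blast
  from wtM_rename[OF w moves_inv[OF assms r]] show "dom \<Gamma> \<subseteq> range f \<and> wtM M (\<Gamma> \<circ> f) T"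
    using r assms by (simp add: rename_rename rename_id)
next
  assume "dom \<Gamma> \<subseteq> range f \<and> wtM M (\<Gamma> \<circ> f) T"
  then show "wtM (rename f M) \<Gamma> T" using wtM_rename[OF _ moves_comp[OF assms]] by blast
qed

lemma inj_bind1: "inj (bind1 x)" and inj_bind2: "inj (bind2 x y)"
  by (auto simp: inj_def bind1_def bind2_def)

lemma range_bind1: "n \<in> range (bind1 x) \<longleftrightarrow> n \<noteq> Suc x"
  by (cases n) (auto simp: bind1_def image_iff)

text \<open>The missed indices are those at which outer variables named \<open>x\<close> and
  \<open>y\<close> would sit. For \<open>x = y\<close> the test for \<open>x\<close> comes first in
  \<open>bind2\<close>, so index 1 is missed as well.\<close>

lemma range_bind2:
  "n \<in> range (bind2 x y) \<longleftrightarrow> n \<noteq> Suc (Suc x) \<and> n \<noteq> Suc (Suc y) \<and> (x = y \<longrightarrow> n \<noteq> Suc 0)"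
proof (cases n)
  case (Suc m)
  then show ?thesis by (cases m) (auto simp: bind2_def image_iff)
qed (auto simp: bind2_def image_iff)

lemma dom_subset_iff: "dom \<Gamma> \<subseteq> A \<longleftrightarrow> (\<forall>n. n \<notin> A \<longrightarrow> \<Gamma> n = None)"
  by auto

text \<open>Pulling a pushed environment back along \<open>bind1 x\<close> overrides
  \<open>x\<close>; the index missed by \<open>bind1 x\<close> is that of an outer \<open>x\<close>,
  whence the condition that it has no entry.\<close>

lemma wtM_bind1 [simp]:
  "wtM (rename (bind1 x) M) (push T \<Gamma>) U \<longleftrightarrow> \<Gamma> x = None \<and> wtM M (\<Gamma>(x := live T)) U"
proof -
  have "push T \<Gamma> \<circ> bind1 x = \<Gamma>(x := live T)"
    by (auto simp: bind1_def)
  then show ?thesis by (simp add: wtM_rename_inj inj_bind1 dom_subset_iff range_bind1)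
qed

lemma wtM_bind2 [simp]:
  "wtM (rename (bind2 x y) M) (push T (push T' \<Gamma>)) U \<longleftrightarrow>
    \<Gamma> x = None \<and> \<Gamma> y = None \<and> (x = y \<longrightarrow> T' = Sess End) \<and> wtM M (\<Gamma>(y := live T', x := live T)) U"
proof -
  have "push T (push T' \<Gamma>) \<circ> bind2 x y = \<Gamma>(y := live T', x := live T)"
    by (auto simp: bind2_def)
  then show ?thesis by (auto simp: wtM_rename_inj inj_bind2 dom_subset_iff range_bind2)
qed

section \<open>Buffers and configurations under renaming\<close>

lemma wtB_dom: "wtB ms \<Gamma> S' S \<Longrightarrow> dom \<Gamma> \<subseteq> fn_msgs ms"
proof (induction ms \<Gamma> S' S rule: wtB.induct)
  case (2 M ms \<Gamma> S' S)
  then show ?case using wtM_dom splits_dom by (fastforce simp: fn_msgs_def)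
qed (auto simp: fn_msgs_def)

lemma wtB_rename: "wtB ms \<Gamma> S' S \<Longrightarrow> moves f \<Gamma> \<Gamma>' \<Longrightarrow> wtB (map (rename_msg f) ms) \<Gamma>' S' S"
proof (induction ms \<Gamma> S' S arbitrary: \<Gamma>' rule: wtB.induct)
  case (2 M ms \<Gamma> S' S)
  then obtain \<Gamma>1 \<Gamma>2 T where *: "splits \<Gamma> \<Gamma>1 \<Gamma>2" "wtM M \<Gamma>1 T" "wtB ms \<Gamma>2 (Out T S') S"
    by (simp only: wtB.simps) blast
  obtain \<Gamma>1' \<Gamma>2' where m: "moves f \<Gamma>1 \<Gamma>1'" "moves f \<Gamma>2 \<Gamma>2'" "splits \<Gamma>' \<Gamma>1' \<Gamma>2'"
    using moves_splits[OF "2.prems"(2) *(1)] .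
  have "wtB (map (rename_msg f) ms) \<Gamma>2' (Out T S') S"
    using 2 *(3) m(2) by blast
  then show ?case using wtM_rename[OF *(2) m(1)] m(3) by auto
qed auto

lemma wtC_dom: "wtC C \<Gamma> \<phi> T \<Longrightarrow> dom \<Gamma> \<subseteq> fn_conf C"
proof (induction C arbitrary: \<Gamma> \<phi> T)
  case (Thread \<psi> M)
  then show ?case using wtM_dom by (simp only: wtC.simps fn_conf.simps) blast
next
  case (Par C D)
  then obtain \<Gamma>1 \<Gamma>2 where "splits \<Gamma> \<Gamma>1 \<Gamma>2" "dom \<Gamma>1 \<subseteq> fn_conf C" "dom \<Gamma>2 \<subseteq> fn_conf D"
    by (simp only: wtC.simps) blast
  then show ?case using splits_dom[of \<Gamma> \<Gamma>1 \<Gamma>2] by auto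
next
  case (dbRes ms C)
  then obtain \<Gamma>1 \<Gamma>2 S S' where "splits (push (Sess S') (push (Sess (dual S)) \<Gamma>)) \<Gamma>1 \<Gamma>2"
    "wtB ms \<Gamma>1 S' S" "wtC C \<Gamma>2 \<phi> T"
    by auto
  then have "dom (push (Sess S') (push (Sess (dual S)) \<Gamma>)) \<subseteq> fn_msgs ms \<union> fn_conf C"
    using wtB_dom dbRes.IH by (metis splits_dom Un_mono)
  then show ?case by (auto dest!: subsetD[of _ _ "Suc (Suc _)"])
next
  case (dbCSub C M)
  then obtain \<Gamma>1 \<Gamma>2 U where *: "splits \<Gamma> \<Gamma>1 \<Gamma>2" "wtM M \<Gamma>2 U" "wtC C (push U \<Gamma>1) \<phi> T"
    by auto
  then show ?case using wtM_dom[OF *(2)] dbCSub.IH[OF *(3)] splits_dom[OF *(1)]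
    by (auto simp: dom_push)
qed

lemma wtC_rename: "wtC C \<Gamma> \<phi> T \<Longrightarrow> moves f \<Gamma> \<Gamma>' \<Longrightarrow> wtC (rename_conf f C) \<Gamma>' \<phi> T"
proof (induction C arbitrary: \<Gamma> \<Gamma>' \<phi> T f)
  case (Thread \<psi> M)
  then show ?case using wtM_rename by auto
next
  case (Par C D)
  from Par.prems(1) obtain \<Gamma>1 \<Gamma>2 where *: "splits \<Gamma> \<Gamma>1 \<Gamma>2"
    "wtC C \<Gamma>1 Child One \<and> wtC D \<Gamma>2 \<phi> T \<or> wtC C \<Gamma>1 \<phi> T \<and> wtC D \<Gamma>2 Child One"
    by auto
  obtain \<Gamma>1' \<Gamma>2' where "moves f \<Gamma>1 \<Gamma>1'" "moves f \<Gamma>2 \<Gamma>2'" "splits \<Gamma>' \<Gamma>1' \<Gamma>2'"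
    using moves_splits[OF Par.prems(2) *(1)] .
  then show ?case using *(2) Par.IH by (simp only: wtC.simps rename_conf.simps) blast
next
  case (dbRes ms C)
  then obtain \<Gamma>1 \<Gamma>2 S S' where *: "splits (push (Sess S') (push (Sess (dual S)) \<Gamma>)) \<Gamma>1 \<Gamma>2"
    "\<Gamma>1 0 = None" "wtB ms \<Gamma>1 S' S" "wtC C \<Gamma>2 \<phi> T"
    by auto
  have "moves (lift (lift f)) (push (Sess S') (push (Sess (dual S)) \<Gamma>))
      (push (Sess S') (push (Sess (dual S)) \<Gamma>'))"
    using dbRes.prems(2) by (intro moves_push)
  then obtain \<Gamma>1' \<Gamma>2' where m: "moves (lift (lift f)) \<Gamma>1 \<Gamma>1'" "moves (lift (lift f)) \<Gamma>2 \<Gamma>2'"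
    "splits (push (Sess S') (push (Sess (dual S)) \<Gamma>')) \<Gamma>1' \<Gamma>2'"
    using moves_splits *(1) by blast
  \<comment> \<open>A lifted renaming sends no other index to 0, so the buffer still does not hold
    the writing endpoint.\<close>
  have "0 \<notin> lift (lift f) ` dom \<Gamma>1"
    using *(2) by (auto simp: lift_def split: nat.splits)
  then have "\<Gamma>1' 0 = None" using m(1) unfolding moves_def by (metis domIff)
  then show ?case
    using m(3) wtB_rename[OF *(3) m(1)] dbRes.IH[OF *(4) m(2)] by auto
next
  case (dbCSub C M)
  then obtain \<Gamma>1 \<Gamma>2 U where *: "splits \<Gamma> \<Gamma>1 \<Gamma>2" "wtM M \<Gamma>2 U" "wtC C (push U \<Gamma>1) \<phi> T"
    by auto
  obtain \<Gamma>1' \<Gamma>2' where m: "moves f \<Gamma>1 \<Gamma>1'" "moves f \<Gamma>2 \<Gamma>2'" "splits \<Gamma>' \<Gamma>1' \<Gamma>2'"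
    using moves_splits[OF dbCSub.prems(2) *(1)] .
  then show ?case
    using wtM_rename[OF *(2) m(2)] dbCSub.IH[OF *(3) moves_push[OF m(1)]] by auto
qed

lemma lift_id: "lift id = id"
  by (rule ext) (simp add: lift_def split: nat.split)

lemma rename_msg_comp: "rename_msg f (rename_msg g m) = rename_msg (f \<circ> g) m"
  by (cases m) (simp_all add: rename_rename)

lemma rename_msg_id: "rename_msg id = id"
proof
  show "rename_msg id m = id m" for m :: "'a msg"
    by (cases m) (simp_all add: rename_id)
qed

lemma rename_conf_comp: "rename_conf f (rename_conf g C) = rename_conf (f \<circ> g) C"
  by (induction C arbitrary: f g) (simp_all add: rename_rename rename_msg_comp lift_comp)

lemma rename_conf_id: "rename_conf id C = C"
  by (induction C) (simp_all only: rename_conf.simps lift_id rename_id rename_msg_id list.map_id)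

lemma wtB_rename_inj:
  fixes ms :: "'a msg list"
  assumes "inj f"
  shows "wtB (map (rename_msg f) ms) \<Gamma> S' S \<longleftrightarrow> dom \<Gamma> \<subseteq> range f \<and> wtB ms (\<Gamma> \<circ> f) S' S"
proof
  assume w: "wtB (map (rename_msg f) ms) \<Gamma> S' S"
  then have r: "dom \<Gamma> \<subseteq> range f" using wtB_dom fn_msgs_rename by blast
  note i = wtB_rename[OF w moves_inv[OF assms r]]
  show "dom \<Gamma> \<subseteq> range f \<and> wtB ms (\<Gamma> \<circ> f) S' S"
  proof -
    have "rename_msg (inv f) \<circ> rename_msg f = (id :: 'a msg \<Rightarrow> _)"
      using assms by (intro ext) (simp add: rename_msg_comp rename_msg_id)
    then have "map (rename_msg (inv f)) (map (rename_msg f) ms) = ms"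
      by (simp only: map_map list.map_id)
    then show ?thesis using i r by simp
  qed
next
  assume "dom \<Gamma> \<subseteq> range f \<and> wtB ms (\<Gamma> \<circ> f) S' S"
  then show "wtB (map (rename_msg f) ms) \<Gamma> S' S" using wtB_rename[OF _ moves_comp[OF assms]] by blast
qed

lemma wtC_rename_inj:
  assumes "inj f"
  shows "wtC (rename_conf f C) \<Gamma> \<phi> T \<longleftrightarrow> dom \<Gamma> \<subseteq> range f \<and> wtC C (\<Gamma> \<circ> f) \<phi> T"
proof
  assume w: "wtC (rename_conf f C) \<Gamma> \<phi> T"
  then have r: "dom \<Gamma> \<subseteq> range f" using wtC_dom fn_rename_conf by blast
  from wtC_rename[OF w moves_inv[OF assms r]] show "dom \<Gamma> \<subseteq> range f \<and> wtC C (\<Gamma> \<circ> f) \<phi> T"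
    using r assms by (simp add: rename_conf_comp rename_conf_id)
next
  assume "dom \<Gamma> \<subseteq> range f \<and> wtC C (\<Gamma> \<circ> f) \<phi> T"
  then show "wtC (rename_conf f C) \<Gamma> \<phi> T" using wtC_rename[OF _ moves_comp[OF assms]] by blast
qed

section \<open>Typing of named binders\<close>

lemma wtM_Lam:
  "wtM (Lam x M) \<Gamma> T \<longleftrightarrow> (\<exists>T1 U. T = Lolli T1 U \<and> \<Gamma> x = None \<and> wtM M (\<Gamma>(x := live T1)) U)"
  by (simp add: Lam_def)

lemma wtM_LetP:
  "wtM (LetP x y M N) \<Gamma> U \<longleftrightarrow>
    (\<exists>\<Gamma>1 \<Gamma>2 T T'. splits \<Gamma> \<Gamma>1 \<Gamma>2 \<and> wtM M \<Gamma>1 (Prod T T') \<and> \<Gamma>2 x = None \<and> \<Gamma>2 y = None \<and>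
      (x = y \<longrightarrow> T' = Sess End) \<and> wtM N (\<Gamma>2(y := live T', x := live T)) U)"
  by (simp add: LetP_def)

lemma wtM_ESub:
  "wtM (ESub M N x) \<Gamma> U \<longleftrightarrow>
    (\<exists>\<Gamma>1 \<Gamma>2 T. splits \<Gamma> \<Gamma>1 \<Gamma>2 \<and> \<Gamma>1 x = None \<and> wtM M (\<Gamma>1(x := live T)) U \<and> wtM N \<Gamma>2 T)"
  by (simp add: ESub_def)

lemma wtC_CSub:
  "wtC (CSub C M x) \<Gamma> \<phi> U \<longleftrightarrow>
    (\<exists>\<Gamma>1 \<Gamma>2 T. splits \<Gamma> \<Gamma>1 \<Gamma>2 \<and> \<Gamma>1 x = None \<and> wtC C (\<Gamma>1(x := live T)) \<phi> U \<and> wtM M \<Gamma>2 T)"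
proof -
  have "push T \<Delta> \<circ> bind1 x = \<Delta>(x := live T)" for T and \<Delta> :: "'a lenv"
    by (auto simp: bind1_def)
  then show ?thesis by (simp add: CSub_def wtC_rename_inj inj_bind1 dom_subset_iff range_bind1)
qed

text \<open>Here the pushed environment is split before it reaches the renamed parts, so the
  splitting itself has to be transported: back along \<open>bind2 x y\<close> by composition, and
  forward along it by \<open>moves_splits\<close>.\<close>

lemma wtC_Res:
  "wtC (Res x ms y C) \<Gamma> \<phi> T \<longleftrightarrow> \<Gamma> x = None \<and> \<Gamma> y = None \<and>
    (\<exists>\<Gamma>1 \<Gamma>2 S S'. (x = y \<longrightarrow> S = End) \<and>
      splits (\<Gamma>(y := live (Sess (dual S)), x := live (Sess S'))) \<Gamma>1 \<Gamma>2 \<and> \<Gamma>1 x = None \<and>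
      wtB ms \<Gamma>1 S' S \<and> wtC C \<Gamma>2 \<phi> T)" (is "?L \<longleftrightarrow> ?R")
proof -
  let ?b = "bind2 x y"
  let ?p = "\<lambda>S S'. push (Sess S') (push (Sess (dual S)) \<Gamma>)"
  let ?u = "\<lambda>S S'. \<Gamma>(y := live (Sess (dual S)), x := live (Sess S'))"
  have r: "dom (?p S S') \<subseteq> range ?b \<longleftrightarrow> \<Gamma> x = None \<and> \<Gamma> y = None \<and> (x = y \<longrightarrow> S = End)" for S S'
    by (auto simp: dom_subset_iff range_bind2)
  have c: "?p S S' \<circ> ?b = ?u S S'" for S S'
    by (auto simp: bind2_def)
  show ?thesis
  proof
    assume ?L
    then obtain \<Gamma>1 \<Gamma>2 S S' where *: "splits (?p S S') \<Gamma>1 \<Gamma>2" "\<Gamma>1 0 = None" "dom \<Gamma>1 \<subseteq> range ?b"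
      "wtB ms (\<Gamma>1 \<circ> ?b) S' S" "dom \<Gamma>2 \<subseteq> range ?b" "wtC C (\<Gamma>2 \<circ> ?b) \<phi> T"
      by (auto simp: Res_def wtB_rename_inj wtC_rename_inj inj_bind2)
    then have "dom (?p S S') \<subseteq> range ?b" using splits_dom by blast
    then have "\<Gamma> x = None \<and> \<Gamma> y = None \<and> (x = y \<longrightarrow> S = End)" using r by blast
    moreover have "splits (?u S S') (\<Gamma>1 \<circ> ?b) (\<Gamma>2 \<circ> ?b)"
      using *(1) by (simp only: splits_def c[symmetric] o_apply) blast
    moreover have "(\<Gamma>1 \<circ> ?b) x = None" using *(2) by (simp add: bind2_def)
    ultimately show ?R using *(4,6) by blast
  next
    assume ?R
    then obtain \<Gamma>1 \<Gamma>2 S S' where *: "\<Gamma> x = None \<and> \<Gamma> y = None \<and> (x = y \<longrightarrow> S = End)"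
      "splits (?u S S') \<Gamma>1 \<Gamma>2" "\<Gamma>1 x = None" "wtB ms \<Gamma>1 S' S" "wtC C \<Gamma>2 \<phi> T"
      by blast
    have "moves ?b (?u S S') (?p S S')"
      using moves_comp[OF inj_bind2 r[THEN iffD2, OF *(1)]] by (simp only: c)
    then obtain \<Gamma>1' \<Gamma>2' where m: "moves ?b \<Gamma>1 \<Gamma>1'" "moves ?b \<Gamma>2 \<Gamma>2'" "splits (?p S S') \<Gamma>1' \<Gamma>2'"
      using moves_splits *(2) by blast
    have "0 \<notin> ?b ` dom \<Gamma>1"
      using *(3) by (auto simp: bind2_def split: if_splits)
    then have "\<Gamma>1' 0 = None" using m(1) unfolding moves_def by (metis domIff)
    then show ?L
      using m(3) wtB_rename[OF *(4) m(1)] wtC_rename[OF *(5) m(2)] by (auto simp: Res_def)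
  qed
qed

section \<open>Contexts\<close>

text \<open>The environment \<open>\<Gamma>h\<close> at the hole consists of a part \<open>\<Gamma>o\<close> of \<open>\<Gamma>\<close> and of entries \<open>\<Gamma>b\<close> for
  names bound by the context; the context itself uses the rest \<open>\<Gamma>r\<close> of \<open>\<Gamma>\<close>.  Replacing \<open>\<Gamma>o\<close>
  by another environment \<open>\<Gamma>o'\<close> has the same effect on the outside, as expressed by \<open>Q\<close>.\<close>

definition framed ::
  "var set \<Rightarrow> var set \<Rightarrow> 'l lenv \<Rightarrow> 'l lenv \<Rightarrow> ('l lenv \<Rightarrow> 'l lenv \<Rightarrow> bool) \<Rightarrow> bool" where
  "framed X B \<Gamma> \<Gamma>h Q \<longleftrightarrow> (\<exists>\<Gamma>r \<Gamma>o \<Gamma>b. splits \<Gamma> \<Gamma>r \<Gamma>o \<and> dom \<Gamma>r \<subseteq> X \<and> dom \<Gamma>b \<subseteq> B \<and>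
    dom \<Gamma>o \<inter> B = {} \<and> \<Gamma>h = \<Gamma>o ++ \<Gamma>b \<and>
    (\<forall>\<Gamma>' \<Gamma>o'. splits \<Gamma>' \<Gamma>r \<Gamma>o' \<longrightarrow> dom \<Gamma>o' \<inter> B = {} \<longrightarrow> Q (\<Gamma>o' ++ \<Gamma>b) \<Gamma>'))"

section \<open>Calculus of frames: passing siblings and binders, changing the hole\<close>

lemma map_add_upd_None: "\<Delta> x = None \<Longrightarrow> \<Gamma>(x := t) ++ \<Delta> = (\<Gamma> ++ \<Delta>)(x := t)"
  by (rule ext) (simp add: map_add_def split: option.split)

lemma splits_add_both:
  assumes "splits \<Gamma> \<Gamma>1 \<Gamma>2" "dom \<Gamma>2 \<inter> dom \<Delta> = {}"
  shows "splits (\<Gamma> ++ \<Delta>) (\<Gamma>1 ++ \<Delta>) \<Gamma>2"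
  unfolding splits_def
proof
  fix n
  have "\<Gamma>2 n = None \<or> \<Delta> n = None" using assms(2) by auto
  then show "(\<Gamma>1 ++ \<Delta>) n = None \<and> (\<Gamma> ++ \<Delta>) n = \<Gamma>2 n \<or> \<Gamma>2 n = None \<and> (\<Gamma> ++ \<Delta>) n = (\<Gamma>1 ++ \<Delta>) n"
    using assms(1)[unfolded splits_def, rule_format, of n] by (auto simp: map_add_def split: option.split)
qed

text \<open>The entries in \<open>\<Delta>\<close> are disjoint from \<open>\<Gamma>2\<close>, so
  all of them stay on the side of \<open>\<Gamma>1\<close>, and \<open>\<Gamma>2\<close> is carved
  out of \<open>\<Gamma>\<close> alone.\<close>

lemma splits_add_cancel:
  assumes "splits (\<Gamma> ++ \<Delta>) \<Gamma>1 \<Gamma>2" "dom \<Gamma>2 \<inter> dom \<Delta> = {}" "dom \<Gamma> \<inter> dom \<Delta> = {}"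
  shows "splits \<Gamma> (\<Gamma> |` (- dom \<Gamma>2)) \<Gamma>2" and "\<Gamma>1 = \<Gamma> |` (- dom \<Gamma>2) ++ \<Delta>"
proof -
  have n: "\<Gamma>1 n = None \<and> (\<Gamma> ++ \<Delta>) n = \<Gamma>2 n \<or> \<Gamma>2 n = None \<and> (\<Gamma> ++ \<Delta>) n = \<Gamma>1 n"
    "\<Gamma>2 n = None \<or> \<Delta> n = None" "\<Gamma> n = None \<or> \<Delta> n = None" for n
    using assms unfolding splits_def by auto
  show "splits \<Gamma> (\<Gamma> |` (- dom \<Gamma>2)) \<Gamma>2"
    unfolding splits_def
  proof
    show "(\<Gamma> |` (- dom \<Gamma>2)) n = None \<and> \<Gamma> n = \<Gamma>2 n \<or> \<Gamma>2 n = None \<and> \<Gamma> n = (\<Gamma> |` (- dom \<Gamma>2)) n" for n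
      using n[of n] by (cases "\<Gamma>2 n") (auto simp: map_add_def restrict_map_def)
  qed
  show "\<Gamma>1 = \<Gamma> |` (- dom \<Gamma>2) ++ \<Delta>"
  proof
    show "\<Gamma>1 n = (\<Gamma> |` (- dom \<Gamma>2) ++ \<Delta>) n" for n
      using n[of n] by (cases "\<Gamma>2 n"; cases "\<Delta> n"; cases "\<Gamma>1 n") (auto simp: map_add_def restrict_map_def)
  qed
qed

lemma framed_hole: "(\<And>\<Gamma>. Q \<Gamma> \<Gamma>) \<Longrightarrow> framed {} {} \<Gamma> \<Gamma> Q"
  unfolding framed_def by (intro exI[of _ Map.empty] exI[of _ \<Gamma>]) simp

lemma framed_mono:
  assumes "framed X B \<Gamma> \<Gamma>h Q" "X \<subseteq> X'" "\<And>\<Gamma>h \<Gamma>. Q \<Gamma>h \<Gamma> \<Longrightarrow> Q' \<Gamma>h \<Gamma>"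
  shows "framed X' B \<Gamma> \<Gamma>h Q'"
proof -
  obtain \<Gamma>r \<Gamma>o \<Gamma>b where *: "splits \<Gamma> \<Gamma>r \<Gamma>o" "dom \<Gamma>r \<subseteq> X" "dom \<Gamma>b \<subseteq> B" "dom \<Gamma>o \<inter> B = {}"
    "\<Gamma>h = \<Gamma>o ++ \<Gamma>b" "\<And>\<Gamma>' \<Gamma>o'. splits \<Gamma>' \<Gamma>r \<Gamma>o' \<Longrightarrow> dom \<Gamma>o' \<inter> B = {} \<Longrightarrow> Q (\<Gamma>o' ++ \<Gamma>b) \<Gamma>'"
    using assms(1) unfolding framed_def by metis
  show ?thesis
    unfolding framed_def using *(1) subset_trans[OF *(2) assms(2)] *(3-5) assms(3)[OF *(6)] by blast
qed

text \<open>One step outwards past a sibling typed in \<open>\<Gamma>2\<close>: that share joins the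
  part used by the context, and the outer part at the hole stays the same.\<close>

lemma framed_splits:
  assumes "framed X B \<Gamma>1 \<Gamma>h Q" "splits \<Gamma> \<Gamma>1 \<Gamma>2" "dom \<Gamma>2 \<subseteq> Y"
    and "\<And>\<Gamma>h \<Gamma>1 \<Gamma>. Q \<Gamma>h \<Gamma>1 \<Longrightarrow> splits \<Gamma> \<Gamma>1 \<Gamma>2 \<Longrightarrow> Q' \<Gamma>h \<Gamma>"
  shows "framed (X \<union> Y) B \<Gamma> \<Gamma>h Q'"
proof -
  obtain \<Gamma>r \<Gamma>o \<Gamma>b where *: "splits \<Gamma>1 \<Gamma>r \<Gamma>o" "dom \<Gamma>r \<subseteq> X" "dom \<Gamma>b \<subseteq> B" "dom \<Gamma>o \<inter> B = {}"
    "\<Gamma>h = \<Gamma>o ++ \<Gamma>b" "\<And>\<Gamma>' \<Gamma>o'. splits \<Gamma>' \<Gamma>r \<Gamma>o' \<Longrightarrow> dom \<Gamma>o' \<inter> B = {} \<Longrightarrow> Q (\<Gamma>o' ++ \<Gamma>b) \<Gamma>'"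
    using assms(1) unfolding framed_def by metis
  obtain \<Delta> where d: "splits \<Gamma> \<Delta> \<Gamma>o" "splits \<Delta> \<Gamma>2 \<Gamma>r"
    using splits_assoc[OF splits_sym[OF assms(2)] *(1)] .
  have "dom \<Delta> \<subseteq> X \<union> Y" using splits_dom[OF d(2)] *(2) assms(3) by auto
  moreover have "Q' (\<Gamma>o' ++ \<Gamma>b) \<Gamma>'" if s: "splits \<Gamma>' \<Delta> \<Gamma>o'" and o: "dom \<Gamma>o' \<inter> B = {}" for \<Gamma>' \<Gamma>o'
  proof -
    obtain \<Delta>' where d': "splits \<Gamma>' \<Delta>' \<Gamma>2" "splits \<Delta>' \<Gamma>o' \<Gamma>r"
      by (rule splits_assoc[OF splits_sym[OF s] splits_sym[OF d(2)]])
    show ?thesis using assms(4)[OF *(6)[OF splits_sym[OF d'(2)] o] d'(1)] .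
  qed
  ultimately show ?thesis unfolding framed_def using d(1) *(3-5) by blast
qed

text \<open>One step outwards past a binder of \<open>z\<close>: an entry of \<open>z\<close> at the
  hole leaves the exchangeable outer part and becomes a fixed entry of a bound name.\<close>

lemma framed_bind:
  assumes "framed X B (\<Gamma>(z := t)) \<Gamma>h Q" "\<Gamma> z = None"
    and "\<And>\<Gamma>h \<Gamma>. Q \<Gamma>h (\<Gamma>(z := t)) \<Longrightarrow> \<Gamma> z = None \<Longrightarrow> Q' \<Gamma>h \<Gamma>"
  shows "framed (X - {z}) (insert z B) \<Gamma> \<Gamma>h Q'"
proof -
  obtain \<Gamma>r \<Gamma>o \<Gamma>b where *: "splits (\<Gamma>(z := t)) \<Gamma>r \<Gamma>o" "dom \<Gamma>r \<subseteq> X" "dom \<Gamma>b \<subseteq> B" "dom \<Gamma>o \<inter> B = {}"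
    "\<Gamma>h = \<Gamma>o ++ \<Gamma>b" "\<And>\<Gamma>' \<Gamma>o'. splits \<Gamma>' \<Gamma>r \<Gamma>o' \<Longrightarrow> dom \<Gamma>o' \<inter> B = {} \<Longrightarrow> Q (\<Gamma>o' ++ \<Gamma>b) \<Gamma>'"
    using assms(1) unfolding framed_def by metis
  \<comment> \<open>If \<open>z\<close> is bound again further in, \<open>\<Gamma>o\<close> has no
    entry for it, and the inner entry in \<open>\<Gamma>b\<close> has to survive.\<close>
  let ?\<Gamma>b = "if \<Gamma>o z = None then \<Gamma>b else \<Gamma>b(z := \<Gamma>o z)"
  have "z \<in> B \<Longrightarrow> \<Gamma>o z = None" using *(4) by auto
  have bz: "\<Gamma>o z \<noteq> None \<Longrightarrow> \<Gamma>b z = None" using *(3,4) by auto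
  have "splits \<Gamma> (\<Gamma>r(z := None)) (\<Gamma>o(z := None))"
    using *(1) assms(2) unfolding splits_def by (metis fun_upd_apply)
  moreover have "dom (\<Gamma>r(z := None)) \<subseteq> X - {z}" using *(2) by auto
  moreover have "dom ?\<Gamma>b \<subseteq> insert z B" using *(3) by auto
  moreover have "dom (\<Gamma>o(z := None)) \<inter> insert z B = {}" using *(4) by auto
  moreover have "\<Gamma>h = \<Gamma>o(z := None) ++ ?\<Gamma>b"
    using bz *(5) by (auto simp: map_add_def split: option.splits)
  moreover have "Q' (\<Gamma>o' ++ ?\<Gamma>b) \<Gamma>'"
    if s: "splits \<Gamma>' (\<Gamma>r(z := None)) \<Gamma>o'" and d: "dom \<Gamma>o' \<inter> insert z B = {}" for \<Gamma>' \<Gamma>o'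
  proof (rule assms(3))
    have z: "\<Gamma>o' z = None" using d by auto
    then show "\<Gamma>' z = None" using s unfolding splits_def by (metis fun_upd_same)
    \<comment> \<open>A replacement of the outer part is given the old entry of \<open>z\<close>, so
      that inside the binder \<open>z\<close> keeps the value \<open>t\<close>.\<close>
    have "splits (\<Gamma>'(z := t)) \<Gamma>r (\<Gamma>o'(z := \<Gamma>o z))"
      using *(1) s unfolding splits_def by (metis fun_upd_apply)
    moreover have "dom (\<Gamma>o'(z := \<Gamma>o z)) \<inter> B = {}" using *(4) d by auto
    moreover have "\<Gamma>o'(z := \<Gamma>o z) ++ \<Gamma>b = \<Gamma>o' ++ ?\<Gamma>b"
      using bz z by (auto simp: map_add_def fun_eq_iff split: option.splits)
    ultimately show "Q (\<Gamma>o' ++ ?\<Gamma>b) (\<Gamma>'(z := t))" using *(6) by metis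
  qed
  ultimately show ?thesis unfolding framed_def by blast
qed

lemma framed_here: "framed X B \<Gamma> \<Gamma>h Q \<Longrightarrow> Q \<Gamma>h \<Gamma>"
  unfolding framed_def by metis

text \<open>For hatted contexts: with nothing bound over the hole, its entire environment can be
  exchanged, which lets a term leave or enter the hole.\<close>

lemma framed_unbound:
  "framed X {} \<Gamma> \<Gamma>h Q \<longleftrightarrow>
    (\<exists>\<Gamma>r. splits \<Gamma> \<Gamma>r \<Gamma>h \<and> dom \<Gamma>r \<subseteq> X \<and> (\<forall>\<Gamma>' \<Gamma>h'. splits \<Gamma>' \<Gamma>r \<Gamma>h' \<longrightarrow> Q \<Gamma>h' \<Gamma>'))"
  unfolding framed_def by auto

text \<open>Either alternative of the last assumption ensures that the context has no share in
  \<open>x\<close>, so the entry can be changed inside and outside at once. This is how a session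
  type advances under a context and how fresh endpoints reach the hole of
  \<open>new\<close>.\<close>

lemma framed_update:
  assumes "framed X B \<Gamma> \<Gamma>h Q" "x \<notin> B" "x \<notin> X \<or> \<Gamma>h x \<noteq> None"
  shows "\<Gamma>h x = \<Gamma> x" and "framed X B (\<Gamma>(x := t)) (\<Gamma>h(x := t)) Q"
proof -
  obtain \<Gamma>r \<Gamma>o \<Gamma>b where *: "splits \<Gamma> \<Gamma>r \<Gamma>o" "dom \<Gamma>r \<subseteq> X" "dom \<Gamma>b \<subseteq> B" "dom \<Gamma>o \<inter> B = {}"
    "\<Gamma>h = \<Gamma>o ++ \<Gamma>b" "\<And>\<Gamma>' \<Gamma>o'. splits \<Gamma>' \<Gamma>r \<Gamma>o' \<Longrightarrow> dom \<Gamma>o' \<inter> B = {} \<Longrightarrow> Q (\<Gamma>o' ++ \<Gamma>b) \<Gamma>'"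
    using assms(1) unfolding framed_def by metis
  have b: "\<Gamma>b x = None" using *(3) assms(2) by auto
  then have o: "\<Gamma>h x = \<Gamma>o x" using *(5) by (simp add: map_add_def)
  have r: "\<Gamma>r x = None" using assms(3) *(1,2) o unfolding splits_def by (metis domIff subsetD)
  then show "\<Gamma>h x = \<Gamma> x" using o *(1) unfolding splits_def by metis
  have "splits (\<Gamma>(x := t)) \<Gamma>r (\<Gamma>o(x := t))"
    using *(1) r unfolding splits_def by (metis fun_upd_apply)
  moreover have "dom (\<Gamma>o(x := t)) \<inter> B = {}" using *(4) assms(2) by auto
  moreover have "\<Gamma>o(x := t) ++ \<Gamma>b = \<Gamma>h(x := t)"
    using b *(5) by (simp add: map_add_upd_None)
  ultimately show "framed X B (\<Gamma>(x := t)) (\<Gamma>h(x := t)) Q"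
    unfolding framed_def using *(2,3,6) by metis
qed

text \<open>Moves a substitution for \<open>x\<close> inwards. The context does not mention
  \<open>x\<close>, so its entry must be at the hole, where it is traded for the environment
  \<open>\<Gamma>2\<close> of the substituted term; no name of \<open>\<Gamma>2\<close> is captured
  on the way.\<close>

lemma framed_sink:
  assumes "framed X B (\<Gamma>1(x := t)) \<Gamma>h Q" "x \<notin> X" "x \<notin> B" "\<Gamma>1 x = None"
    and "splits \<Gamma> \<Gamma>1 \<Gamma>2" "dom \<Gamma>2 \<inter> B = {}"
  shows "\<exists>\<Gamma>h1 \<Gamma>h'. \<Gamma>h = \<Gamma>h1(x := t) \<and> \<Gamma>h1 x = None \<and> splits \<Gamma>h' \<Gamma>h1 \<Gamma>2 \<and> Q \<Gamma>h' \<Gamma>"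
proof -
  obtain \<Gamma>r \<Gamma>o \<Gamma>b where *: "splits (\<Gamma>1(x := t)) \<Gamma>r \<Gamma>o" "dom \<Gamma>r \<subseteq> X" "dom \<Gamma>b \<subseteq> B" "dom \<Gamma>o \<inter> B = {}"
    "\<Gamma>h = \<Gamma>o ++ \<Gamma>b" "\<And>\<Gamma>' \<Gamma>o'. splits \<Gamma>' \<Gamma>r \<Gamma>o' \<Longrightarrow> dom \<Gamma>o' \<inter> B = {} \<Longrightarrow> Q (\<Gamma>o' ++ \<Gamma>b) \<Gamma>'"
    using assms(1) unfolding framed_def by metis
  have b: "\<Gamma>b x = None" using *(3) assms(3) by auto
  have r: "\<Gamma>r x = None" using *(2) assms(2) by auto
  then have o: "\<Gamma>o x = t" using *(1) unfolding splits_def by (metis fun_upd_same)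
  let ?\<Gamma>o = "\<Gamma>o(x := None)"
  have s: "splits \<Gamma>1 \<Gamma>r ?\<Gamma>o"
    using *(1) r assms(4) unfolding splits_def by (metis fun_upd_apply)
  then obtain \<Delta> where d: "splits \<Gamma> \<Gamma>r \<Delta>" "splits \<Delta> \<Gamma>2 ?\<Gamma>o"
    using splits_assoc[OF splits_sym[OF assms(5)] splits_sym] splits_sym by metis
  have dB: "dom \<Delta> \<inter> B = {}" using splits_dom[OF d(2)] *(4) assms(6) by auto
  have "\<Gamma>h = (?\<Gamma>o ++ \<Gamma>b)(x := t)"
    using *(5) o by (simp add: b map_add_upd_None[symmetric] del: fun_upd_apply) auto
  moreover have "(?\<Gamma>o ++ \<Gamma>b) x = None" using b by (simp add: map_add_def)
  moreover have "splits (\<Delta> ++ \<Gamma>b) (?\<Gamma>o ++ \<Gamma>b) \<Gamma>2"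
    using splits_add_both[OF splits_sym[OF d(2)]] *(3) assms(6) by blast
  ultimately show ?thesis using *(6)[OF d(1) dB] by blast
qed

text \<open>The reverse trade: \<open>\<Gamma>2\<close> leaves the hole, which is possible because
  it avoids the bound names, and an entry for \<open>x\<close> comes in from outside.\<close>

lemma framed_float:
  assumes "framed X B \<Gamma> \<Gamma>h Q" "x \<notin> X" "x \<notin> B" "\<Gamma>h1 x = None"
    and "splits \<Gamma>h \<Gamma>h1 \<Gamma>2" "dom \<Gamma>2 \<inter> B = {}"
  shows "\<exists>\<Gamma>1. splits \<Gamma> \<Gamma>1 \<Gamma>2 \<and> \<Gamma>1 x = None \<and> Q (\<Gamma>h1(x := t)) (\<Gamma>1(x := t))"
proof -
  obtain \<Gamma>r \<Gamma>o \<Gamma>b where *: "splits \<Gamma> \<Gamma>r \<Gamma>o" "dom \<Gamma>r \<subseteq> X" "dom \<Gamma>b \<subseteq> B" "dom \<Gamma>o \<inter> B = {}"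
    "\<Gamma>h = \<Gamma>o ++ \<Gamma>b" "\<And>\<Gamma>' \<Gamma>o'. splits \<Gamma>' \<Gamma>r \<Gamma>o' \<Longrightarrow> dom \<Gamma>o' \<inter> B = {} \<Longrightarrow> Q (\<Gamma>o' ++ \<Gamma>b) \<Gamma>'"
    using assms(1) unfolding framed_def by metis
  have r: "\<Gamma>r x = None" using *(2) assms(2) by auto
  have b: "\<Gamma>b x = None" using *(3) assms(3) by auto
  let ?\<Gamma>o = "\<Gamma>o |` (- dom \<Gamma>2)"
  have "splits \<Gamma>o ?\<Gamma>o \<Gamma>2" "\<Gamma>h1 = ?\<Gamma>o ++ \<Gamma>b"
    using splits_add_cancel[OF assms(5)[unfolded *(5)]] assms(6) *(3,4) by blast+
  then obtain \<Gamma>1 where d: "splits \<Gamma> \<Gamma>1 \<Gamma>2" "splits \<Gamma>1 \<Gamma>r ?\<Gamma>o"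
    using splits_assoc *(1) by blast
  have o: "?\<Gamma>o x = None" using \<open>\<Gamma>h1 = _\<close> assms(4) b by (simp add: map_add_def)
  have "splits (\<Gamma>1(x := t)) \<Gamma>r (?\<Gamma>o(x := t))"
    using d(2) r unfolding splits_def by (metis fun_upd_apply)
  moreover have "dom (?\<Gamma>o(x := t)) \<inter> B = {}" using *(4) assms(3) by auto
  moreover have "?\<Gamma>o(x := t) ++ \<Gamma>b = \<Gamma>h1(x := t)"
    using b \<open>\<Gamma>h1 = _\<close> by (simp add: map_add_upd_None)
  moreover have "\<Gamma>1 x = None" using d(2) r o unfolding splits_def by metis
  ultimately show ?thesis using *(6) d(1) by metis
qed

section \<open>Free names of contexts\<close>

lemma rfn_simps [simp]:
  "rfn RHole = {}"
  "rfn (RApp R M) = rfn R \<union> fn M"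
  "rfn (RSpawn R) = rfn R"
  "rfn (RSend R) = rfn R"
  "rfn (RRecv R) = rfn R"
  "rfn (RLetP x y R M) = rfn R \<union> (fn M - {x, y})"
  "rfn (RSelect l R) = rfn R"
  "rfn (RCase R B) = rfn R \<union> \<Union> (fmran' (fmmap fn B))"
  "rfn (RESubL R M x) = rfn R - {x} \<union> fn M"
  "rfn (RESubR M R x) = rfn R \<union> (fn M - {x})"
  "rfn (RSendP M R) = rfn R \<union> fn M"
  by (auto simp: rfn_def fn_LetP fn_ESub)

lemma ffn_simps [simp]:
  "ffn (FThread \<phi> R) = rfn R"
  "ffn (FCSub C R x) = rfn R \<union> (fn_conf C - {x})"
  by (auto simp: ffn_def rfn_def fn_CSub)

lemma gfn_simps [simp]:
  "gfn GHole = {}"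
  "gfn (GPar G D) = gfn G \<union> fn_conf D"
  "gfn (GRes x ms y G) = (gfn G \<union> fn_msgs ms) - {x} - {y}"
  "gfn (GCSub G M x) = gfn G - {x} \<union> fn M"
  by (auto simp: gfn_def fn_Res fn_CSub)

text \<open>\<open>RESubL\<close> is the only constructor that binds over the hole of a thread
  context.\<close>

lemma fhat_fbinders: "fhat F \<Longrightarrow> fbinders F = {}"
proof -
  have "rhat R \<Longrightarrow> rbinders R = {}" for R :: "'l rctx"
    by (induction R) auto
  then show "fhat F \<Longrightarrow> fbinders F = {}" by (cases F) auto
qed

lemma dom_subset_if_upd: "dom (\<Gamma>(x := t)) \<subseteq> A \<Longrightarrow> \<Gamma> x = None \<Longrightarrow> dom \<Gamma> \<subseteq> A - {x}"
proof
  fix n assume a: "dom (\<Gamma>(x := t)) \<subseteq> A" "\<Gamma> x = None" "n \<in> dom \<Gamma>"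
  then have "n \<noteq> x" by auto
  moreover from this have "n \<in> dom (\<Gamma>(x := t))" using a(3) by auto
  ultimately show "n \<in> A - {x}" using a(1) by blast
qed

section \<open>Decomposition of plugged terms and configurations\<close>

abbreviation framesM :: "'l rctx \<Rightarrow> 'l lenv \<Rightarrow> 'l ty \<Rightarrow> 'l lenv \<Rightarrow> 'l ty \<Rightarrow> bool" where
  "framesM R \<Gamma> U \<Gamma>h V \<equiv> framed (rfn R) (rbinders R) \<Gamma> \<Gamma>h
    (\<lambda>\<Gamma>h \<Gamma>. \<forall>N. wtM N \<Gamma>h V \<longrightarrow> wtM (rplug R N) \<Gamma> U)"

text \<open>Inversion and replacement in one statement: terms do not determine their types, so the
  type of the hole and the share of the context must come from the same derivation in order to fit a
  later replacement.\<close>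

lemma wtM_rplug:
  "wtM (rplug R M) \<Gamma> U \<Longrightarrow> \<exists>V \<Gamma>h. wtM M \<Gamma>h V \<and> framesM R \<Gamma> U \<Gamma>h V"
proof (induction R arbitrary: \<Gamma> U)
  case RHole
  then have "wtM M \<Gamma> U" by simp
  moreover have "framesM RHole \<Gamma> U \<Gamma> U"
    unfolding rfn_simps rbinders.simps by (rule framed_hole) simp
  ultimately show ?case by blast
next
  case (RApp R P)
  from RApp.prems obtain \<Gamma>1 \<Gamma>2 T where *: "splits \<Gamma> \<Gamma>1 \<Gamma>2" "wtM (rplug R M) \<Gamma>1 (Lolli T U)" "wtM P \<Gamma>2 T"
    by auto
  obtain V \<Gamma>h where h: "wtM M \<Gamma>h V" "framesM R \<Gamma>1 (Lolli T U) \<Gamma>h V"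
    using RApp.IH[OF *(2)] by blast
  have "framesM (RApp R P) \<Gamma> U \<Gamma>h V"
    unfolding rfn_simps rbinders.simps rplug.simps wtM.simps
    by (rule framed_splits[OF h(2) *(1) wtM_dom[OF *(3)]]) (use *(3) in blast)
  then show ?case using h(1) by blast
next
  case (RLetP x y R P)
  from RLetP.prems obtain \<Gamma>1 \<Gamma>2 T T' where *: "splits \<Gamma> \<Gamma>1 \<Gamma>2" "wtM (rplug R M) \<Gamma>1 (Prod T T')"
    "wtM (rename (bind2 x y) P) (push T (push T' \<Gamma>2)) U"
    unfolding rplug.simps LetP_def wtM.simps by blast
  obtain V \<Gamma>h where h: "wtM M \<Gamma>h V" "framesM R \<Gamma>1 (Prod T T') \<Gamma>h V"
    using RLetP.IH[OF *(2)] by blast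
  \<comment> \<open>The entries of \<open>\<Gamma>2\<close> sit at indices
    \<open>Suc (Suc n)\<close>, which \<open>bind2 x y\<close> reaches only from names
    \<open>n\<close> outside \<open>{x, y}\<close>.\<close>
  have "dom (push T (push T' \<Gamma>2)) \<subseteq> bind2 x y ` fn P" using wtM_dom[OF *(3)] by (simp add: fn_rename)
  then have "dom \<Gamma>2 \<subseteq> fn P - {x, y}"
    by (auto dest!: subsetD[of _ _ "Suc (Suc _)"] simp: bind2_def split: if_splits)
  note f = framed_splits[OF h(2) *(1) this]
  have "framesM (RLetP x y R P) \<Gamma> U \<Gamma>h V"
    unfolding rfn_simps rbinders.simps rplug.simps LetP_def wtM.simps
    by (rule f) (use *(3) in blast)
  then show ?case using h(1) by blast
next
  case (RCase R B)
  from RCase.prems obtain \<Gamma>1 \<Gamma>2 Ss where *: "splits \<Gamma> \<Gamma>1 \<Gamma>2" "wtM (rplug R M) \<Gamma>1 (Sess (EChoice Ss))"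
    "fmdom' Ss \<noteq> {}" "fmdom' B = fmdom' Ss"
    "\<And>i S N. fmlookup Ss i = Some S \<Longrightarrow> fmlookup B i = Some N \<Longrightarrow> wtM N \<Gamma>2 (Lolli (Sess S) U)"
    unfolding rplug.simps wtM_Case by blast
  obtain V \<Gamma>h where h: "wtM M \<Gamma>h V" "framesM R \<Gamma>1 (Sess (EChoice Ss)) \<Gamma>h V"
    using RCase.IH[OF *(2)] by blast
  obtain i S N where i: "fmlookup Ss i = Some S" "fmlookup B i = Some N"
    using *(3,4) by (metis fmlookup_dom'_iff ex_in_conv)
  then have "dom \<Gamma>2 \<subseteq> fn N" using *(5) wtM_dom by blast
  then have "dom \<Gamma>2 \<subseteq> \<Union> (fmran' (fmmap fn B))"
    using fmran'I[OF i(2)] by (auto simp: fmap.set_map)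
  note f = framed_splits[OF h(2) *(1) this]
  have "framesM (RCase R B) \<Gamma> U \<Gamma>h V"
    unfolding rfn_simps rbinders.simps rplug.simps wtM_Case
    by (rule f) (use *(3-5) in blast)
  then show ?case using h(1) by blast
next
  case (RESubL R P z)
  from RESubL.prems obtain \<Gamma>1 \<Gamma>2 T where *: "splits \<Gamma> \<Gamma>1 \<Gamma>2" "\<Gamma>1 z = None"
    "wtM (rplug R M) (\<Gamma>1(z := live T)) U" "wtM P \<Gamma>2 T"
    by (auto simp: wtM_ESub)
  obtain V \<Gamma>h where h: "wtM M \<Gamma>h V" "framesM R (\<Gamma>1(z := live T)) U \<Gamma>h V"
    using RESubL.IH[OF *(3)] by blast
  have "framed (rfn R - {z}) (insert z (rbinders R)) \<Gamma>1 \<Gamma>h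
    (\<lambda>\<Gamma>h \<Gamma>. \<Gamma> z = None \<and> (\<forall>N. wtM N \<Gamma>h V \<longrightarrow> wtM (rplug R N) (\<Gamma>(z := live T)) U))"
    by (rule framed_bind[OF h(2) *(2)]) blast
  note f = framed_splits[OF this *(1) wtM_dom[OF *(4)]]
  have "framesM (RESubL R P z) \<Gamma> U \<Gamma>h V"
    unfolding rfn_simps rbinders.simps rplug.simps wtM_ESub
    by (rule f) (use *(4) in blast)
  then show ?case using h(1) by blast
next
  case (RESubR P R z)
  from RESubR.prems obtain \<Gamma>1 \<Gamma>2 T where *: "splits \<Gamma> \<Gamma>1 \<Gamma>2" "\<Gamma>1 z = None"
    "wtM P (\<Gamma>1(z := live T)) U" "wtM (rplug R M) \<Gamma>2 T"
    by (auto simp: wtM_ESub)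
  obtain V \<Gamma>h where h: "wtM M \<Gamma>h V" "framesM R \<Gamma>2 T \<Gamma>h V"
    using RESubR.IH[OF *(4)] by blast
  have "dom \<Gamma>1 \<subseteq> fn P - {z}"
    by (rule dom_subset_if_upd[OF wtM_dom[OF *(3)] *(2)])
  note f = framed_splits[OF h(2) splits_sym[OF *(1)] this]
  have "framesM (RESubR P R z) \<Gamma> U \<Gamma>h V"
    unfolding rfn_simps rbinders.simps rplug.simps wtM_ESub
    by (rule f) (use *(2,3) splits_sym in blast)
  then show ?case using h(1) by blast
next
  case (RSendP P R)
  from RSendP.prems obtain \<Gamma>1 \<Gamma>2 T S where *: "splits \<Gamma> \<Gamma>1 \<Gamma>2" "U = Sess S"
    "wtM P \<Gamma>1 T" "wtM (rplug R M) \<Gamma>2 (Sess (Out T S))"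
    by auto
  obtain V \<Gamma>h where h: "wtM M \<Gamma>h V" "framesM R \<Gamma>2 (Sess (Out T S)) \<Gamma>h V"
    using RSendP.IH[OF *(4)] by blast
  have "framesM (RSendP P R) \<Gamma> U \<Gamma>h V"
    unfolding rfn_simps rbinders.simps rplug.simps wtM.simps
    by (rule framed_splits[OF h(2) splits_sym[OF *(1)] wtM_dom[OF *(3)]])
      (use *(2,3) splits_sym in blast)
  then show ?case using h(1) by blast
next
  case (RSpawn R)
  from RSpawn.prems have "wtM (rplug R M) \<Gamma> (Prod One U)" by simp
  then obtain V \<Gamma>h where h: "wtM M \<Gamma>h V" "framesM R \<Gamma> (Prod One U) \<Gamma>h V"
    using RSpawn.IH by blast
  have "framesM (RSpawn R) \<Gamma> U \<Gamma>h V"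
    unfolding rfn_simps rbinders.simps rplug.simps wtM.simps
    by (rule framed_mono[OF h(2) subset_refl]) blast
  then show ?case using h(1) by blast
next
  case (RSend R)
  from RSend.prems obtain T S where *: "U = Sess S" "wtM (rplug R M) \<Gamma> (Prod T (Sess (Out T S)))" by auto
  obtain V \<Gamma>h where h: "wtM M \<Gamma>h V" "framesM R \<Gamma> (Prod T (Sess (Out T S))) \<Gamma>h V"
    using RSend.IH[OF *(2)] by blast
  have "framesM (RSend R) \<Gamma> U \<Gamma>h V"
    unfolding rfn_simps rbinders.simps rplug.simps wtM.simps
    by (rule framed_mono[OF h(2) subset_refl]) (use *(1) in blast)
  then show ?case using h(1) by blast
next
  case (RRecv R)
  from RRecv.prems obtain T S where *: "U = Prod T (Sess S)" "wtM (rplug R M) \<Gamma> (Sess (In T S))" by auto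
  obtain V \<Gamma>h where h: "wtM M \<Gamma>h V" "framesM R \<Gamma> (Sess (In T S)) \<Gamma>h V"
    using RRecv.IH[OF *(2)] by blast
  have "framesM (RRecv R) \<Gamma> U \<Gamma>h V"
    unfolding rfn_simps rbinders.simps rplug.simps wtM.simps
    by (rule framed_mono[OF h(2) subset_refl]) (use *(1) in blast)
  then show ?case using h(1) by blast
next
  case (RSelect l R)
  from RSelect.prems obtain Ss S where *: "U = Sess S" "fmlookup Ss l = Some S" "wtM (rplug R M) \<Gamma> (Sess (IChoice Ss))"
    by auto
  obtain V \<Gamma>h where h: "wtM M \<Gamma>h V" "framesM R \<Gamma> (Sess (IChoice Ss)) \<Gamma>h V"
    using RSelect.IH[OF *(3)] by blast
  have "framesM (RSelect l R) \<Gamma> U \<Gamma>h V"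
    unfolding rfn_simps rbinders.simps rplug.simps wtM.simps
    by (rule framed_mono[OF h(2) subset_refl]) (use *(1,2) in blast)
  then show ?case using h(1) by blast
qed

abbreviation framesF :: "'l fctx \<Rightarrow> 'l lenv \<Rightarrow> marker \<Rightarrow> 'l ty \<Rightarrow> 'l lenv \<Rightarrow> 'l ty \<Rightarrow> bool" where
  "framesF F \<Gamma> \<phi> U \<Gamma>h V \<equiv> framed (ffn F) (fbinders F) \<Gamma> \<Gamma>h
    (\<lambda>\<Gamma>h \<Gamma>. \<forall>N. wtM N \<Gamma>h V \<longrightarrow> wtC (fplug F N) \<Gamma> \<phi> U)"

lemma wtC_fplug:
  assumes "wtC (fplug F M) \<Gamma> \<phi> U"
  shows "\<exists>V \<Gamma>h. wtM M \<Gamma>h V \<and> framesF F \<Gamma> \<phi> U \<Gamma>h V"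
proof (cases F)
  case (FThread \<psi> R)
  with assms have *: "\<psi> = \<phi>" "\<phi> = Child \<Longrightarrow> U = One" "wtM (rplug R M) \<Gamma> U" by auto
  obtain V \<Gamma>h where h: "wtM M \<Gamma>h V" "framesM R \<Gamma> U \<Gamma>h V" using wtM_rplug[OF *(3)] by blast
  have "framesF F \<Gamma> \<phi> U \<Gamma>h V"
    unfolding FThread ffn_simps fbinders.simps fplug.simps wtC.simps
    by (rule framed_mono[OF h(2) subset_refl]) (use *(1,2) in blast)
  then show ?thesis using h(1) by blast
next
  case (FCSub C R x)
  with assms obtain \<Gamma>1 \<Gamma>2 T where *: "splits \<Gamma> \<Gamma>1 \<Gamma>2" "\<Gamma>1 x = None" "wtC C (\<Gamma>1(x := live T)) \<phi> U"
    "wtM (rplug R M) \<Gamma>2 T"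
    by (auto simp: wtC_CSub)
  obtain V \<Gamma>h where h: "wtM M \<Gamma>h V" "framesM R \<Gamma>2 T \<Gamma>h V" using wtM_rplug[OF *(4)] by blast
  have "dom \<Gamma>1 \<subseteq> fn_conf C - {x}"
    by (rule dom_subset_if_upd[OF wtC_dom[OF *(3)] *(2)])
  note f = framed_splits[OF h(2) splits_sym[OF *(1)] this]
  have "framesF F \<Gamma> \<phi> U \<Gamma>h V"
    unfolding FCSub ffn_simps fbinders.simps fplug.simps wtC_CSub
    by (rule f) (use *(2,3) splits_sym in blast)
  then show ?thesis using h(1) by blast
qed

abbreviation framesFP ::
  "'l fctx \<Rightarrow> 'l conf \<Rightarrow> 'l lenv \<Rightarrow> marker \<Rightarrow> 'l ty \<Rightarrow> 'l lenv \<Rightarrow> 'l ty \<Rightarrow> bool" where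
  "framesFP F C \<Gamma> \<phi> U \<Gamma>h V \<equiv> framed (ffn F \<union> fn_conf C) (fbinders F) \<Gamma> \<Gamma>h
    (\<lambda>\<Gamma>h \<Gamma>. \<forall>N. wtM N \<Gamma>h V \<longrightarrow> wtC (fplug F N \<parallel> C) \<Gamma> \<phi> U)"

text \<open>Communication acts on a thread beside \<open>C\<close>. For the frame, \<open>C\<close>
  is one more sibling; which of the two is the child is recorded once in \<open>p\<close> and holds
  for every replacement.\<close>

lemma wtC_fplug_Par:
  assumes "wtC (fplug F M \<parallel> C) \<Gamma> \<phi> U"
  shows "\<exists>V \<Gamma>h. wtM M \<Gamma>h V \<and> framesFP F C \<Gamma> \<phi> U \<Gamma>h V"
proof -
  obtain \<Gamma>1 \<Gamma>2 \<phi>1 U1 \<phi>2 U2 where *: "splits \<Gamma> \<Gamma>1 \<Gamma>2" "wtC (fplug F M) \<Gamma>1 \<phi>1 U1" "wtC C \<Gamma>2 \<phi>2 U2"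
    and p: "\<phi>1 = Child \<and> U1 = One \<and> \<phi>2 = \<phi> \<and> U2 = U \<or> \<phi>1 = \<phi> \<and> U1 = U \<and> \<phi>2 = Child \<and> U2 = One"
    using assms by auto
  obtain V \<Gamma>h where h: "wtM M \<Gamma>h V" "framesF F \<Gamma>1 \<phi>1 U1 \<Gamma>h V" using wtC_fplug[OF *(2)] by blast
  have "framesFP F C \<Gamma> \<phi> U \<Gamma>h V"
    unfolding wtC.simps
    by (rule framed_splits[OF h(2) *(1) wtC_dom[OF *(3)]]) (use *(3) p in blast)
  then show ?thesis using h(1) by blast
qed

abbreviation framesC ::
  "'l gctx \<Rightarrow> 'l lenv \<Rightarrow> marker \<Rightarrow> 'l ty \<Rightarrow> 'l lenv \<Rightarrow> marker \<Rightarrow> 'l ty \<Rightarrow> bool" where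
  "framesC G \<Gamma> \<phi> U \<Gamma>h \<psi> V \<equiv> framed (gfn G) (gbinders G) \<Gamma> \<Gamma>h
    (\<lambda>\<Gamma>h \<Gamma>. \<forall>D. wtC D \<Gamma>h \<psi> V \<longrightarrow> wtC (gplug G D) \<Gamma> \<phi> U)"

lemma wtC_gplug:
  "wtC (gplug G C) \<Gamma> \<phi> U \<Longrightarrow> \<exists>\<psi> V \<Gamma>h. wtC C \<Gamma>h \<psi> V \<and> framesC G \<Gamma> \<phi> U \<Gamma>h \<psi> V"
proof (induction G arbitrary: \<Gamma> \<phi> U)
  case GHole
  then have "wtC C \<Gamma> \<phi> U" by simp
  moreover have "framesC GHole \<Gamma> \<phi> U \<Gamma> \<phi> U"
    unfolding gfn_simps gbinders.simps by (rule framed_hole) simp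
  ultimately show ?case by blast
next
  case (GPar G D)
  from GPar.prems obtain \<Gamma>1 \<Gamma>2 \<phi>1 U1 \<phi>2 U2 where *: "splits \<Gamma> \<Gamma>1 \<Gamma>2" "wtC (gplug G C) \<Gamma>1 \<phi>1 U1" "wtC D \<Gamma>2 \<phi>2 U2"
    and p: "\<phi>1 = Child \<and> U1 = One \<and> \<phi>2 = \<phi> \<and> U2 = U \<or> \<phi>1 = \<phi> \<and> U1 = U \<and> \<phi>2 = Child \<and> U2 = One"
    by auto
  obtain \<psi> V \<Gamma>h where h: "wtC C \<Gamma>h \<psi> V" "framesC G \<Gamma>1 \<phi>1 U1 \<Gamma>h \<psi> V" using GPar.IH[OF *(2)] by blast
  have "framesC (GPar G D) \<Gamma> \<phi> U \<Gamma>h \<psi> V"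
    unfolding gfn_simps gbinders.simps gplug.simps wtC.simps
    by (rule framed_splits[OF h(2) *(1) wtC_dom[OF *(3)]]) (use *(3) p in blast)
  then show ?case using h(1) by blast
next
  case (GCSub G M x)
  from GCSub.prems obtain \<Gamma>1 \<Gamma>2 T where *: "splits \<Gamma> \<Gamma>1 \<Gamma>2" "\<Gamma>1 x = None"
    "wtC (gplug G C) (\<Gamma>1(x := live T)) \<phi> U" "wtM M \<Gamma>2 T"
    by (auto simp: wtC_CSub)
  obtain \<psi> V \<Gamma>h where h: "wtC C \<Gamma>h \<psi> V" "framesC G (\<Gamma>1(x := live T)) \<phi> U \<Gamma>h \<psi> V"
    using GCSub.IH[OF *(3)] by blast
  have "framed (gfn G - {x}) (insert x (gbinders G)) \<Gamma>1 \<Gamma>h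
    (\<lambda>\<Gamma>h \<Gamma>. \<Gamma> x = None \<and> (\<forall>D. wtC D \<Gamma>h \<psi> V \<longrightarrow> wtC (gplug G D) (\<Gamma>(x := live T)) \<phi> U))"
    by (rule framed_bind[OF h(2) *(2)]) blast
  note f = framed_splits[OF this *(1) wtM_dom[OF *(4)]]
  have "framesC (GCSub G M x) \<Gamma> \<phi> U \<Gamma>h \<psi> V"
    unfolding gfn_simps gbinders.simps gplug.simps wtC_CSub
    by (rule f) (use *(4) in blast)
  then show ?case using h(1) by blast
next
  case (GRes x ms y G)
  let ?u = "\<lambda>\<Gamma> S S'. \<Gamma>(y := live (Sess (dual S)), x := live (Sess S'))"
  from GRes.prems obtain \<Gamma>1 \<Gamma>2 S S' where *: "\<Gamma> x = None" "\<Gamma> y = None" "x = y \<longrightarrow> S = End"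
    "splits (?u \<Gamma> S S') \<Gamma>1 \<Gamma>2" "\<Gamma>1 x = None" "wtB ms \<Gamma>1 S' S" "wtC (gplug G C) \<Gamma>2 \<phi> U"
    unfolding gplug.simps wtC_Res by blast
  obtain \<psi> V \<Gamma>h where h: "wtC C \<Gamma>h \<psi> V" "framesC G \<Gamma>2 \<phi> U \<Gamma>h \<psi> V"
    using GRes.IH[OF *(7)] by blast
  \<comment> \<open>Inside the restriction the buffer acts as a sibling with environment
    \<open>\<Gamma>1\<close>. Afterwards \<open>x\<close> and \<open>y\<close> are abstracted by one
    use of \<open>framed_bind\<close> each; if they coincide, \<open>S\<close> is \<open>end\<close>
    and the update of \<open>y\<close> leaves no entry.\<close>
  have 1: "framed (gfn G \<union> fn_msgs ms) (gbinders G) (?u \<Gamma> S S') \<Gamma>h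
    (\<lambda>\<Gamma>h \<Gamma>. \<exists>\<Gamma>2. splits \<Gamma> \<Gamma>1 \<Gamma>2 \<and> (\<forall>D. wtC D \<Gamma>h \<psi> V \<longrightarrow> wtC (gplug G D) \<Gamma>2 \<phi> U))"
    by (rule framed_splits[OF h(2) splits_sym[OF *(4)] wtB_dom[OF *(6)]]) (use splits_sym in blast)
  have "(\<Gamma>(y := live (Sess (dual S)))) x = None" using *(1,3) by simp
  then have 2: "framed (gfn G \<union> fn_msgs ms - {x}) (insert x (gbinders G)) (\<Gamma>(y := live (Sess (dual S)))) \<Gamma>h
    (\<lambda>\<Gamma>h \<Gamma>. \<Gamma> x = None \<and> (\<exists>\<Gamma>2. splits (\<Gamma>(x := live (Sess S'))) \<Gamma>1 \<Gamma>2 \<and>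
      (\<forall>D. wtC D \<Gamma>h \<psi> V \<longrightarrow> wtC (gplug G D) \<Gamma>2 \<phi> U)))"
    by (rule framed_bind[OF 1]) blast
  have "framed (gfn G \<union> fn_msgs ms - {x} - {y}) (insert y (insert x (gbinders G))) \<Gamma> \<Gamma>h
    (\<lambda>\<Gamma>h \<Gamma>. \<forall>D. wtC D \<Gamma>h \<psi> V \<longrightarrow> wtC (gplug (GRes x ms y G) D) \<Gamma> \<phi> U)"
  proof (rule framed_bind[OF 2 *(2)], elim conjE exE, intro allI impI)
    fix \<Gamma>h \<Gamma> :: "'a lenv" and \<Gamma>2 D
    assume a: "\<Gamma> y = None" "(\<Gamma>(y := live (Sess (dual S)))) x = None" "splits (?u \<Gamma> S S') \<Gamma>1 \<Gamma>2"
      "\<forall>D. wtC D \<Gamma>h \<psi> V \<longrightarrow> wtC (gplug G D) \<Gamma>2 \<phi> U" "wtC D \<Gamma>h \<psi> V"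
    then have "\<Gamma> x = None" by (simp split: if_splits)
    moreover have "wtC (gplug G D) \<Gamma>2 \<phi> U" using a(4,5) by blast
    ultimately show "wtC (gplug (GRes x ms y G) D) \<Gamma> \<phi> U"
      unfolding gplug.simps wtC_Res using a(1,3) *(3,5,6) by blast
  qed
  moreover have "insert y (insert x (gbinders G)) = gbinders (GRes x ms y G)" by auto
  ultimately have "framesC (GRes x ms y G) \<Gamma> \<phi> U \<Gamma>h \<psi> V" by (simp only: gfn_simps)
  then show ?case using h(1) by blast
qed

section \<open>Preservation for terms\<close>

lemma splits_rotate:
  assumes "splits \<Gamma> \<Gamma>1 \<Gamma>2" "splits \<Gamma>2 \<Gamma>3 \<Gamma>4"
  obtains \<Delta> where "splits \<Gamma> \<Gamma>3 \<Delta>" "splits \<Delta> \<Gamma>1 \<Gamma>4"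
  using splits_assoc[OF assms(1) splits_sym[OF assms(2)]] splits_sym by metis

lemma splits_updI: "splits \<Gamma> \<Gamma>1 \<Gamma>2 \<Longrightarrow> \<Gamma>1 x = None \<Longrightarrow> splits (\<Gamma>(x := t)) \<Gamma>1 (\<Gamma>2(x := t))"
  by (simp add: splits_def)

lemma splits_updD:
  assumes "splits (\<Gamma>(x := t)) \<Gamma>1 \<Gamma>2" "\<Gamma>1 x = None" "\<Gamma> x = None"
  shows "\<Gamma>2 x = t" and "splits \<Gamma> \<Gamma>1 (\<Gamma>2(x := None))"
  using assms unfolding splits_def by (metis fun_upd_same, metis fun_upd_apply)

lemma live_inject [simp]: "live T = live U \<longleftrightarrow> T = U"
  by (auto simp: live_def)

lemma splits_sing: "\<Gamma> x = None \<Longrightarrow> splits (\<Gamma>(x := live T)) \<Gamma> (sing x T)"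
  by (simp add: splits_def)

text \<open>As an equality of predicates, symmetry and transitivity are immediate and each
  congruence rule is a rewrite with the typing equation of its constructor. Only moving a
  substitution through a context needs frames.\<close>

lemma wtM_scongM: "M \<equiv>\<^sub>M N \<Longrightarrow> wtM M = wtM N"
proof (induction rule: scongM.induct)
  case (SCM_Sub x R N M)
  have "wtM (ESub (rplug R M) N x) \<Gamma> U \<longleftrightarrow> wtM (rplug R (ESub M N x)) \<Gamma> U" for \<Gamma> U
  proof
    assume "wtM (ESub (rplug R M) N x) \<Gamma> U"
    then obtain \<Gamma>1 \<Gamma>2 T where *: "splits \<Gamma> \<Gamma>1 \<Gamma>2" "\<Gamma>1 x = None"
      "wtM (rplug R M) (\<Gamma>1(x := live T)) U" "wtM N \<Gamma>2 T"
      unfolding wtM_ESub by blast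
    obtain V \<Gamma>h where h: "wtM M \<Gamma>h V" "framesM R (\<Gamma>1(x := live T)) U \<Gamma>h V"
      using wtM_rplug[OF *(3)] by blast
    have "dom \<Gamma>2 \<inter> rbinders R = {}" using wtM_dom[OF *(4)] SCM_Sub(3) by blast
    from framed_sink[OF h(2) SCM_Sub(1,2) *(2,1) this] obtain \<Gamma>h1 \<Gamma>h' where
      "\<Gamma>h = \<Gamma>h1(x := live T)" "\<Gamma>h1 x = None" "splits \<Gamma>h' \<Gamma>h1 \<Gamma>2"
      and q: "\<forall>N. wtM N \<Gamma>h' V \<longrightarrow> wtM (rplug R N) \<Gamma> U"
      by blast
    then have "wtM (ESub M N x) \<Gamma>h' V" using h(1) *(4) unfolding wtM_ESub by blast
    then show "wtM (rplug R (ESub M N x)) \<Gamma> U" using q by blast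
  next
    assume "wtM (rplug R (ESub M N x)) \<Gamma> U"
    then obtain V \<Gamma>h where h: "wtM (ESub M N x) \<Gamma>h V" "framesM R \<Gamma> U \<Gamma>h V"
      using wtM_rplug by blast
    from h(1) obtain \<Gamma>1 \<Gamma>2 T where *: "splits \<Gamma>h \<Gamma>1 \<Gamma>2" "\<Gamma>1 x = None"
      "wtM M (\<Gamma>1(x := live T)) V" "wtM N \<Gamma>2 T"
      unfolding wtM_ESub by blast
    have "dom \<Gamma>2 \<inter> rbinders R = {}" using wtM_dom[OF *(4)] SCM_Sub(3) by blast
    from framed_float[OF h(2) SCM_Sub(1,2) *(2,1) this, of "live T"] *(3,4)
    show "wtM (ESub (rplug R M) N x) \<Gamma> U" unfolding wtM_ESub by blast
  qed
  then show ?case by blast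
next
  case (SCM_Case M M' B B')
  \<comment> \<open>The defining equation of \<open>Case\<close> sees the branches only through
    \<open>fmmap wtM\<close>, so the pointwise relation is turned into equality of these
    maps.\<close>
  have "fmrel (\<lambda>M N. wtM M = wtM N) B B'"
    using SCM_Case.IH(2) by (rule fmap.rel_mono_strong) blast
  then have "fmmap wtM B = fmmap wtM B'" by (simp add: fmap.rel_map flip: fmap.rel_eq)
  moreover from this have "fmdom' B = fmdom' B'" by (metis fmdom'_map)
  ultimately show ?case
    using SCM_Case.IH(1) by (intro ext) (simp only: wtM.simps)
qed (intro ext; simp only: wtM.simps wtM_Lam wtM_LetP wtM_ESub)+

text \<open>Identifying \<open>x\<close> with \<open>y\<close> never merges two entries. If
  \<open>T\<close> is not \<open>end\<close>, \<open>sing y T\<close> holds the entry of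
  \<open>y\<close>, so \<open>\<Gamma>1\<close> has none and any other use of \<open>y\<close> has
  type \<open>end\<close>. If \<open>T\<close> is \<open>end\<close>, \<open>x\<close> has no entry
  and the renaming fixes the whole domain.\<close>

lemma moves_subst:
  assumes "splits \<Gamma> \<Gamma>1 (sing y T)" "\<Gamma>1 x = None"
  shows "moves (id(x := y)) (\<Gamma>1(x := live T)) \<Gamma>"
proof (cases "T = Sess End")
  case True
  then have "sing y T = Map.empty" "\<Gamma>1(x := live T) = \<Gamma>1"
    using assms(2) by (auto simp: sing_def fun_eq_iff)
  moreover from this have "\<Gamma>1 = \<Gamma>" using assms(1) by simp
  ultimately show ?thesis using assms(2) by (auto simp: moves_def inj_on_def image_iff dom_def)
next
  case False
  then have t: "live T = Some T" by simp
  have y: "\<Gamma>1 y = None" "\<Gamma> y = Some T"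
    using assms(1)[unfolded splits_def, rule_format, of y] t by auto
  have n: "\<Gamma> n = \<Gamma>1 n" if "n \<noteq> y" for n
    using assms(1)[unfolded splits_def, rule_format, of n] that by auto
  show ?thesis
    unfolding moves_def
  proof (intro conjI ballI set_eqI iffI)
    show "inj_on (id(x := y)) (dom (\<Gamma>1(x := live T)))"
      using y(1) by (auto simp: inj_on_def dom_def split: if_splits)
  next
    fix n assume "n \<in> dom (\<Gamma>1(x := live T))"
    then show "\<Gamma> ((id(x := y)) n) = (\<Gamma>1(x := live T)) n"
      using y n[of n] t by (cases "n = x"; cases "n = y") (simp_all add: dom_def live_def)
  next
    fix n assume d: "n \<in> dom \<Gamma>"
    show "n \<in> id(x := y) ` dom (\<Gamma>1(x := live T))"
    proof (cases "n = y")
      case True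
      then show ?thesis using t by (intro image_eqI[of _ _ x]) auto
    next
      case False
      then have "\<Gamma>1 n \<noteq> None" using d n by (metis domIff)
      moreover from this have "n \<noteq> x" using assms(2) by auto
      ultimately show ?thesis by (intro image_eqI[of _ _ n]) (simp_all add: domIff)
    qed
  next
    fix n assume "n \<in> id(x := y) ` dom (\<Gamma>1(x := live T))"
    then obtain k where k: "n = (id(x := y)) k" "k \<in> dom (\<Gamma>1(x := live T))" by blast
    show "n \<in> dom \<Gamma>"
    proof (cases "k = x")
      case True
      then show ?thesis using k(1) y(2) by auto
    next
      case False
      then have "n = k" "\<Gamma>1 k \<noteq> None" using k by (auto split: if_splits)
      moreover from this have "k \<noteq> y" using y(1) by auto
      ultimately show ?thesis using n by (metis domIff)
    qed
  qed
qed

lemma wtM_redM: "M \<longrightarrow>\<^sub>M N \<Longrightarrow> wtM M \<Gamma> U \<Longrightarrow> wtM N \<Gamma> U"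
proof (induction arbitrary: \<Gamma> U rule: redM.induct)
  case (RM_Lam x N M)
  then show ?case unfolding wtM_ESub wtM.simps wtM_Lam ty.inject by blast
next
  case (RM_Pair x y M1 M2 N)
  from RM_Pair.prems obtain \<Gamma>1 \<Gamma>2 \<Gamma>3 \<Gamma>4 T T' where *: "splits \<Gamma> \<Gamma>1 \<Gamma>2" "splits \<Gamma>1 \<Gamma>3 \<Gamma>4"
    "wtM M1 \<Gamma>3 T" "wtM M2 \<Gamma>4 T'" "\<Gamma>2 x = None" "\<Gamma>2 y = None"
    "wtM N (\<Gamma>2(y := live T', x := live T)) U"
    unfolding wtM_LetP wtM.simps ty.inject by blast
  obtain \<Delta> where d: "splits \<Gamma> \<Delta> \<Gamma>4" "splits \<Delta> \<Gamma>2 \<Gamma>3"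
    using splits_assoc[OF splits_sym[OF *(1)] *(2)] .
  \<comment> \<open>The outer substitution for \<open>y\<close> scopes over \<open>M1\<close>;
    freshness of \<open>y\<close> keeps it out of the environment of \<open>M1\<close>.\<close>
  have y: "\<Gamma>3 y = None" using wtM_dom[OF *(3)] RM_Pair.hyps(2) by (auto simp: dom_def)
  then have "splits (\<Delta>(y := live T')) (\<Gamma>2(y := live T')) \<Gamma>3"
    using splits_updI[OF splits_sym[OF d(2)]] splits_sym by blast
  moreover have "(\<Gamma>2(y := live T')) x = None" using *(5) RM_Pair.hyps(1) by simp
  ultimately have "wtM (ESub N M1 x) (\<Delta>(y := live T')) U"
    using *(3,7) unfolding wtM_ESub by blast
  moreover have "\<Delta> y = None" using d(2) y *(6) unfolding splits_def by metis
  ultimately show ?case using *(4) d(1) wtM_ESub by blast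
next
  case (RM_SubName M y x)
  then obtain \<Gamma>1 T where "splits \<Gamma> \<Gamma>1 (sing y T)" "\<Gamma>1 x = None" "wtM M (\<Gamma>1(x := live T)) U"
    unfolding wtM_ESub wtM.simps by blast
  then show ?case unfolding subst_var_def by (blast intro: wtM_rename moves_subst)
next
  case (RM_NameSub x M)
  then obtain \<Gamma>1 \<Gamma>2 T where *: "splits \<Gamma> \<Gamma>1 \<Gamma>2" "\<Gamma>1 x = None" "\<Gamma>1(x := live T) = sing x U" "wtM M \<Gamma>2 T"
    unfolding wtM_ESub wtM.simps by blast
  have "live T = live U" using fun_cong[OF *(3), of x] by simp
  moreover have "\<Gamma>1 = Map.empty"
  proof
    show "\<Gamma>1 n = None" for n using fun_cong[OF *(3), of n] *(2) by (auto split: if_splits)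
  qed
  ultimately show ?case using *(1,4) by simp
next
  case (RM_Send M N)
  then show ?case unfolding wtM.simps ty.inject by blast
next
  case (RM_Lift M N R)
  then obtain V \<Gamma>h where h: "wtM M \<Gamma>h V" "framesM R \<Gamma> U \<Gamma>h V"
    using wtM_rplug by blast
  then show ?case using framed_here[OF h(2)] RM_Lift.IH by blast
next
  case (RM_SC M M' N' N)
  then show ?case using wtM_scongM by metis
qed

section \<open>Preservation for configurations\<close>

lemma wtB_append:
  "wtB (ms @ ns) \<Gamma> S' S \<longleftrightarrow> (\<exists>\<Gamma>1 \<Gamma>2 S0. splits \<Gamma> \<Gamma>1 \<Gamma>2 \<and> wtB ms \<Gamma>1 S' S0 \<and> wtB ns \<Gamma>2 S0 S)"
proof (induction ms arbitrary: \<Gamma> S')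
  case Nil
  show ?case by simp
next
  case (Cons m ms)
  show ?case
  proof (cases m)
    case (Lbl l)
    then show ?thesis unfolding append_Cons Lbl wtB.simps Cons.IH by blast
  next
    case (Val M)
    show ?thesis
      unfolding append_Cons Val wtB.simps Cons.IH
    proof (intro iffI; elim exE conjE)
      fix \<Gamma>1 \<Gamma>2 T \<Gamma>3 \<Gamma>4 S0
      assume *: "splits \<Gamma> \<Gamma>1 \<Gamma>2" "wtM M \<Gamma>1 T" "splits \<Gamma>2 \<Gamma>3 \<Gamma>4" "wtB ms \<Gamma>3 (Out T S') S0" "wtB ns \<Gamma>4 S0 S"
      obtain \<Delta> where "splits \<Gamma> \<Delta> \<Gamma>4" "splits \<Delta> \<Gamma>1 \<Gamma>3"
        using splits_assoc[OF *(1,3)] .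
      with * show "\<exists>\<Gamma>1 \<Gamma>2 S0. splits \<Gamma> \<Gamma>1 \<Gamma>2 \<and>
        (\<exists>\<Gamma>3 \<Gamma>4 T. splits \<Gamma>1 \<Gamma>3 \<Gamma>4 \<and> wtM M \<Gamma>3 T \<and> wtB ms \<Gamma>4 (Out T S') S0) \<and> wtB ns \<Gamma>2 S0 S"
        by blast
    next
      fix \<Gamma>1 \<Gamma>2 T \<Gamma>3 \<Gamma>4 S0
      assume *: "splits \<Gamma> \<Gamma>1 \<Gamma>2" "splits \<Gamma>1 \<Gamma>3 \<Gamma>4" "wtM M \<Gamma>3 T" "wtB ms \<Gamma>4 (Out T S') S0" "wtB ns \<Gamma>2 S0 S"
      obtain \<Delta> where d: "splits \<Gamma> \<Delta> \<Gamma>3" "splits \<Delta> \<Gamma>2 \<Gamma>4"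
        using splits_assoc[OF splits_sym[OF *(1)] splits_sym[OF *(2)]] .
      show "\<exists>\<Gamma>1 \<Gamma>2 T. splits \<Gamma> \<Gamma>1 \<Gamma>2 \<and> wtM M \<Gamma>1 T \<and>
        (\<exists>\<Gamma>3 \<Gamma>4 S0. splits \<Gamma>2 \<Gamma>3 \<Gamma>4 \<and> wtB ms \<Gamma>3 (Out T S') S0 \<and> wtB ns \<Gamma>4 S0 S)"
        using splits_sym[OF d(1)] splits_sym[OF d(2)] *(3-5) by blast
    qed
  qed
qed

text \<open>Recovers the shape of the declared rules, which peel off the rightmost message, from the
  recursion on the left. At the cut, \<open>S\<close> is the type owed to the reader before the
  message and \<open>S0\<close> the one after it, both up to duality.\<close>

lemma wtB_snoc:
  "wtB (ms @ [Val M]) \<Gamma> S' S \<longleftrightarrow>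
    (\<exists>\<Gamma>1 \<Gamma>2 T S0. S = Out T S0 \<and> splits \<Gamma> \<Gamma>1 \<Gamma>2 \<and> wtB ms \<Gamma>1 S' S0 \<and> wtM M \<Gamma>2 T)"
  "wtB (ms @ [Lbl l]) \<Gamma> S' S \<longleftrightarrow>
    (\<exists>Ss S0. S = IChoice Ss \<and> fmlookup Ss l = Some S0 \<and> wtB ms \<Gamma> S' S0)"
proof -
  have "wtB [Val M] \<Delta> R R' \<longleftrightarrow> (\<exists>T. R' = Out T R \<and> wtM M \<Delta> T)"
    and "wtB [Lbl l] \<Delta> R R' \<longleftrightarrow> (\<exists>Ss. fmlookup Ss l = Some R \<and> \<Delta> = Map.empty \<and> R' = IChoice Ss)"
    for \<Delta> R R'
    by auto
  note v = this
  show "wtB (ms @ [Val M]) \<Gamma> S' S \<longleftrightarrow>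
      (\<exists>\<Gamma>1 \<Gamma>2 T S0. S = Out T S0 \<and> splits \<Gamma> \<Gamma>1 \<Gamma>2 \<and> wtB ms \<Gamma>1 S' S0 \<and> wtM M \<Gamma>2 T)"
    unfolding wtB_append v by blast
  show "wtB (ms @ [Lbl l]) \<Gamma> S' S \<longleftrightarrow>
      (\<exists>Ss S0. S = IChoice Ss \<and> fmlookup Ss l = Some S0 \<and> wtB ms \<Gamma> S' S0)"
    unfolding wtB_append v using splits_empty(2) by metis
qed

lemma wtC_Res_Nil:
  assumes "x \<noteq> y"
  shows "wtC (Res x [] y C) \<Gamma> \<phi> T \<longleftrightarrow> \<Gamma> x = None \<and> \<Gamma> y = None \<and>
    (\<exists>S. wtC C (\<Gamma>(y := live (Sess (dual S)), x := live (Sess S))) \<phi> T)"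
  using assms unfolding wtC_Res wtB.simps splits_empty by auto

lemma wtC_Res_neq:
  assumes "x \<noteq> y"
  shows "wtC (Res x ms y C) \<Gamma> \<phi> T \<longleftrightarrow> \<Gamma> x = None \<and> \<Gamma> y = None \<and>
    (\<exists>\<Gamma>1 \<Gamma>2 S S'. splits (\<Gamma>(y := live (Sess (dual S)), x := live (Sess S'))) \<Gamma>1 \<Gamma>2 \<and> \<Gamma>1 x = None \<and>
      wtB ms \<Gamma>1 S' S \<and> wtC C \<Gamma>2 \<phi> T)"
  using assms unfolding wtC_Res by blast

lemma splits_NoneD: "splits \<Gamma> \<Gamma>1 \<Gamma>2 \<Longrightarrow> \<Gamma> x = None \<longleftrightarrow> \<Gamma>1 x = None \<and> \<Gamma>2 x = None"
  unfolding splits_def by metis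

lemma splits_pass: "splits \<Gamma> \<Gamma>1 \<Gamma>2 \<Longrightarrow> \<Gamma>1 x = None \<Longrightarrow> \<Gamma>2 x = \<Gamma> x"
  unfolding splits_def by metis

lemma splits_updD2:
  assumes "splits (\<Gamma>(y := s, x := t)) \<Gamma>1 \<Gamma>2" "x \<noteq> y" "\<Gamma>1 x = None" "\<Gamma>1 y = None" "\<Gamma> x = None" "\<Gamma> y = None"
  obtains \<Delta> where "splits \<Gamma> \<Gamma>1 \<Delta>" "\<Delta> x = None" "\<Delta> y = None" "\<Gamma>2 = \<Delta>(y := s, x := t)"
proof
  have x: "(\<Gamma>(y := s)) x = None" using assms(2,5) by simp
  note d = splits_updD[OF assms(1,3) x]
  note e = splits_updD[OF d(2) assms(4,6)]
  show "splits \<Gamma> \<Gamma>1 (\<Gamma>2(x := None, y := None))" by (rule e(2))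
  show "\<Gamma>2 = \<Gamma>2(x := None, y := None, y := s, x := t)"
    using d(1) e(1) assms(2) by (auto simp: fun_eq_iff)
qed simp_all

section \<open>Structural congruence: restrictions, parallel composition and buffered
  actions\<close>

lemma wtC_ResComm:
  assumes "distinct [x, y, z, w]" "{x, y} \<inter> fn_msgs ns = {}" "{z, w} \<inter> fn_msgs ms = {}"
    and "wtC (Res x ms y (Res z ns w C)) \<Gamma> \<phi> T"
  shows "wtC (Res z ns w (Res x ms y C)) \<Gamma> \<phi> T"
proof -
  have xy: "x \<noteq> y" and zw: "z \<noteq> w" using assms(1) by auto
  from assms(4) obtain \<Gamma>1 \<Gamma>2 S S' where a: "\<Gamma> x = None" "\<Gamma> y = None"
    "splits (\<Gamma>(y := live (Sess (dual S)), x := live (Sess S'))) \<Gamma>1 \<Gamma>2"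
    "\<Gamma>1 x = None" "wtB ms \<Gamma>1 S' S" and c: "wtC (Res z ns w C) \<Gamma>2 \<phi> T"
    unfolding wtC_Res_neq[OF xy] by blast
  from c obtain \<Gamma>3 \<Gamma>4 R R' where b: "\<Gamma>2 z = None" "\<Gamma>2 w = None"
    "splits (\<Gamma>2(w := live (Sess (dual R)), z := live (Sess R'))) \<Gamma>3 \<Gamma>4"
    "\<Gamma>3 z = None" "wtB ns \<Gamma>3 R' R" "wtC C \<Gamma>4 \<phi> T"
    unfolding wtC_Res_neq[OF zw] by blast
  \<comment> \<open>By the side conditions no endpoint of one restriction lies in the buffer of the
    other, so either buffer can be split off first.\<close>
  have 1: "\<Gamma>1 z = None" "\<Gamma>1 w = None" using wtB_dom[OF a(5)] assms(3) by auto
  have 3: "\<Gamma>3 x = None" "\<Gamma>3 y = None" using wtB_dom[OF b(5)] assms(2) by auto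
  have g: "\<Gamma> z = None" "\<Gamma> w = None"
    using splits_pass[OF a(3) 1(1)] splits_pass[OF a(3) 1(2)] b(1,2) assms(1) by auto
  have "splits (\<Gamma>(y := live (Sess (dual S)), x := live (Sess S'), w := live (Sess (dual R)), z := live (Sess R')))
      \<Gamma>1 (\<Gamma>2(w := live (Sess (dual R)), z := live (Sess R')))"
    using splits_updI[OF splits_updI[OF a(3) 1(2)] 1(1)] .
  then obtain \<Delta> where d: "splits (\<Gamma>(y := live (Sess (dual S)), x := live (Sess S'),
      w := live (Sess (dual R)), z := live (Sess R'))) \<Gamma>3 \<Delta>" "splits \<Delta> \<Gamma>1 \<Gamma>4"
    using splits_rotate b(3) by blast
  have "\<Gamma>(y := live (Sess (dual S)), x := live (Sess S'), w := live (Sess (dual R)), z := live (Sess R')) =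
      \<Gamma>(w := live (Sess (dual R)), z := live (Sess R'), y := live (Sess (dual S)), x := live (Sess S'))"
    using assms(1) by (auto simp: fun_eq_iff)
  with d(1) have d1: "splits (\<Gamma>(w := live (Sess (dual R)), z := live (Sess R'),
    y := live (Sess (dual S)), x := live (Sess S'))) \<Gamma>3 \<Delta>" by simp
  have n: "(\<Gamma>(w := live (Sess (dual R)), z := live (Sess R'))) x = None"
    "(\<Gamma>(w := live (Sess (dual R)), z := live (Sess R'))) y = None"
    using a(1,2) assms(1) by auto
  obtain \<Delta>' where e: "splits (\<Gamma>(w := live (Sess (dual R)), z := live (Sess R'))) \<Gamma>3 \<Delta>'"
    "\<Delta>' x = None" "\<Delta>' y = None" "\<Delta> = \<Delta>'(y := live (Sess (dual S)), x := live (Sess S'))"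
    using splits_updD2[OF d1 xy 3 n] .
  have "wtC (Res x ms y C) \<Delta>' \<phi> T"
    using e(2,3) d(2)[unfolded e(4)] a(4,5) b(6) unfolding wtC_Res_neq[OF xy] by blast
  then show ?thesis using e(1) g b(4,5) unfolding wtC_Res_neq[OF zw] by blast
qed

lemma wtC_Par:
  "wtC (C \<parallel> D) \<Gamma> \<phi> T \<longleftrightarrow> (\<exists>\<Gamma>1 \<Gamma>2 \<phi>1 T1 \<phi>2 T2. splits \<Gamma> \<Gamma>1 \<Gamma>2 \<and> wtC C \<Gamma>1 \<phi>1 T1 \<and> wtC D \<Gamma>2 \<phi>2 T2 \<and>
    (\<phi>1 = Child \<and> T1 = One \<and> \<phi>2 = \<phi> \<and> T2 = T \<or> \<phi>1 = \<phi> \<and> T1 = T \<and> \<phi>2 = Child \<and> T2 = One))"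
  unfolding wtC.simps by blast

lemma wtC_ResExt:
  assumes "x \<noteq> y" "x \<notin> fn_conf C" "y \<notin> fn_conf C"
  shows "wtC (Res x ms y (C \<parallel> D)) \<Gamma> \<phi> T \<longleftrightarrow> wtC (C \<parallel> Res x ms y D) \<Gamma> \<phi> T"
proof
  assume "wtC (Res x ms y (C \<parallel> D)) \<Gamma> \<phi> T"
  then obtain \<Gamma>1 \<Gamma>2 S S' \<Gamma>3 \<Gamma>4 \<phi>1 T1 \<phi>2 T2 where a: "\<Gamma> x = None" "\<Gamma> y = None"
    "splits (\<Gamma>(y := live (Sess (dual S)), x := live (Sess S'))) \<Gamma>1 \<Gamma>2"
    "\<Gamma>1 x = None" "wtB ms \<Gamma>1 S' S" "splits \<Gamma>2 \<Gamma>3 \<Gamma>4" "wtC C \<Gamma>3 \<phi>1 T1" "wtC D \<Gamma>4 \<phi>2 T2"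
    and p: "\<phi>1 = Child \<and> T1 = One \<and> \<phi>2 = \<phi> \<and> T2 = T \<or> \<phi>1 = \<phi> \<and> T1 = T \<and> \<phi>2 = Child \<and> T2 = One"
    unfolding wtC_Res_neq[OF assms(1)] wtC_Par by blast
  have 3: "\<Gamma>3 x = None" "\<Gamma>3 y = None" using wtC_dom[OF a(7)] assms(2,3) by auto
  obtain \<Delta> where d: "splits (\<Gamma>(y := live (Sess (dual S)), x := live (Sess S'))) \<Gamma>3 \<Delta>" "splits \<Delta> \<Gamma>1 \<Gamma>4"
    using splits_rotate[OF a(3,6)] .
  obtain \<Delta>' where e: "splits \<Gamma> \<Gamma>3 \<Delta>'" "\<Delta>' x = None" "\<Delta>' y = None"
    "\<Delta> = \<Delta>'(y := live (Sess (dual S)), x := live (Sess S'))"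
    using splits_updD2[OF d(1) assms(1) 3 a(1,2)] .
  have "wtC (Res x ms y D) \<Delta>' \<phi>2 T2"
    using e(2,3) d(2)[unfolded e(4)] a(4,5,8) unfolding wtC_Res_neq[OF assms(1)] by blast
  then show "wtC (C \<parallel> Res x ms y D) \<Gamma> \<phi> T"
    using e(1) a(7) p unfolding wtC_Par by blast
next
  assume "wtC (C \<parallel> Res x ms y D) \<Gamma> \<phi> T"
  then obtain \<Gamma>3 \<Delta> \<phi>1 T1 \<phi>2 T2 where a: "splits \<Gamma> \<Gamma>3 \<Delta>" "wtC C \<Gamma>3 \<phi>1 T1" "wtC (Res x ms y D) \<Delta> \<phi>2 T2"
    and p: "\<phi>1 = Child \<and> T1 = One \<and> \<phi>2 = \<phi> \<and> T2 = T \<or> \<phi>1 = \<phi> \<and> T1 = T \<and> \<phi>2 = Child \<and> T2 = One"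
    unfolding wtC_Par by blast
  from a(3) obtain \<Gamma>1 \<Gamma>4 S S' where b: "\<Delta> x = None" "\<Delta> y = None"
    "splits (\<Delta>(y := live (Sess (dual S)), x := live (Sess S'))) \<Gamma>1 \<Gamma>4"
    "\<Gamma>1 x = None" "wtB ms \<Gamma>1 S' S" "wtC D \<Gamma>4 \<phi>2 T2"
    unfolding wtC_Res_neq[OF assms(1)] by blast
  have 3: "\<Gamma>3 x = None" "\<Gamma>3 y = None" using wtC_dom[OF a(2)] assms(2,3) by auto
  have g: "\<Gamma> x = None" "\<Gamma> y = None"
    using splits_NoneD[OF a(1)] 3 b(1,2) by auto
  have "splits (\<Gamma>(y := live (Sess (dual S)), x := live (Sess S'))) \<Gamma>3
      (\<Delta>(y := live (Sess (dual S)), x := live (Sess S')))"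
    using splits_updI[OF splits_updI[OF a(1) 3(2)] 3(1)] .
  then obtain \<Gamma>2 where "splits (\<Gamma>(y := live (Sess (dual S)), x := live (Sess S'))) \<Gamma>1 \<Gamma>2" "splits \<Gamma>2 \<Gamma>3 \<Gamma>4"
    using splits_rotate b(3) by blast
  then show "wtC (Res x ms y (C \<parallel> D)) \<Gamma> \<phi> T"
    using g b(4-6) a(2) p unfolding wtC_Res_neq[OF assms(1)] wtC_Par by blast
qed

lemma wtC_ParAssoc: "wtC (C \<parallel> (D \<parallel> E)) \<Gamma> \<phi> T \<longleftrightarrow> wtC ((C \<parallel> D) \<parallel> E) \<Gamma> \<phi> T"
proof
  assume "wtC (C \<parallel> (D \<parallel> E)) \<Gamma> \<phi> T"
  then obtain \<Gamma>1 \<Gamma>2 \<Gamma>3 \<Gamma>4 where *: "splits \<Gamma> \<Gamma>1 \<Gamma>2" "splits \<Gamma>2 \<Gamma>3 \<Gamma>4"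
    and p: "wtC C \<Gamma>1 Child One \<and> wtC D \<Gamma>3 Child One \<and> wtC E \<Gamma>4 \<phi> T \<or>
      wtC C \<Gamma>1 Child One \<and> wtC D \<Gamma>3 \<phi> T \<and> wtC E \<Gamma>4 Child One \<or>
      wtC C \<Gamma>1 \<phi> T \<and> wtC D \<Gamma>3 Child One \<and> wtC E \<Gamma>4 Child One"
    unfolding wtC.simps by blast
  obtain \<Delta> where "splits \<Gamma> \<Delta> \<Gamma>4" "splits \<Delta> \<Gamma>1 \<Gamma>3" using splits_assoc[OF *] .
  then show "wtC ((C \<parallel> D) \<parallel> E) \<Gamma> \<phi> T" using p unfolding wtC.simps by blast
next
  assume "wtC ((C \<parallel> D) \<parallel> E) \<Gamma> \<phi> T"
  then obtain \<Gamma>1 \<Gamma>3 \<Gamma>4 \<Delta> where *: "splits \<Gamma> \<Delta> \<Gamma>4" "splits \<Delta> \<Gamma>1 \<Gamma>3"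
    and p: "wtC C \<Gamma>1 Child One \<and> wtC D \<Gamma>3 Child One \<and> wtC E \<Gamma>4 \<phi> T \<or>
      wtC C \<Gamma>1 Child One \<and> wtC D \<Gamma>3 \<phi> T \<and> wtC E \<Gamma>4 Child One \<or>
      wtC C \<Gamma>1 \<phi> T \<and> wtC D \<Gamma>3 Child One \<and> wtC E \<Gamma>4 Child One"
    unfolding wtC.simps by blast
  obtain \<Gamma>2 where d: "splits \<Gamma> \<Gamma>2 \<Gamma>1" "splits \<Gamma>2 \<Gamma>4 \<Gamma>3"
    using splits_assoc[OF splits_sym[OF *(1)] splits_sym[OF *(2)]] .
  show "wtC (C \<parallel> (D \<parallel> E)) \<Gamma> \<phi> T"
    using p splits_sym[OF d(1)] splits_sym[OF d(2)] unfolding wtC.simps by blast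
qed

lemma sing_None: "(sing x T)(x := None) = Map.empty"
  by (simp add: sing_def)

lemma sing_upd: "(sing x T)(x := live U) = sing x U"
  by (simp add: sing_def)

text \<open>The share of the payload moves between hole and buffer, for which nothing may be bound
  over the hole, while \<open>x\<close> changes between \<open>Out T S''\<close> and
  \<open>S''\<close>. A payload may contain \<open>y\<close>; then the reading endpoint changes
  sides with it.\<close>

lemma wtC_Send:
  assumes "x \<noteq> y" "fhat F" "x \<notin> ffn F" "x \<notin> fn_conf C"
  shows "wtC (Res x ms y (fplug F (SendP M (Var x)) \<parallel> C)) \<Gamma> \<phi> U \<longleftrightarrow>
    wtC (Res x (Val M # ms) y (fplug F (Var x) \<parallel> C)) \<Gamma> \<phi> U"
proof
  assume "wtC (Res x ms y (fplug F (SendP M (Var x)) \<parallel> C)) \<Gamma> \<phi> U"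
  then obtain \<Gamma>1 \<Gamma>2 S S' where a: "\<Gamma> x = None" "\<Gamma> y = None"
    "splits (\<Gamma>(y := live (Sess (dual S)), x := live (Sess S'))) \<Gamma>1 \<Gamma>2"
    "\<Gamma>1 x = None" "wtB ms \<Gamma>1 S' S" "wtC (fplug F (SendP M (Var x)) \<parallel> C) \<Gamma>2 \<phi> U"
    unfolding wtC_Res_neq[OF assms(1)] by blast
  obtain V \<Gamma>h \<Gamma>r where "wtM (SendP M (Var x)) \<Gamma>h V" and r: "splits \<Gamma>2 \<Gamma>r \<Gamma>h" "dom \<Gamma>r \<subseteq> ffn F \<union> fn_conf C"
    and q: "\<And>\<Gamma>' \<Gamma>h' N. splits \<Gamma>' \<Gamma>r \<Gamma>h' \<Longrightarrow> wtM N \<Gamma>h' V \<Longrightarrow> wtC (fplug F N \<parallel> C) \<Gamma>' \<phi> U"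
    using wtC_fplug_Par[OF a(6)] unfolding fhat_fbinders[OF assms(2)] framed_unbound by blast
  then obtain \<Gamma>m T S'' where h: "splits \<Gamma>h \<Gamma>m (sing x (Sess (Out T S'')))" "wtM M \<Gamma>m T" "V = Sess S''"
    unfolding wtM.simps by blast
  \<comment> \<open>An output type is live, so the displayed \<open>x\<close> must hold the entry
    and is the endpoint proper.\<close>
  have hx: "\<Gamma>h x = Some (Sess (Out T S''))" "\<Gamma>m x = None"
    using h(1)[unfolded splits_def, rule_format, of x] by auto
  have rx: "\<Gamma>r x = None" "\<Gamma>2 x = Some (Sess (Out T S''))"
    using hx(1) r(1)[unfolded splits_def, rule_format, of x] by auto
  then have S': "S' = Out T S''" using splits_pass[OF a(3,4)] by auto
  have x: "(\<Gamma>(y := live (Sess (dual S)))) x = None" using a(1) assms(1) by simp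
  have h': "splits (\<Gamma>h(x := None)) \<Gamma>m Map.empty"
    using splits_updI[OF h(1) hx(2), of None] by (simp only: sing_None)
  have "splits (\<Gamma>2(x := None)) \<Gamma>r (\<Gamma>h(x := None))"
    using splits_updI[OF r(1) rx(1)] .
  then have "splits (\<Gamma>2(x := None)) \<Gamma>r \<Gamma>m" using h' by simp
  moreover have "splits (\<Gamma>(y := live (Sess (dual S)))) \<Gamma>1 (\<Gamma>2(x := None))"
    using splits_updD(2)[OF a(3,4) x] .
  ultimately obtain \<Delta> where d: "splits (\<Gamma>(y := live (Sess (dual S)))) \<Gamma>r \<Delta>" "splits \<Delta> \<Gamma>1 \<Gamma>m"
    using splits_rotate by blast
  have s: "splits (\<Gamma>(y := live (Sess (dual S)), x := live (Sess S''))) \<Delta> (\<Gamma>r(x := live (Sess S'')))"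
    using splits_updI[OF splits_sym[OF d(1)]] splits_NoneD[OF d(1)] x by blast
  have "wtC (fplug F (Var x) \<parallel> C) (\<Gamma>r(x := live (Sess S''))) \<phi> U"
    using q[OF splits_sing[of \<Gamma>r x "Sess S''", OF rx(1)]] h(3) by simp
  moreover have "wtB (Val M # ms) \<Delta> S'' S"
    using splits_sym[OF d(2)] h(2) a(5) S' by auto
  moreover have "\<Delta> x = None" using splits_NoneD[OF d(1)] x by blast
  ultimately show "wtC (Res x (Val M # ms) y (fplug F (Var x) \<parallel> C)) \<Gamma> \<phi> U"
    using s a(1,2) unfolding wtC_Res_neq[OF assms(1)] by blast
next
  assume "wtC (Res x (Val M # ms) y (fplug F (Var x) \<parallel> C)) \<Gamma> \<phi> U"
  then obtain \<Gamma>1 \<Gamma>2 S S'' where a: "\<Gamma> x = None" "\<Gamma> y = None"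
    "splits (\<Gamma>(y := live (Sess (dual S)), x := live (Sess S''))) \<Gamma>1 \<Gamma>2"
    "\<Gamma>1 x = None" "wtB (Val M # ms) \<Gamma>1 S'' S" "wtC (fplug F (Var x) \<parallel> C) \<Gamma>2 \<phi> U"
    unfolding wtC_Res_neq[OF assms(1)] by blast
  obtain V \<Gamma>r where r: "splits \<Gamma>2 \<Gamma>r (sing x V)" "dom \<Gamma>r \<subseteq> ffn F \<union> fn_conf C"
    and q: "\<And>\<Gamma>' \<Gamma>h' N. splits \<Gamma>' \<Gamma>r \<Gamma>h' \<Longrightarrow> wtM N \<Gamma>h' V \<Longrightarrow> wtC (fplug F N \<parallel> C) \<Gamma>' \<phi> U"
    using wtC_fplug_Par[OF a(6)] unfolding fhat_fbinders[OF assms(2)] framed_unbound wtM.simps by blast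
  \<comment> \<open>In this direction the type \<open>V\<close> of the displayed \<open>x\<close>
    might be \<open>end\<close>. That the context holds no entry of \<open>x\<close> follows from
    the side conditions on free names; since \<open>live\<close> is injective, \<open>V\<close> is
    then the type of the endpoint.\<close>
  have rx: "\<Gamma>r x = None" using r(2) assms(3,4) by auto
  have "live V = live (Sess S'')"
    using splits_pass[OF r(1) rx] splits_pass[OF a(3,4)] by simp
  then have V: "V = Sess S''" by simp
  from a(5) obtain \<Gamma>m \<Gamma>b T where b: "splits \<Gamma>1 \<Gamma>m \<Gamma>b" "wtM M \<Gamma>m T" "wtB ms \<Gamma>b (Out T S'') S"
    by auto
  have bx: "\<Gamma>m x = None" "\<Gamma>b x = None" using splits_NoneD[OF b(1)] a(4) by auto
  have x: "(\<Gamma>(y := live (Sess (dual S)))) x = None" using a(1) assms(1) by simp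
  have "splits (\<Gamma>2(x := None)) \<Gamma>r Map.empty"
    using splits_updI[OF r(1) rx, of None] by (simp only: sing_None)
  then have "\<Gamma>r = \<Gamma>2(x := None)" by simp
  then have "splits (\<Gamma>(y := live (Sess (dual S)))) \<Gamma>1 \<Gamma>r"
    using splits_updD(2)[OF a(3,4) x] by (simp only:)
  then obtain \<Delta> where d: "splits (\<Gamma>(y := live (Sess (dual S)))) \<Delta> \<Gamma>b" "splits \<Delta> \<Gamma>r \<Gamma>m"
    using splits_assoc[OF splits_sym b(1)] by blast
  let ?t = "live (Sess (Out T S''))"
  have "splits (\<Gamma>(y := live (Sess (dual S)), x := ?t)) \<Gamma>b (\<Delta>(x := ?t))"
    using splits_updI[OF splits_sym[OF d(1)] bx(2)] .
  moreover have "wtC (fplug F (SendP M (Var x)) \<parallel> C) (\<Delta>(x := ?t)) \<phi> U"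
  proof (rule q)
    show "splits (\<Delta>(x := ?t)) \<Gamma>r (\<Gamma>m(x := ?t))" using splits_updI[OF d(2) rx] .
    show "wtM (SendP M (Var x)) (\<Gamma>m(x := ?t)) V"
      using b(2) V splits_sing[of \<Gamma>m x "Sess (Out T S'')"] bx(1) unfolding wtM.simps by blast
  qed
  ultimately show "wtC (Res x ms y (fplug F (SendP M (Var x)) \<parallel> C)) \<Gamma> \<phi> U"
    using a(1,2) bx(2) b(3) unfolding wtC_Res_neq[OF assms(1)] by blast
qed

text \<open>A label carries no environment, so only the type of \<open>x\<close> changes and
  \<open>framed_update\<close> suffices, even when other names are bound over the hole. The context
  has no share in \<open>x\<close> because a choice type is live at the hole, or, from right to
  left, because \<open>x\<close> is not free in it.\<close>

lemma wtC_Select: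
  assumes "x \<noteq> y" "x \<notin> fbinders F" "x \<notin> ffn F" "x \<notin> fn_conf C"
  shows "wtC (Res x ms y (fplug F (Select l (Var x)) \<parallel> C)) \<Gamma> \<phi> U \<longleftrightarrow>
    wtC (Res x (Lbl l # ms) y (fplug F (Var x) \<parallel> C)) \<Gamma> \<phi> U"
proof
  assume "wtC (Res x ms y (fplug F (Select l (Var x)) \<parallel> C)) \<Gamma> \<phi> U"
  then obtain \<Gamma>1 \<Gamma>2 S S' where a: "\<Gamma> x = None" "\<Gamma> y = None"
    "splits (\<Gamma>(y := live (Sess (dual S)), x := live (Sess S'))) \<Gamma>1 \<Gamma>2"
    "\<Gamma>1 x = None" "wtB ms \<Gamma>1 S' S" "wtC (fplug F (Select l (Var x)) \<parallel> C) \<Gamma>2 \<phi> U"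
    unfolding wtC_Res_neq[OF assms(1)] by blast
  obtain Ss S'' where f: "framesFP F C \<Gamma>2 \<phi> U (sing x (Sess (IChoice Ss))) (Sess S'')" "fmlookup Ss l = Some S''"
    using wtC_fplug_Par[OF a(6)] unfolding wtM.simps by blast
  have "sing x (Sess (IChoice Ss)) x \<noteq> None" by simp
  note u = framed_update[OF f(1) assms(2) disjI2[OF this]]
  have "live (Sess (IChoice Ss)) = live (Sess S')"
    using u(1) splits_pass[OF a(3,4)] by simp
  then have S': "S' = IChoice Ss" by simp
  have "splits (\<Gamma>(y := live (Sess (dual S)), x := live (Sess S''))) \<Gamma>1 (\<Gamma>2(x := live (Sess S'')))"
    using splits_updI[OF a(3,4)] by simp
  moreover have "wtC (fplug F (Var x) \<parallel> C) (\<Gamma>2(x := live (Sess S''))) \<phi> U"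
    using framed_here[OF u(2)[of "live (Sess S'')"]] unfolding sing_upd by simp
  moreover have "wtB (Lbl l # ms) \<Gamma>1 S'' S" using a(5) S' f(2) by auto
  ultimately show "wtC (Res x (Lbl l # ms) y (fplug F (Var x) \<parallel> C)) \<Gamma> \<phi> U"
    using a(1,2,4) unfolding wtC_Res_neq[OF assms(1)] by blast
next
  assume "wtC (Res x (Lbl l # ms) y (fplug F (Var x) \<parallel> C)) \<Gamma> \<phi> U"
  then obtain \<Gamma>1 \<Gamma>2 S S'' where a: "\<Gamma> x = None" "\<Gamma> y = None"
    "splits (\<Gamma>(y := live (Sess (dual S)), x := live (Sess S''))) \<Gamma>1 \<Gamma>2"
    "\<Gamma>1 x = None" "wtB (Lbl l # ms) \<Gamma>1 S'' S" "wtC (fplug F (Var x) \<parallel> C) \<Gamma>2 \<phi> U"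
    unfolding wtC_Res_neq[OF assms(1)] by blast
  obtain V where f: "framesFP F C \<Gamma>2 \<phi> U (sing x V) V"
    using wtC_fplug_Par[OF a(6)] unfolding wtM.simps by blast
  have "x \<notin> ffn F \<union> fn_conf C" using assms(3,4) by simp
  note u = framed_update[OF f assms(2) disjI1[OF this]]
  have "live V = live (Sess S'')"
    using u(1) splits_pass[OF a(3,4)] by simp
  then have V: "V = Sess S''" by simp
  from a(5) obtain Ss where b: "fmlookup Ss l = Some S''" "wtB ms \<Gamma>1 (IChoice Ss) S" by auto
  have "splits (\<Gamma>(y := live (Sess (dual S)), x := live (Sess (IChoice Ss)))) \<Gamma>1
      (\<Gamma>2(x := live (Sess (IChoice Ss))))"
    using splits_updI[OF a(3,4)] by simp
  moreover have "wtM (Select l (Var x)) (sing x (Sess (IChoice Ss))) V"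
    using V b(1) by auto
  then have "wtC (fplug F (Select l (Var x)) \<parallel> C) (\<Gamma>2(x := live (Sess (IChoice Ss)))) \<phi> U"
    using framed_here[OF u(2)[of "live (Sess (IChoice Ss))"]] unfolding sing_upd by blast
  ultimately show "wtC (Res x ms y (fplug F (Select l (Var x)) \<parallel> C)) \<Gamma> \<phi> U"
    using a(1,2,4) b(2) unfolding wtC_Res_neq[OF assms(1)] by blast
qed

lemma wtC_ConfSubExt:
  assumes "x \<notin> gfn G" "x \<notin> gbinders G" "gbinders G \<inter> fn M = {}"
  shows "wtC (CSub (gplug G C) M x) \<Gamma> \<phi> U \<longleftrightarrow> wtC (gplug G (CSub C M x)) \<Gamma> \<phi> U"
proof
  assume "wtC (CSub (gplug G C) M x) \<Gamma> \<phi> U"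
  then obtain \<Gamma>1 \<Gamma>2 T where *: "splits \<Gamma> \<Gamma>1 \<Gamma>2" "\<Gamma>1 x = None"
    "wtC (gplug G C) (\<Gamma>1(x := live T)) \<phi> U" "wtM M \<Gamma>2 T"
    unfolding wtC_CSub by blast
  obtain \<psi> V \<Gamma>h where h: "wtC C \<Gamma>h \<psi> V" "framesC G (\<Gamma>1(x := live T)) \<phi> U \<Gamma>h \<psi> V"
    using wtC_gplug[OF *(3)] by blast
  have "dom \<Gamma>2 \<inter> gbinders G = {}" using wtM_dom[OF *(4)] assms(3) by blast
  from framed_sink[OF h(2) assms(1,2) *(2,1) this] obtain \<Gamma>h1 \<Gamma>h' where
    "\<Gamma>h = \<Gamma>h1(x := live T)" "\<Gamma>h1 x = None" "splits \<Gamma>h' \<Gamma>h1 \<Gamma>2"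
    and q: "\<forall>D. wtC D \<Gamma>h' \<psi> V \<longrightarrow> wtC (gplug G D) \<Gamma> \<phi> U"
    by blast
  then have "wtC (CSub C M x) \<Gamma>h' \<psi> V" using h(1) *(4) unfolding wtC_CSub by blast
  then show "wtC (gplug G (CSub C M x)) \<Gamma> \<phi> U" using q by blast
next
  assume "wtC (gplug G (CSub C M x)) \<Gamma> \<phi> U"
  then obtain \<psi> V \<Gamma>h where h: "wtC (CSub C M x) \<Gamma>h \<psi> V" "framesC G \<Gamma> \<phi> U \<Gamma>h \<psi> V"
    using wtC_gplug by blast
  from h(1) obtain \<Gamma>1 \<Gamma>2 T where *: "splits \<Gamma>h \<Gamma>1 \<Gamma>2" "\<Gamma>1 x = None"
    "wtC C (\<Gamma>1(x := live T)) \<psi> V" "wtM M \<Gamma>2 T"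
    unfolding wtC_CSub by blast
  have "dom \<Gamma>2 \<inter> gbinders G = {}" using wtM_dom[OF *(4)] assms(3) by blast
  from framed_float[OF h(2) assms(1,2) *(2,1) this, of "live T"] *(3,4)
  show "wtC (CSub (gplug G C) M x) \<Gamma> \<phi> U" unfolding wtC_CSub by blast
qed

section \<open>Structural congruence and reduction of configurations\<close>

lemma wtC_scongC: "C \<equiv>\<^sub>C D \<Longrightarrow> wtC C = wtC D"
proof (induction rule: scongC.induct)
  case (SCC_Term M M' \<phi>)
  then have "wtM M = wtM M'" by (rule wtM_scongM)
  then show ?case by (intro ext) simp
next
  case (SCC_ResSwap x y C)
  \<comment> \<open>After the swap the session type is \<open>dual S\<close>; duality being an
    involution, the two entries are the same as before.\<close>
  have 1: "wtC (Res y [] x C) \<Gamma> \<phi> T" if n: "x \<noteq> y" and w: "wtC (Res x [] y C) \<Gamma> \<phi> T" for x y \<Gamma> \<phi> T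
  proof -
    from w obtain S where *: "\<Gamma> x = None" "\<Gamma> y = None"
      "wtC C (\<Gamma>(y := live (Sess (dual S)), x := live (Sess S))) \<phi> T"
      unfolding wtC_Res_Nil[OF n] by blast
    have "\<Gamma>(y := live (Sess (dual S)), x := live (Sess S)) =
        \<Gamma>(x := live (Sess (dual (dual S))), y := live (Sess (dual S)))"
      using n by (auto simp: fun_eq_iff)
    then show ?thesis using * unfolding wtC_Res_Nil[OF n[symmetric]] by metis
  qed
  show ?case using 1[OF SCC_ResSwap] 1[OF SCC_ResSwap[symmetric]] by (intro ext) blast
next
  case (SCC_ResComm x y z w ns ms C)
  have "distinct [z, w, x, y]" using SCC_ResComm(1) by auto
  then show ?case
    using wtC_ResComm[OF SCC_ResComm] wtC_ResComm[OF _ SCC_ResComm(3,2)] by (intro ext) blast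
next
  case (SCC_ResExt x y C ms D)
  then show ?case by (intro ext wtC_ResExt)
next
  case (SCC_ResNil x y C)
  have "wtC (Res x [] y C) \<Gamma> \<phi> T \<longleftrightarrow> wtC C \<Gamma> \<phi> T" for \<Gamma> \<phi> T
  proof
    assume "wtC (Res x [] y C) \<Gamma> \<phi> T"
    then obtain S where *: "\<Gamma> x = None" "\<Gamma> y = None"
      "wtC C (\<Gamma>(y := live (Sess (dual S)), x := live (Sess S))) \<phi> T"
      unfolding wtC_Res_Nil[OF SCC_ResNil(1)] by blast
    \<comment> \<open>\<open>C\<close> does not mention \<open>x\<close>, so there can be no entry
      for it; the session guessed for the empty buffer was \<open>end\<close>.\<close>
    have "live (Sess S) = None" using wtC_dom[OF *(3)] SCC_ResNil(2) by (auto split: if_splits)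
    then have "S = End" by simp
    then have "\<Gamma>(y := live (Sess (dual S)), x := live (Sess S)) = \<Gamma>"
      using *(1,2) by (auto simp: fun_eq_iff live_def)
    then show "wtC C \<Gamma> \<phi> T" using *(3) by simp
  next
    assume w: "wtC C \<Gamma> \<phi> T"
    then have n: "\<Gamma> x = None" "\<Gamma> y = None" using wtC_dom[OF w] SCC_ResNil(2,3) by auto
    \<comment> \<open>The session \<open>end\<close> is its own dual and adds no entries.\<close>
    then have "\<Gamma>(y := live (Sess (dual End)), x := live (Sess End)) = \<Gamma>"
      by (auto simp: fun_eq_iff live_def)
    then show "wtC (Res x [] y C) \<Gamma> \<phi> T"
      using n w unfolding wtC_Res_Nil[OF SCC_ResNil(1)] by metis
  qed
  then show ?case by (intro ext)
next
  case (SCC_Send x y F C ms M)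
  then show ?case by (intro ext wtC_Send)
next
  case (SCC_Select x y F C ms l)
  then show ?case by (intro ext wtC_Select)
next
  case (SCC_ParNil C)
  have "wtC (C \<parallel> Thread Child Triv) \<Gamma> \<phi> T \<longleftrightarrow> wtC C \<Gamma> \<phi> T" for \<Gamma> \<phi> T
  proof
    assume "wtC C \<Gamma> \<phi> T"
    moreover have "splits \<Gamma> \<Gamma> Map.empty" by simp
    ultimately show "wtC (C \<parallel> Thread Child Triv) \<Gamma> \<phi> T"
      unfolding wtC.simps wtM.simps by blast
  qed auto
  then show ?case by (intro ext)
next
  case (SCC_ParComm C D)
  have "wtC (C \<parallel> D) \<Gamma> \<phi> T \<Longrightarrow> wtC (D \<parallel> C) \<Gamma> \<phi> T" for C D :: "'a conf" and \<Gamma> \<phi> T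
    unfolding wtC.simps using splits_sym by blast
  then show ?case by (intro ext) blast
next
  case (SCC_ParAssoc C D E)
  then show ?case by (intro ext wtC_ParAssoc)
next
  case (SCC_ConfSub \<phi> M N x)
  have "wtC (Thread \<phi> (ESub M N x)) \<Gamma> \<psi> T \<longleftrightarrow> wtC (CSub (Thread \<phi> M) N x) \<Gamma> \<psi> T" for \<Gamma> \<psi> T
    unfolding wtC_CSub wtC.simps wtM_ESub by blast
  then show ?case by (intro ext)
next
  case (SCC_ConfSubExt x G M C)
  then show ?case by (intro ext wtC_ConfSubExt)
qed (intro ext; simp only: wtC.simps wtC_Res wtC_CSub)+

lemma wtC_redC: "C \<longrightarrow>\<^sub>C D \<Longrightarrow> wtC C \<Gamma> \<phi> U \<Longrightarrow> wtC D \<Gamma> \<phi> U"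
proof (induction arbitrary: \<Gamma> \<phi> U rule: redC.induct)
  case (RC_New x y F)
  obtain V \<Gamma>h where h: "wtM New \<Gamma>h V" "framesF F \<Gamma> \<phi> U \<Gamma>h V"
    using wtC_fplug[OF RC_New.prems] by blast
  then obtain S where S: "\<Gamma>h = Map.empty" "V = Prod (Sess S) (Sess (dual S))" by auto
  have xy: "x \<notin> fbinders F" "y \<notin> fbinders F" "x \<notin> ffn F" "y \<notin> ffn F" using RC_New.hyps(2) by auto
  \<comment> \<open>\<open>New\<close> uses no entries at all; the two endpoints, both absent from
    the context, are added one after the other.\<close>
  note y = framed_update[OF h(2) xy(2) disjI1[OF xy(4)]]
  note x = framed_update[OF y(2)[of "live (Sess (dual S))"] xy(1) disjI1[OF xy(3)]]
  have n: "\<Gamma> y = None" "\<Gamma> x = None"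
    using y(1) x(1) S(1) RC_New.hyps(1) by auto
  have "splits (Map.empty(y := live (Sess (dual S)), x := live (Sess S)))
      (sing x (Sess S)) (sing y (Sess (dual S)))"
    using RC_New.hyps(1) by (simp add: splits_def)
  then have "wtM (Tup (Var x) (Var y)) (\<Gamma>h(y := live (Sess (dual S)), x := live (Sess S))) V"
    unfolding S wtM.simps by blast
  then have "wtC (fplug F (Tup (Var x) (Var y))) (\<Gamma>(y := live (Sess (dual S)), x := live (Sess S))) \<phi> U"
    using framed_here[OF x(2)] by blast
  then show ?case using n unfolding wtC_Res_Nil[OF RC_New.hyps(1)] by blast
next
  case (RC_Spawn F M N)
  obtain V \<Gamma>h \<Gamma>r where "wtM (Spawn (Tup M N)) \<Gamma>h V" and r: "splits \<Gamma> \<Gamma>r \<Gamma>h"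
    and q: "\<And>\<Gamma>' \<Gamma>h' N. splits \<Gamma>' \<Gamma>r \<Gamma>h' \<Longrightarrow> wtM N \<Gamma>h' V \<Longrightarrow> wtC (fplug F N) \<Gamma>' \<phi> U"
    using wtC_fplug[OF RC_Spawn.prems] unfolding fhat_fbinders[OF RC_Spawn.hyps] framed_unbound by blast
  then obtain \<Gamma>1 \<Gamma>2 where h: "splits \<Gamma>h \<Gamma>1 \<Gamma>2" "wtM M \<Gamma>1 One" "wtM N \<Gamma>2 V"
    unfolding wtM.simps ty.inject by blast
  \<comment> \<open>\<open>M\<close> takes its share \<open>\<Gamma>1\<close> out of the hole, over
    which a hatted context binds nothing.\<close>
  obtain \<Delta> where d: "splits \<Gamma> \<Delta> \<Gamma>1" "splits \<Delta> \<Gamma>r \<Gamma>2"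
    using splits_assoc[OF r splits_sym[OF h(1)]] .
  then show ?case using q h(2,3) unfolding wtC.simps by blast
next
  case (RC_Recv x y F ms M C)
  have ef: "fbinders F = {}" using fhat_fbinders[OF RC_Recv.hyps(2)] .
  obtain \<Gamma>1 \<Gamma>2 S S' where a: "\<Gamma> x = None" "\<Gamma> y = None"
    "splits (\<Gamma>(y := live (Sess (dual S)), x := live (Sess S'))) \<Gamma>1 \<Gamma>2"
    "\<Gamma>1 x = None" "wtB (ms @ [Val M]) \<Gamma>1 S' S" "wtC (fplug F (Recv (Var y)) \<parallel> C) \<Gamma>2 \<phi> U"
    using RC_Recv.prems unfolding wtC_Res_neq[OF RC_Recv.hyps(1)] by blast
  from a(5) obtain \<Gamma>b \<Gamma>m T S0 where b: "S = Out T S0" "splits \<Gamma>1 \<Gamma>b \<Gamma>m" "wtB ms \<Gamma>b S' S0" "wtM M \<Gamma>m T"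
    unfolding wtB_snoc by blast
  obtain V \<Gamma>h \<Gamma>r where "wtM (Recv (Var y)) \<Gamma>h V" and r: "splits \<Gamma>2 \<Gamma>r \<Gamma>h"
    and q: "\<And>\<Gamma>' \<Gamma>h' N. splits \<Gamma>' \<Gamma>r \<Gamma>h' \<Longrightarrow> wtM N \<Gamma>h' V \<Longrightarrow> wtC (fplug F N \<parallel> C) \<Gamma>' \<phi> U"
    using wtC_fplug_Par[OF a(6)] unfolding ef framed_unbound by blast
  then obtain T1 S1 where h: "\<Gamma>h = sing y (Sess (In T1 S1))" "V = Prod T1 (Sess S1)"
    unfolding wtM.simps by blast
  have ry: "\<Gamma>r y = None" "\<Gamma>2 y = Some (Sess (In T1 S1))"
    using r[unfolded splits_def, rule_format, of y] h(1) by auto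
  \<comment> \<open>The body uses \<open>y\<close> at a live type, so the buffer does not hold
    it.\<close>
  have y1: "\<Gamma>1 y = None"
    using a(3)[unfolded splits_def, rule_format, of y] ry(2) by auto
  \<comment> \<open>Buffer and body are tied together by \<open>dual S\<close> alone: with
    \<open>S = Out T S0\<close> this forces \<open>T1 = T\<close> and
    \<open>S1 = dual S0\<close>.\<close>
  have "live (Sess (dual S)) = Some (Sess (In T1 S1))"
    using splits_pass[OF a(3) y1] ry(2) RC_Recv.hyps(1) by simp
  then have V: "V = Prod T (Sess (dual S0))" using b(1) h(2) by simp
  have bn: "\<Gamma>b y = None" "\<Gamma>m y = None" "\<Gamma>b x = None"
    using splits_NoneD[OF b(2)] y1 a(4) by auto
  have n: "(\<Gamma>(x := live (Sess S'))) y = None" using a(2) RC_Recv.hyps(1) by simp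
  \<comment> \<open>Brings the update of \<open>y\<close> outermost, where it can be removed and
    replaced.\<close>
  have tw: "\<Gamma>(y := t, x := live (Sess S')) = \<Gamma>(x := live (Sess S'), y := t)" for t
    using RC_Recv.hyps(1) by (auto simp: fun_eq_iff)
  have "splits (\<Gamma>2(y := None)) \<Gamma>r Map.empty"
    using splits_updI[OF r ry(1), of None] unfolding h(1) by (simp only: sing_None)
  then have "\<Gamma>r = \<Gamma>2(y := None)" by simp
  then have "splits (\<Gamma>(x := live (Sess S'))) \<Gamma>1 \<Gamma>r"
    using splits_updD(2)[OF a(3)[unfolded tw] y1 n] by (simp only:)
  then obtain \<Delta> where d: "splits (\<Gamma>(x := live (Sess S'))) \<Delta> \<Gamma>b" "splits \<Delta> \<Gamma>r \<Gamma>m"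
    using splits_assoc[OF splits_sym splits_sym[OF b(2)]] by blast
  let ?t = "live (Sess (dual S0))"
  have "splits (\<Gamma>(y := ?t, x := live (Sess S'))) \<Gamma>b (\<Delta>(y := ?t))"
    unfolding tw using splits_updI[OF splits_sym[OF d(1)] bn(1)] .
  moreover have "wtC (fplug F (Tup M (Var y)) \<parallel> C) (\<Delta>(y := ?t)) \<phi> U"
  proof (rule q)
    show "splits (\<Delta>(y := ?t)) \<Gamma>r (\<Gamma>m(y := ?t))" using splits_updI[OF d(2) ry(1)] .
    show "wtM (Tup M (Var y)) (\<Gamma>m(y := ?t)) V"
      using b(4) V splits_sing[of \<Gamma>m y "Sess (dual S0)", OF bn(2)] unfolding wtM.simps by blast
  qed
  ultimately show ?case
    using a(1,2) bn(3) b(3) unfolding wtC_Res_neq[OF RC_Recv.hyps(1)] by blast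
next
  case (RC_Case x y F B j N ms C)
  obtain \<Gamma>1 \<Gamma>2 S S' where a: "\<Gamma> x = None" "\<Gamma> y = None"
    "splits (\<Gamma>(y := live (Sess (dual S)), x := live (Sess S'))) \<Gamma>1 \<Gamma>2"
    "\<Gamma>1 x = None" "wtB (ms @ [Lbl j]) \<Gamma>1 S' S" "wtC (fplug F (Case (Var y) B) \<parallel> C) \<Gamma>2 \<phi> U"
    using RC_Case.prems unfolding wtC_Res_neq[OF RC_Case.hyps(1)] by blast
  from a(5) obtain Ss S0 where b: "S = IChoice Ss" "fmlookup Ss j = Some S0" "wtB ms \<Gamma>1 S' S0"
    unfolding wtB_snoc by blast
  obtain V \<Gamma>h where "wtM (Case (Var y) B) \<Gamma>h V" and f: "framesFP F C \<Gamma>2 \<phi> U \<Gamma>h V"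
    using wtC_fplug_Par[OF a(6)] by blast
  then obtain Ss' \<Gamma>n where h: "splits \<Gamma>h (sing y (Sess (EChoice Ss'))) \<Gamma>n"
    "\<And>S. fmlookup Ss' j = Some S \<Longrightarrow> wtM N \<Gamma>n (Lolli (Sess S) V)"
    unfolding wtM_Case wtM.simps(1) using RC_Case.hyps(3) by blast
  have hy: "\<Gamma>h y = Some (Sess (EChoice Ss'))" "\<Gamma>n y = None"
    using h(1)[unfolded splits_def, rule_format, of y] by auto
  then have "\<Gamma>h y \<noteq> None" by simp
  note u = framed_update[OF f RC_Case.hyps(2) disjI2[OF this]]
  have y1: "\<Gamma>1 y = None"
    using a(3)[unfolded splits_def, rule_format, of y] u(1) hy(1) by auto
  have "live (Sess (dual S)) = Some (Sess (EChoice Ss'))"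
    using splits_pass[OF a(3) y1] u(1) hy(1) RC_Case.hyps(1) by simp
  then have "Ss' = fmmap dual Ss" using b(1) by simp
  then have N: "wtM N \<Gamma>n (Lolli (Sess (dual S0)) V)" using h(2) b(2) by simp
  let ?t = "live (Sess (dual S0))"
  \<comment> \<open>The scrutinee held the entry of \<open>y\<close> and nothing else. What remains
    is the environment of the branches, to which \<open>y\<close> returns at its advanced
    type.\<close>
  have "splits (\<Gamma>h(y := None)) Map.empty \<Gamma>n"
    using splits_updI[OF splits_sym[OF h(1)] hy(2), of None] splits_sym unfolding sing_None by blast
  then have "\<Gamma>h(y := ?t) = \<Gamma>n(y := ?t)" by (metis fun_upd_upd splits_empty(1))
  then have "wtM (App N (Var y)) (\<Gamma>h(y := ?t)) V"
    using N splits_sing[of \<Gamma>n y "Sess (dual S0)", OF hy(2)] unfolding wtM.simps by metis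
  then have "wtC (fplug F (App N (Var y)) \<parallel> C) (\<Gamma>2(y := ?t)) \<phi> U"
    using framed_here[OF u(2)] by blast
  moreover have "splits (\<Gamma>(y := ?t, x := live (Sess S'))) \<Gamma>1 (\<Gamma>2(y := ?t))"
    using splits_updI[OF a(3) y1, of ?t] RC_Case.hyps(1) by (simp add: fun_upd_twist)
  ultimately show ?case
    using a(1,2,4) b(3) unfolding wtC_Res_neq[OF RC_Case.hyps(1)] by blast
next
  case (RC_LiftC C C' G)
  obtain \<psi> V \<Gamma>h where h: "wtC C \<Gamma>h \<psi> V" "framesC G \<Gamma> \<phi> U \<Gamma>h \<psi> V"
    using wtC_gplug[OF RC_LiftC.prems] by blast
  then show ?case using framed_here[OF h(2)] RC_LiftC.IH by blast
next
  case (RC_LiftM M M' F)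
  obtain V \<Gamma>h where h: "wtM M \<Gamma>h V" "framesF F \<Gamma> \<phi> U \<Gamma>h V"
    using wtC_fplug[OF RC_LiftM.prems] by blast
  then show ?case using framed_here[OF h(2)] wtM_redM[OF RC_LiftM.hyps] by blast
next
  case (RC_SC C C' D' D)
  then show ?case using wtC_scongC by metis
qed

section \<open>Correspondence with the declarative rules\<close>

definition core :: "'l env \<Rightarrow> 'l lenv" where
  "core G n = Option.bind (fmlookup G n) live"

lemma core_fmempty [simp]: "core fmempty = Map.empty"
  by (simp add: core_def fun_eq_iff)

lemma core_fmupd [simp]: "core (fmupd x T G) = (core G)(x := live T)"
  by (simp add: core_def fun_eq_iff)

lemma core_notin: "x \<notin> fmdom' G \<Longrightarrow> core G x = None"
  by (auto simp: core_def dest: fmdom'_notD)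

lemma core_fmadd: "G \<diamondop> H \<Longrightarrow> splits (core (G ++\<^sub>f H)) (core G) (core H)"
  unfolding splits_def
proof
  fix n
  assume "G \<diamondop> H"
  then have "n \<notin> fmdom' G \<or> n \<notin> fmdom' H" by (auto simp: disj_def)
  then show "core G n = None \<and> core (G ++\<^sub>f H) n = core H n \<or>
      core H n = None \<and> core (G ++\<^sub>f H) n = core G n"
  proof
    assume "n \<notin> fmdom' G"
    then have "fmlookup G n = None" by (rule fmdom'_notD)
    then show ?thesis by (cases "n |\<in>| fmdom H") (auto simp: core_def fmdom_notD)
  next
    assume "n \<notin> fmdom' H"
    then have "fmlookup H n = None" by (rule fmdom'_notD)
    then show ?thesis by (auto simp: core_def fmlookup_dom_iff)
  qed
qed

text \<open>Entries of type \<open>end\<close> lie in neither part of the core. Cutting at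
  \<open>dom \<Gamma>1\<close> sends all of them to the right half, so both halves have the required
  cores and the left one is free of \<open>end\<close>.\<close>

lemma splits_coreD:
  fixes G :: "'l env"
  assumes "splits (core G) \<Gamma>1 \<Gamma>2"
  shows "G = fmrestrict_set (dom \<Gamma>1) G ++\<^sub>f fmdrop_set (dom \<Gamma>1) G"
    and "fmrestrict_set (dom \<Gamma>1) G \<diamondop> fmdrop_set (dom \<Gamma>1) G"
    and "core (fmrestrict_set (dom \<Gamma>1) G) = \<Gamma>1"
    and "core (fmdrop_set (dom \<Gamma>1) G) = \<Gamma>2"
proof -
  show "G = fmrestrict_set (dom \<Gamma>1) G ++\<^sub>f fmdrop_set (dom \<Gamma>1) G"
    by (rule fmap_ext) (auto simp: fmlookup_dom_iff)
  show "fmrestrict_set (dom \<Gamma>1) G \<diamondop> fmdrop_set (dom \<Gamma>1) G"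
    unfolding disj_def fmdom'_restrict_set_precise fmdom'_drop_set by blast
  show "core (fmrestrict_set (dom \<Gamma>1) G) = \<Gamma>1"
  proof
    show "core (fmrestrict_set (dom \<Gamma>1) G) n = \<Gamma>1 n" for n
      using assms[unfolded splits_def, rule_format, of n] by (cases "\<Gamma>1 n") (auto simp: core_def)
  qed
  show "core (fmdrop_set (dom \<Gamma>1) G) = \<Gamma>2"
  proof
    show "core (fmdrop_set (dom \<Gamma>1) G) n = \<Gamma>2 n" for n
      using assms[unfolded splits_def, rule_format, of n] by (cases "\<Gamma>1 n") (auto simp: core_def)
  qed
qed

lemma live_eq_rev [simp]: "None = live T \<longleftrightarrow> T = Sess End" "Some U = live T \<longleftrightarrow> U = T \<and> T \<noteq> Sess End"
  by (auto simp: live_def)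

lemma sing_End: "sing x (Sess End) = Map.empty"
  by (simp add: sing_def live_def)

section \<open>From the declared rules to the linear system\<close>

lemma typM_wtM: "G \<turnstile>\<^sub>M M \<^bold>: T \<Longrightarrow> wtM M (core G) T"
proof (induction rule: typM.induct)
  case (T_Var x T)
  show ?case by (simp only: wtM.simps core_fmupd core_fmempty sing_def)
next
  case (T_EndR x)
  show ?case by (simp only: wtM.simps core_fmempty sing_End)
next
  case (T_EndL x G M T)
  then have "core (fmupd x (Sess End) G) = core G"
    by (auto simp: fun_eq_iff core_notin)
  then show ?case using T_EndL.IH by (simp only:)
next
  case (T_Abs x G T M U)
  then show ?case unfolding wtM_Lam core_fmupd using core_notin by blast
next
  case (T_Split G H x y M T T' N U)
  have tw: "(core H)(x := live T, y := live T') = (core H)(y := live T', x := live T)"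
    using T_Split.hyps(2) by (simp add: fun_upd_twist)
  have "wtM N ((core H)(y := live T', x := live T)) U"
    using T_Split.IH(2) unfolding core_fmupd tw .
  then show ?case
    unfolding wtM_LetP
    using T_Split.IH(1) core_fmadd[OF T_Split.hyps(1)] core_notin T_Split.hyps(2-4) by blast
next
  case (T_Sub G H x T M U N)
  then show ?case unfolding wtM_ESub core_fmupd using core_fmadd core_notin by blast
next
  case (T_Case G H M Ss B U)
  then show ?case unfolding wtM_Case using core_fmadd by blast
next
  case (T_App G H M T U N)
  then show ?case unfolding wtM.simps using core_fmadd by blast
next
  case (T_Pair G H M T N U)
  then show ?case unfolding wtM.simps using core_fmadd by blast
next
  case (T_SendP G H M T N S)
  then show ?case unfolding wtM.simps using core_fmadd by blast
qed (unfold wtM.simps core_fmempty, blast+)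

lemma typB_wtB: "G \<turnstile>\<^sub>B ms \<^bold>: S' \<rhd> S \<Longrightarrow> wtB ms (core G) S' S"
proof (induction rule: typB.induct)
  case (T_BufSend G H M T ms S' S)
  then show ?case unfolding wtB_snoc using typM_wtM splits_sym[OF core_fmadd] by blast
next
  case (T_BufSelect G ms S' S Ss j)
  then show ?case unfolding wtB_snoc by blast
qed simp

lemma typC_wtC: "G \<turnstile>\<^sub>C[\<phi>] C \<^bold>: T \<Longrightarrow> wtC C (core G) \<phi> T"
proof (induction rule: typC.induct)
  case (T_ParL G H C \<phi> D T \<psi>)
  then have "\<psi> = \<phi>" by (cases \<phi>) auto
  then show ?case using T_ParL.IH core_fmadd[OF T_ParL.hyps(1)] unfolding wtC.simps by blast
next
  case (T_ParR G H \<phi> C T D \<psi>)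
  then have "\<psi> = \<phi>" by (cases \<phi>) auto
  then show ?case using T_ParR.IH core_fmadd[OF T_ParR.hyps(1)] unfolding wtC.simps by blast
next
  case (T_Res G H x y ms S' S \<phi> C T)
  have n: "core (G ++\<^sub>f H) x = None" "core (G ++\<^sub>f H) y = None" "core G x = None" "core G y = None"
    using T_Res.hyps(3) by (auto intro!: core_notin)
  have tw: "(core H)(x := live (Sess S'), y := live (Sess (dual S))) =
      (core H)(y := live (Sess (dual S)), x := live (Sess S'))"
    using T_Res.hyps(2) by (simp add: fun_upd_twist)
  have "splits ((core (G ++\<^sub>f H))(y := live (Sess (dual S)), x := live (Sess S'))) (core G)
      ((core H)(y := live (Sess (dual S)), x := live (Sess S')))"
    using splits_updI[OF splits_updI[OF core_fmadd[OF T_Res.hyps(1)] n(4)] n(3)] .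
  then show ?case
    using n T_Res.IH typB_wtB[OF T_Res.hyps(4)] unfolding wtC_Res_neq[OF T_Res.hyps(2)] core_fmupd tw by blast
next
  case (T_ResBuf G H x y S ms S' \<phi> C T)
  have n: "core (G ++\<^sub>f H) x = None" "core (G ++\<^sub>f H) y = None" "core G x = None" "core H y = None"
    using T_ResBuf.hyps(3) by (auto intro!: core_notin)
  have nx: "((core G)(y := live (Sess (dual S)))) x = None" using n(3) T_ResBuf.hyps(2) by simp
  have "splits ((core (G ++\<^sub>f H))(y := live (Sess (dual S)), x := live (Sess S')))
      ((core G)(y := live (Sess (dual S)))) ((core H)(x := live (Sess S')))"
    using splits_updI[OF splits_sym[OF splits_updI[OF splits_sym[OF core_fmadd[OF T_ResBuf.hyps(1)]] n(4)]] nx] .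
  then show ?case
    using n(1,2) nx T_ResBuf.IH typB_wtB[OF T_ResBuf.hyps(4)]
    unfolding wtC_Res_neq[OF T_ResBuf.hyps(2)] core_fmupd by blast
next
  case (T_ConfSub G H x T \<phi> C U M)
  then show ?case
    unfolding wtC_CSub core_fmupd using core_fmadd core_notin typM_wtM by blast
qed (simp_all add: typM_wtM)

section \<open>From the linear system back to the declared rules\<close>

lemma typM_weaken:
  assumes "H \<turnstile>\<^sub>M M \<^bold>: T"
  shows "core K = Map.empty \<Longrightarrow> H \<diamondop> K \<Longrightarrow> H ++\<^sub>f K \<turnstile>\<^sub>M M \<^bold>: T"
proof (induction K)
  case fmempty
  then show ?case using assms by simp
next
  \<comment> \<open>An empty core means that all entries have type \<open>end\<close>, so
    \<open>T_EndL\<close> adds them one by one. The rules for leaves need this, as they fix the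
    environment exactly.\<close>
  case (fmupd x U K)
  have k: "core K = Map.empty" "U = Sess End"
  proof -
    have "core K n = None" for n
      using fun_cong[OF fmupd.prems(1), of n] fmupd.hyps by (auto simp: core_def split: if_splits)
    then show "core K = Map.empty" by blast
    show "U = Sess End" using fun_cong[OF fmupd.prems(1), of x] by simp
  qed
  have "x \<notin> fmdom' H" "H \<diamondop> K" using fmupd.prems(2) by (auto simp: disj_def)
  moreover have "x \<notin> fmdom' K" using fmupd.hyps by (rule fmdom'_notI)
  ultimately show ?case using fmupd.IH[OF k(1)] k(2) by (simp add: T_EndL)
qed

lemma fresh: "finite A \<Longrightarrow> \<exists>x. x \<notin> (A :: var set)"
  by (rule ex_new_if_finite[OF infinite_UNIV_nat])

text \<open>The declared rules speak of named binders, so a nameless one has to be opened with a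
  fresh name. The opened body is a renaming of the subterm rather than the subterm itself; hence the
  statement ranges over all renamings.\<close>

lemma wtM_typM: "wtM (rename f M) (core G) T \<Longrightarrow> G \<turnstile>\<^sub>M rename f M \<^bold>: T"
proof (induction M arbitrary: f G T)
  case (Var x)
  then have c: "core G = sing (f x) T" by simp
  show ?case
  proof (cases "T = Sess End")
    case True
    then have "core G = Map.empty" using c by (simp only: sing_End)
    from typM_weaken[OF T_EndR this, of "f x"] show ?thesis using True by (simp add: disj_def)
  next
    case False
    then have l: "fmlookup G (f x) = Some T"
      using fun_cong[OF c, of "f x"] by (auto simp: core_def live_def split: Option.bind_splits if_splits)
    have "core (fmdrop (f x) G) = Map.empty"
    proof
      show "core (fmdrop (f x) G) n = None" for n
        using fun_cong[OF c, of n] by (auto simp: core_def)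
    qed
    from typM_weaken[OF T_Var this, of "f x" T]
    have "fmupd (f x) T fmempty ++\<^sub>f fmdrop (f x) G \<turnstile>\<^sub>M Var (f x) \<^bold>: T" by (simp add: disj_def)
    moreover have "fmupd (f x) T fmempty ++\<^sub>f fmdrop (f x) G = G"
      by (rule fmap_ext) (use l in \<open>auto simp: fmlookup_dom_iff\<close>)
    ultimately show ?thesis by simp
  qed
next
  case Triv
  then show ?case using typM_weaken[OF T_Unit, of G] by (simp add: disj_def)
next
  case New
  then obtain S where "core G = Map.empty" "T = Prod (Sess S) (Sess (dual S))" by auto
  then show ?case using typM_weaken[OF T_New, of G] by (simp add: disj_def)
next
  case (dbAbs M)
  from dbAbs.prems obtain T1 U where u: "T = Lolli T1 U" by auto
  obtain x where x: "x \<notin> fn (rename f (dbAbs M)) \<union> fmdom' G"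
    using fresh[OF finite_UnI[OF finite_fn finite_fmdom']] by blast
  \<comment> \<open>\<open>case_nat x id\<close> names index 0 and shifts the other indices down by
    one.\<close>
  let ?g = "case_nat x id \<circ> lift f"
  have e: "rename f (dbAbs M) = Lam x (rename ?g M)"
    using dbAbs_eq_Lam[of x "rename (lift f) M"] x by (simp add: rename_rename)
  have "wtM (rename ?g M) (core (fmupd x T1 G)) U"
    using dbAbs.prems[unfolded e u wtM_Lam] unfolding core_fmupd by blast
  then have n: "fmupd x T1 G \<turnstile>\<^sub>M rename ?g M \<^bold>: U" by (rule dbAbs.IH)
  show ?case unfolding e u by (rule T_Abs[OF _ n]) (use x in simp)
next
  case (App M N)
  from App.prems obtain \<Gamma>1 \<Gamma>2 U where *: "splits (core G) \<Gamma>1 \<Gamma>2" "wtM (rename f M) \<Gamma>1 (Lolli U T)"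
    "wtM (rename f N) \<Gamma>2 U"
    unfolding rename.simps wtM.simps by blast
  note s = splits_coreD[OF *(1)]
  show ?case
    unfolding rename.simps
    by (subst s(1), rule T_App[OF s(2) App.IH(1) App.IH(2)]) (use *(2,3) s(3,4) in simp_all)
next
  case (Tup M N)
  from Tup.prems obtain \<Gamma>1 \<Gamma>2 U V where *: "splits (core G) \<Gamma>1 \<Gamma>2" "wtM (rename f M) \<Gamma>1 U"
    "wtM (rename f N) \<Gamma>2 V" "T = Prod U V"
    unfolding rename.simps wtM.simps by blast
  note s = splits_coreD[OF *(1)]
  show ?case
    unfolding rename.simps *(4)
    by (subst s(1), rule T_Pair[OF s(2) Tup.IH(1) Tup.IH(2)]) (use *(2,3) s(3,4) in simp_all)
next
  case (SendP M N)
  from SendP.prems obtain \<Gamma>1 \<Gamma>2 U S where *: "splits (core G) \<Gamma>1 \<Gamma>2" "wtM (rename f M) \<Gamma>1 U"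
    "wtM (rename f N) \<Gamma>2 (Sess (Out U S))" "T = Sess S"
    unfolding rename.simps wtM.simps by blast
  note s = splits_coreD[OF *(1)]
  show ?case
    unfolding rename.simps *(4)
    by (subst s(1), rule T_SendP[OF s(2) SendP.IH(1) SendP.IH(2)]) (use *(2,3) s(3,4) in simp_all)
next
  case (dbSplit M N)
  obtain x where x: "x \<notin> fn (rename f (dbSplit M N)) \<union> fmdom' G"
    using fresh[OF finite_UnI[OF finite_fn finite_fmdom']] by blast
  obtain y where y: "y \<notin> insert x (fn (rename f (dbSplit M N)) \<union> fmdom' G)"
    using fresh[OF finite.insertI[OF finite_UnI[OF finite_fn finite_fmdom']]] by blast
  have xy: "x \<noteq> y" using y by auto
  let ?g = "case_nat x (case_nat y id) \<circ> lift (lift f)"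
  have e: "rename f (dbSplit M N) = LetP x y (rename f M) (rename ?g N)"
    using dbSplit_eq_LetP[of x y "rename f M" "rename (lift (lift f)) N"] x y xy
    by (simp add: rename_rename)
  from dbSplit.prems[unfolded e] obtain \<Gamma>1 \<Gamma>2 U V where *: "splits (core G) \<Gamma>1 \<Gamma>2"
    "wtM (rename f M) \<Gamma>1 (Prod U V)" "wtM (rename ?g N) (\<Gamma>2(y := live V, x := live U)) T"
    unfolding wtM_LetP by blast
  note s = splits_coreD[OF *(1)]
  have "wtM (rename ?g N) (core (fmupd y V (fmupd x U (fmdrop_set (dom \<Gamma>1) G)))) T"
    using *(3) xy by (simp add: s(4) fun_upd_twist)
  then have n: "fmupd y V (fmupd x U (fmdrop_set (dom \<Gamma>1) G)) \<turnstile>\<^sub>M rename ?g N \<^bold>: T"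
    by (rule dbSplit.IH(2))
  show ?case
    unfolding e
    by (subst s(1), rule T_Split[OF s(2) xy _ _ dbSplit.IH(1) n]) (use *(2) s(3) x y in simp_all)
next
  case (dbESub M N)
  \<comment> \<open>The scope of the binder is \<open>M\<close> without \<open>N\<close>, so
    \<open>dbAbs M\<close> has exactly the names to be avoided.\<close>
  obtain x where x: "x \<notin> fn (rename f (dbAbs M)) \<union> fmdom' G"
    using fresh[OF finite_UnI[OF finite_fn finite_fmdom']] by blast
  let ?g = "case_nat x id \<circ> lift f"
  have e: "rename f (dbESub M N) = ESub (rename ?g M) (rename f N) x"
    using dbESub_eq_ESub[of x "rename (lift f) M" "rename f N"] x by (simp add: rename_rename)
  from dbESub.prems[unfolded e] obtain \<Gamma>1 \<Gamma>2 U where *: "splits (core G) \<Gamma>1 \<Gamma>2"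
    "wtM (rename ?g M) (\<Gamma>1(x := live U)) T" "wtM (rename f N) \<Gamma>2 U"
    unfolding wtM_ESub by blast
  note s = splits_coreD[OF *(1)]
  have "wtM (rename ?g M) (core (fmupd x U (fmrestrict_set (dom \<Gamma>1) G))) T"
    using *(2) by (simp add: s(3))
  then have n: "fmupd x U (fmrestrict_set (dom \<Gamma>1) G) \<turnstile>\<^sub>M rename ?g M \<^bold>: T"
    by (rule dbESub.IH(1))
  show ?case
    unfolding e
    by (subst s(1), rule T_Sub[OF s(2) _ n dbESub.IH(2)])
      (use *(3) s(4) x in \<open>simp_all add: fmdom'_restrict_set_precise\<close>)
next
  case (Case M B)
  from Case.prems obtain \<Gamma>1 \<Gamma>2 Ss where *: "splits (core G) \<Gamma>1 \<Gamma>2"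
    "wtM (rename f M) \<Gamma>1 (Sess (EChoice Ss))" "fmdom' Ss \<noteq> {}" "fmdom' (fmmap (rename f) B) = fmdom' Ss"
    "\<And>i S N. fmlookup Ss i = Some S \<Longrightarrow> fmlookup (fmmap (rename f) B) i = Some N \<Longrightarrow>
      wtM N \<Gamma>2 (Lolli (Sess S) T)"
    unfolding rename.simps wtM_Case by blast
  note s = splits_coreD[OF *(1)]
  have "fmdrop_set (dom \<Gamma>1) G \<turnstile>\<^sub>M N \<^bold>: Lolli (Sess S) T"
    if l: "fmlookup Ss i = Some S" "fmlookup (fmmap (rename f) B) i = Some N" for i S N
  proof -
    obtain N' where N': "fmlookup B i = Some N'" "N = rename f N'" using l(2) by auto
    show ?thesis
      unfolding N'(2) by (rule Case.IH(2)[OF fmran'I[OF N'(1)]]) (use *(5)[OF l] s(4) N'(2) in simp)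
  qed
  note b = this
  have m: "fmrestrict_set (dom \<Gamma>1) G \<turnstile>\<^sub>M rename f M \<^bold>: Sess (EChoice Ss)"
    by (rule Case.IH(1)) (use *(2) s(3) in simp)
  show ?case
    unfolding rename.simps by (subst s(1), rule T_Case[OF s(2) m *(3,4) b])
next
  case (Spawn M)
  then show ?case by (simp add: T_Spawn)
next
  case (Send M)
  then show ?case unfolding rename.simps wtM.simps by (blast intro: T_Send)
next
  case (Recv M)
  then show ?case unfolding rename.simps wtM.simps by (blast intro: T_Recv)
next
  case (Select l M)
  then show ?case unfolding rename.simps wtM.simps by (blast intro: T_Select)
qed

lemma typM_iff: "G \<turnstile>\<^sub>M M \<^bold>: T \<longleftrightarrow> wtM M (core G) T"
  using typM_wtM wtM_typM[of id M, unfolded rename_id] by blast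

text \<open>The buffer rules have no counterpart of \<open>T_EndL\<close>, hence the first premise.\<close>

lemma wtB_typB:
  "(\<And>x. fmlookup G x \<noteq> Some (Sess End)) \<Longrightarrow> wtB ms (core G) S' S \<Longrightarrow> G \<turnstile>\<^sub>B ms \<^bold>: S' \<rhd> S"
proof (induction ms arbitrary: G S rule: rev_induct)
  case Nil
  from Nil(2) have c: "core G = Map.empty" "S = S'" by simp_all
  have "fmlookup G n = None" for n
    using Nil(1)[of n] fun_cong[OF c(1), of n]
    by (cases "fmlookup G n") (auto simp: core_def)
  then have "G = fmempty" by (intro fmap_ext) simp
  then show ?case using c(2) by (simp add: T_Buf)
next
  case (snoc m ms)
  show ?case
  proof (cases m)
    case (Val M)
    from snoc.prems(2)[unfolded Val] obtain \<Gamma>1 \<Gamma>2 T S0 where *: "S = Out T S0" "splits (core G) \<Gamma>1 \<Gamma>2"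
      "wtB ms \<Gamma>1 S' S0" "wtM M \<Gamma>2 T"
      unfolding wtB_snoc by blast
    \<comment> \<open>The message gets the restricted half; the remaining half inherits the absence
      of \<open>end\<close> entries from \<open>G\<close>.\<close>
    note s = splits_coreD[OF splits_sym[OF *(2)]]
    have "fmlookup (fmdrop_set (dom \<Gamma>2) G) x \<noteq> Some (Sess End)" for x
      using snoc.prems(1)[of x] by simp
    then have "fmdrop_set (dom \<Gamma>2) G \<turnstile>\<^sub>B ms \<^bold>: S' \<rhd> S0" using snoc.IH *(3) s(4) by blast
    moreover have "fmrestrict_set (dom \<Gamma>2) G \<turnstile>\<^sub>M M \<^bold>: T" using *(4) s(3) by (simp add: typM_iff)
    ultimately show ?thesis unfolding Val *(1) by (subst s(1)) (rule T_BufSend[OF s(2)])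
  next
    case (Lbl l)
    from snoc.prems(2)[unfolded Lbl] obtain Ss S0 where *: "S = IChoice Ss" "fmlookup Ss l = Some S0"
      "wtB ms (core G) S' S0"
      unfolding wtB_snoc by blast
    show ?thesis unfolding Lbl *(1) by (rule T_BufSelect[OF snoc.IH[OF snoc.prems(1) *(3)] *(2)])
  qed
qed

section \<open>Naming the nameless binders of configurations\<close>

lemma rename_msg_cong:
  assumes "\<And>n. n \<in> fn_msg m \<Longrightarrow> f n = g n"
  shows "rename_msg f m = rename_msg g m"
proof (cases m)
  case (Val M)
  then have "rename f M = rename g M" using assms by (intro rename_cong) simp
  then show ?thesis using Val by simp
qed simp

lemma rename_conf_cong: "(\<And>n. n \<in> fn_conf C \<Longrightarrow> f n = g n) \<Longrightarrow> rename_conf f C = rename_conf g C"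
proof (induction C arbitrary: f g)
  case (Thread \<phi> M)
  then have "rename f M = rename g M" by (intro rename_cong) simp
  then show ?case by simp
next
  case (Par C D)
  have "rename_conf f C = rename_conf g C" using Par.prems by (intro Par.IH(1)) simp
  moreover have "rename_conf f D = rename_conf g D" using Par.prems by (intro Par.IH(2)) simp
  ultimately show ?case by simp
next
  case (dbRes ms C)
  have "lift (lift f) n = lift (lift g) n" if "n \<in> fn_msgs ms \<union> fn_conf C" for n
    using that dbRes.prems by (auto simp: lift_def split: nat.splits)
  note l = this
  have "rename_conf (lift (lift f)) C = rename_conf (lift (lift g)) C"
    using l by (intro dbRes.IH) blast
  moreover have "map (rename_msg (lift (lift f))) ms = map (rename_msg (lift (lift g))) ms"
    using l unfolding fn_msgs_def by (intro map_cong refl rename_msg_cong) blast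
  ultimately show ?case by simp
next
  case (dbCSub C M)
  have "lift f n = lift g n" if "n \<in> fn_conf C" for n
    using that dbCSub.prems by (auto simp: lift_def split: nat.splits)
  then have "rename_conf (lift f) C = rename_conf (lift g) C" by (rule dbCSub.IH)
  moreover have "rename f M = rename g M" using dbCSub.prems by (intro rename_cong) simp
  ultimately show ?case by simp
qed

lemma dbCSub_eq_CSub:
  assumes "x \<notin> fn_conf (dbCSub C M)"
  shows "dbCSub C M = CSub (rename_conf (case_nat x id) C) M x"
proof -
  have "rename_conf (bind1 x \<circ> case_nat x id) C = rename_conf id C"
    using assms by (intro rename_conf_cong) (auto simp: bind1_def split: nat.splits)
  then show ?thesis by (simp only: CSub_def rename_conf_comp rename_conf_id)
qed

lemma dbRes_eq_Res:
  fixes ms :: "'l msg list"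
  assumes "x \<noteq> y" "x \<notin> fn_conf (dbRes ms C)" "y \<notin> fn_conf (dbRes ms C)"
  shows "dbRes ms C = Res x (map (rename_msg (case_nat x (case_nat y id))) ms) y
    (rename_conf (case_nat x (case_nat y id)) C)"
proof -
  let ?g = "bind2 x y \<circ> case_nat x (case_nat y id)"
  have g: "?g n = id n" if "n \<in> fn_msgs ms \<union> fn_conf C" for n
    using assms that by (auto simp: bind2_def split: nat.splits)
  have "rename_conf ?g C = rename_conf id C"
    using g by (intro rename_conf_cong) blast
  moreover have "rename_msg ?g m = rename_msg id m" if "m \<in> set ms" for m :: "'l msg"
    using g that unfolding fn_msgs_def by (intro rename_msg_cong) blast
  then have "map (rename_msg ?g) ms = map (rename_msg id) ms" by simp
  moreover have "rename_msg (bind2 x y) \<circ> rename_msg (case_nat x (case_nat y id)) =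
      (rename_msg ?g :: 'l msg \<Rightarrow> _)"
    by (rule ext) (simp only: o_apply rename_msg_comp)
  ultimately show ?thesis
    by (simp only: Res_def rename_conf_comp rename_conf_id rename_msg_id map_map list.map_id)
qed

lemma finite_fn_conf: "finite (fn_conf C)"
proof (induction C)
  case (dbRes ms C)
  have "finite (fn_msg m)" for m :: "'a msg" by (cases m) (simp_all add: finite_fn)
  then have "finite (fn_msgs ms \<union> fn_conf C)" using dbRes by (simp add: fn_msgs_def)
  then show ?case using finite_vimageI[of "fn_msgs ms \<union> fn_conf C" "Suc \<circ> Suc"]
    by (simp add: vimage_def inj_def)
next
  case (dbCSub C M)
  then show ?case using finite_vimageI[of "fn_conf C" Suc] by (simp add: vimage_def finite_fn)
qed (simp_all add: finite_fn)

lemma wtC_typC: "wtC (rename_conf f C) (core G) \<phi> T \<Longrightarrow> G \<turnstile>\<^sub>C[\<phi>] rename_conf f C \<^bold>: T"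
proof (induction C arbitrary: f G \<phi> T)
  case (Thread \<psi> M)
  then show ?case
    by (cases \<phi>) (auto simp flip: typM_iff intro: T_Main T_Child)
next
  case (Par C D)
  from Par.prems obtain \<Gamma>1 \<Gamma>2 where *: "splits (core G) \<Gamma>1 \<Gamma>2"
    and p: "wtC (rename_conf f C) \<Gamma>1 Child One \<and> wtC (rename_conf f D) \<Gamma>2 \<phi> T \<or>
      wtC (rename_conf f C) \<Gamma>1 \<phi> T \<and> wtC (rename_conf f D) \<Gamma>2 Child One"
    unfolding rename_conf.simps wtC.simps by blast
  note s = splits_coreD[OF *]
  have m: "madd Child \<phi> = Some \<phi>" "madd \<phi> Child = Some \<phi>" by (cases \<phi>; simp)+
  from p show ?case
    unfolding rename_conf.simps
  proof
    assume "wtC (rename_conf f C) \<Gamma>1 Child One \<and> wtC (rename_conf f D) \<Gamma>2 \<phi> T"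
    then show "G \<turnstile>\<^sub>C[\<phi>] rename_conf f C \<parallel> rename_conf f D \<^bold>: T"
      by (subst s(1), intro T_ParL[OF s(2) Par.IH(1) Par.IH(2) m(1)]) (simp_all add: s(3,4))
  next
    assume "wtC (rename_conf f C) \<Gamma>1 \<phi> T \<and> wtC (rename_conf f D) \<Gamma>2 Child One"
    then show "G \<turnstile>\<^sub>C[\<phi>] rename_conf f C \<parallel> rename_conf f D \<^bold>: T"
      by (subst s(1), intro T_ParR[OF s(2) Par.IH(1) Par.IH(2) m(2)]) (simp_all add: s(3,4))
  qed
next
  case (dbCSub C M)
  obtain x where x: "x \<notin> fn_conf (rename_conf f (dbCSub C M)) \<union> fmdom' G"
    using fresh[OF finite_UnI[OF finite_fn_conf finite_fmdom']] by blast
  let ?g = "case_nat x id \<circ> lift f"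
  have e: "rename_conf f (dbCSub C M) = CSub (rename_conf ?g C) (rename f M) x"
    using dbCSub_eq_CSub[of x "rename_conf (lift f) C" "rename f M"] x by (simp add: rename_conf_comp)
  from dbCSub.prems[unfolded e] obtain \<Gamma>1 \<Gamma>2 U where *: "splits (core G) \<Gamma>1 \<Gamma>2"
    "wtC (rename_conf ?g C) (\<Gamma>1(x := live U)) \<phi> T" "wtM (rename f M) \<Gamma>2 U"
    unfolding wtC_CSub by blast
  note s = splits_coreD[OF *(1)]
  have "wtC (rename_conf ?g C) (core (fmupd x U (fmrestrict_set (dom \<Gamma>1) G))) \<phi> T"
    using *(2) by (simp add: s(3))
  then have n: "fmupd x U (fmrestrict_set (dom \<Gamma>1) G) \<turnstile>\<^sub>C[\<phi>] rename_conf ?g C \<^bold>: T"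
    by (rule dbCSub.IH)
  have "fmdrop_set (dom \<Gamma>1) G \<turnstile>\<^sub>M rename f M \<^bold>: U" using *(3) s(4) by (simp add: typM_iff)
  moreover have "x \<notin> fmdom' (fmrestrict_set (dom \<Gamma>1) G)"
    using x by (simp add: fmdom'_restrict_set_precise)
  ultimately show ?case
    unfolding e by (subst s(1)) (intro T_ConfSub[OF s(2) _ n])
next
  case (dbRes ms C)
  obtain x where x: "x \<notin> fn_conf (rename_conf f (dbRes ms C)) \<union> fmdom' G"
    using fresh[OF finite_UnI[OF finite_fn_conf finite_fmdom']] by blast
  obtain y where y: "y \<notin> insert x (fn_conf (rename_conf f (dbRes ms C)) \<union> fmdom' G)"
    using fresh[OF finite.insertI[OF finite_UnI[OF finite_fn_conf finite_fmdom']]] by blast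
  have xy: "x \<noteq> y" using y by auto
  let ?h = "case_nat x (case_nat y id)"
  let ?g = "?h \<circ> lift (lift f)"
  define ns where "ns = map (rename_msg ?h) (map (rename_msg (lift (lift f))) ms)"
  have e: "rename_conf f (dbRes ms C) = Res x ns y (rename_conf ?g C)"
    using dbRes_eq_Res[OF xy, of "map (rename_msg (lift (lift f))) ms" "rename_conf (lift (lift f)) C"] x y
    unfolding ns_def by (simp add: rename_conf_comp)
  from dbRes.prems[unfolded e] obtain \<Gamma>1 \<Gamma>2 S S' where a:
    "splits ((core G)(y := live (Sess (dual S)), x := live (Sess S'))) \<Gamma>1 \<Gamma>2"
    "\<Gamma>1 x = None" "wtB ns \<Gamma>1 S' S" "wtC (rename_conf ?g C) \<Gamma>2 \<phi> T"
    unfolding wtC_Res_neq[OF xy] by blast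
  have gx: "fmlookup G x = None" "fmlookup G y = None" "core G x = None" "core G y = None"
    using x y by (auto dest: fmdom'_notD core_notin)
  let ?G1 = "fmrestrict_set (dom \<Gamma>1) G" and ?G2 = "fmdrop_set (dom \<Gamma>1) G"
  have j: "?G1 \<diamondop> ?G2" "?G1 ++\<^sub>f ?G2 = G" "{x, y} \<inter> fmdom' (?G1 ++\<^sub>f ?G2) = {}"
  proof -
    show "?G1 \<diamondop> ?G2"
      unfolding disj_def fmdom'_restrict_set_precise fmdom'_drop_set by blast
    show "?G1 ++\<^sub>f ?G2 = G" by (rule fmap_ext) (auto simp: fmlookup_dom_iff)
    then show "{x, y} \<inter> fmdom' (?G1 ++\<^sub>f ?G2) = {}" using x y by simp
  qed
  \<comment> \<open>The splitting concerns the core of \<open>G\<close> extended by \<open>x\<close>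
    and \<open>y\<close>. Agreement with the halves of \<open>G\<close> is shown away from these
    names, which are then treated separately.\<close>
  have l: "\<Gamma>1 n = None \<and> core G n = \<Gamma>2 n \<or> \<Gamma>2 n = None \<and> core G n = \<Gamma>1 n" if "n \<noteq> x" "n \<noteq> y" for n
    using a(1)[unfolded splits_def, rule_format, of n] that by auto
  have lx: "\<Gamma>2 x = live (Sess S')"
    using a(1)[unfolded splits_def, rule_format, of x] a(2) by auto
  have ly: "\<Gamma>1 y = None \<and> \<Gamma>2 y = live (Sess (dual S)) \<or> \<Gamma>2 y = None \<and> \<Gamma>1 y = live (Sess (dual S))"
    using a(1)[unfolded splits_def, rule_format, of y] xy by auto
  have 1: "core ?G1 n = \<Gamma>1 n" "core ?G2 n = \<Gamma>2 n" if "n \<noteq> x" "n \<noteq> y" for n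
  proof -
    show "core ?G1 n = \<Gamma>1 n" using l[OF that] by (cases "\<Gamma>1 n") (auto simp: core_def)
    show "core ?G2 n = \<Gamma>2 n" using l[OF that] by (cases "\<Gamma>1 n") (auto simp: core_def)
  qed
  \<comment> \<open>\<open>dom \<Gamma>1\<close> has only live entries, so every \<open>end\<close>
    entry of \<open>G\<close> falls to the body; the buffer judgement could not absorb it.\<close>
  have f: "fmlookup ?G1 n \<noteq> Some (Sess End)" for n
  proof
    assume "fmlookup ?G1 n = Some (Sess End)"
    then have "n \<in> dom \<Gamma>1" and n: "fmlookup G n = Some (Sess End)"
      by (auto simp del: domIff split: if_splits)
    then have "\<Gamma>1 n \<noteq> None" "core G n = None" by (auto simp: core_def)
    moreover have "n \<noteq> x" "n \<noteq> y" using n gx(1,2) by auto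
    ultimately show False using l[of n] by auto
  qed
  show ?case
  \<comment> \<open>The place of the reading endpoint selects the rule: \<open>T_ResBuf\<close> if
    the buffer holds its entry, \<open>T_Res\<close> otherwise. If \<open>dual S\<close> is
    \<open>end\<close>, neither side has an entry and \<open>T_Res\<close> applies.\<close>
  proof (cases "\<Gamma>1 y")
    case None
    have "core ?G1 = \<Gamma>1"
    proof
      show "core ?G1 n = \<Gamma>1 n" for n
        using 1(1)[of n] None a(2) by (cases "n = x"; cases "n = y") (auto simp: core_def)
    qed
    then have b: "?G1 \<turnstile>\<^sub>B ns \<^bold>: S' \<rhd> S" using wtB_typB[OF f] a(3) by simp
    have "core (fmupd y (Sess (dual S)) (fmupd x (Sess S') ?G2)) = \<Gamma>2"
    proof
      show "core (fmupd y (Sess (dual S)) (fmupd x (Sess S') ?G2)) n = \<Gamma>2 n" for n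
        using 1(2)[of n] None ly lx xy by (cases "n = x"; cases "n = y") (auto simp: live_def)
    qed
    then have "fmupd y (Sess (dual S)) (fmupd x (Sess S') ?G2) \<turnstile>\<^sub>C[\<phi>] rename_conf ?g C \<^bold>: T"
      using dbRes.IH a(4) by metis
    then show ?thesis unfolding e using T_Res[OF j(1) xy j(3) b] j(2) by simp
  next
    case (Some V)
    then have ly': "\<Gamma>2 y = None" "\<Gamma>1 y = live (Sess (dual S))" "dual S \<noteq> End" using ly by auto
    have "core (fmupd y (Sess (dual S)) ?G1) = \<Gamma>1"
    proof
      show "core (fmupd y (Sess (dual S)) ?G1) n = \<Gamma>1 n" for n
        using 1(1)[of n] ly' a(2) by (cases "n = x"; cases "n = y") (auto simp: core_def)
    qed
    moreover have "fmlookup (fmupd y (Sess (dual S)) ?G1) n \<noteq> Some (Sess End)" for n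
      using f[of n] ly'(3) by auto
    ultimately have b: "fmupd y (Sess (dual S)) ?G1 \<turnstile>\<^sub>B ns \<^bold>: S' \<rhd> S"
      using wtB_typB[of "fmupd y (Sess (dual S)) ?G1"] a(3) by simp
    have "core (fmupd x (Sess S') ?G2) = \<Gamma>2"
    proof
      show "core (fmupd x (Sess S') ?G2) n = \<Gamma>2 n" for n
        using 1(2)[of n] ly' lx gx by (cases "n = x"; cases "n = y") (auto simp: core_def)
    qed
    then have "fmupd x (Sess S') ?G2 \<turnstile>\<^sub>C[\<phi>] rename_conf ?g C \<^bold>: T"
      using dbRes.IH a(4) by metis
    then show ?thesis unfolding e using T_ResBuf[OF j(1) xy j(3) b] j(2) by simp
  qed
qed

lemma typC_iff: "G \<turnstile>\<^sub>C[\<phi>] C \<^bold>: T \<longleftrightarrow> wtC C (core G) \<phi> T"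
  using typC_wtC wtC_typC[of id C, unfolded rename_conf_id] by blast

theorem theorem2p6:
  fixes \<Gamma> :: "'l env" and \<phi> :: marker and C D :: "'l conf" and T :: "'l ty"
  assumes "\<Gamma> \<turnstile>\<^sub>C[\<phi>] C \<^bold>: T"
    and "C \<equiv>\<^sub>C D \<or> C \<longrightarrow>\<^sub>C D"
  shows "\<Gamma> \<turnstile>\<^sub>C[\<phi>] D \<^bold>: T"
  using assms wtC_scongC wtC_redC unfolding typC_iff by metis

end
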